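(* Let $d\ge1$, $\alpha>\frac{d-1}{2}$ and $\beta-\alpha>\frac{d-1}{2}$. Let $w:\mathcal{P}_d\to\mathrm{GL}_d$ be a measurable function such that $x=w(x)^\top w(x)$ for all $x\in\mathcal{P}_d$, and write $T_y(x):=w(y)^\top x\,w(y)$ for $x,y\in\mathcal{P}_d$. Let $(X(n),n\ge1)$ be i.i.d. random matrices with the distribution $\mathrm{B}^{\mathrm{II}}_d(\alpha,\beta)$ and let $$Z_\infty:=\sum_{k=1}^\infty T_{X(1)}\circ T_{X(2)}\circ\cdots\circ T_{X(k)}(I).$$ Let $X\sim\mathrm{B}^{\mathrm{II}}_d(\alpha,\beta)$ and consider the stochastic equation $$Z\stackrel{\mathrm{d}}{=}T_X(I+Z)$$ for a random matrix $Z$ in $\mathcal{P}_d$ independent of $X$. Then the distribution $\mathscr{L}(Z_\infty)$ of $Z_\infty$ is the unique solution to this equation, and $\mathscr{L}(Z_\infty)=\mathrm{B}^{\mathrm{II}}_d(\alpha,\beta-\alpha)$.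
   Context: $\mathcal{P}_d$ is the set of $d\times d$ real symmetric positive definite matrices, $\mathrm{GL}_d$ the group of invertible $d\times d$ real matrices; $|x|$ is the determinant, $\mathrm{tr}[x]$ the trace, $I$ the identity matrix. $\mu(\mathrm{d}x):=|x|^{-(d+1)/2}\prod_{1\le i\le j\le d}\mathrm{d}x_{ij}$ on $\mathcal{P}_d$. For parameters $>\frac{d-1}{2}$, $\Gamma_d(\alpha):=\int_{\mathcal{P}_d}|x|^\alpha e^{-\mathrm{tr}[x]}\mu(\mathrm{d}x)$, $B_d(\alpha,\beta):=\Gamma_d(\alpha)\Gamma_d(\beta)/\Gamma_d(\alpha+\beta)$, and the matrix Beta type II distribution $\mathrm{B}^{\mathrm{II}}_d(\alpha,\beta)$ is $B_d(\alpha,\beta)^{-1}|x|^\alpha|I+x|^{-(\alpha+\beta)}\mu(\mathrm{d}x)$. $\stackrel{\mathrm{d}}{=}$ denotes equality in distribution. Under the stated conditions on $\alpha,\beta$ the series defining $Z_\infty$ converges almost surely, to a random matrix in $\mathcal{P}_d$. *)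

theory Defs
  imports "HOL-Probability.Probability"
begin

definition posdef :: "(real^'d^'d) set" where
  "posdef = {x. transpose x = x \<and> (\<forall>v. v \<noteq> 0 \<longrightarrow> v \<bullet> (x *v v) > 0)}"

abbreviation posdef_borel :: "(real^'d^'d) measure" where
  "posdef_borel \<equiv> restrict_space borel posdef"

text \<open>A symmetric matrix has one free coordinate \<open>x\<^sub>i\<^sub>j = x\<^sub>j\<^sub>i\<close> for each unordered pair
  \<open>{i, j}\<close> (with \<open>i = j\<close> allowed). Indexing the coordinates by these pairs instead of by
  the pairs \<open>i \<le> j\<close> avoids choosing a linear order on the index type.\<close>

definition sym_of_coords :: "('d set \<Rightarrow> real) \<Rightarrow> real^'d^'d" where
  "sym_of_coords f = (\<chi> i j. f {i, j})"

definition sym_lebesgue :: "(real^'d^'d) measure" where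
  "sym_lebesgue =
     distr (\<Pi>\<^sub>M p\<in>{{i, j} | i j. True}. (lborel :: real measure)) borel sym_of_coords"

text \<open>Measures on the cone \<open>posdef\<close> are represented as Borel measures on the space of all
  matrices that vanish off \<open>posdef\<close>.\<close>

definition mu :: "(real^'d^'d) measure" where
  "mu = density sym_lebesgue
     (\<lambda>x. indicator posdef x * ennreal (det x powr (- (real CARD('d) + 1) / 2)))"

definition mGamma :: "'d::finite itself \<Rightarrow> real \<Rightarrow> real" where
  "mGamma _ \<alpha> =
     (\<integral>x. det x powr \<alpha> * exp (- trace x) \<partial>(mu :: (real^'d^'d) measure))"

definition mBeta :: "'d::finite itself \<Rightarrow> real \<Rightarrow> real \<Rightarrow> real" where
  "mBeta D \<alpha> \<beta> = mGamma D \<alpha> * mGamma D \<beta> / mGamma D (\<alpha> + \<beta>)"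

definition BetaII :: "real \<Rightarrow> real \<Rightarrow> (real^'d^'d) measure" where
  "BetaII \<alpha> \<beta> = density mu
     (\<lambda>x. ennreal (det x powr \<alpha> * det (mat 1 + x) powr (- (\<alpha> + \<beta>))
                    / mBeta TYPE('d) \<alpha> \<beta>))"

definition T :: "(real^'d^'d \<Rightarrow> real^'d^'d) \<Rightarrow> real^'d^'d \<Rightarrow> real^'d^'d \<Rightarrow> real^'d^'d"
  where "T w y x = transpose (w y) ** x ** w y"

text \<open>\<open>T_iter w x k\<close> is \<open>(T w (x 1) \<circ> \<dots> \<circ> T w (x k)) (mat 1)\<close>.\<close>

definition T_iter :: "(real^'d^'d \<Rightarrow> real^'d^'d) \<Rightarrow> (nat \<Rightarrow> real^'d^'d) \<Rightarrow> nat \<Rightarrow> real^'d^'d"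
  where "T_iter w x k = foldr (\<lambda>n. T w (x n)) [1..<Suc k] (mat 1)"

definition Z_inf :: "(real^'d^'d \<Rightarrow> real^'d^'d) \<Rightarrow> (nat \<Rightarrow> real^'d^'d) \<Rightarrow> real^'d^'d"
  where "Z_inf w x = (\<Sum>k. T_iter w x (Suc k))"

text \<open>\<open>Y \<sim> BetaII \<alpha> \<beta>\<close> and \<open>Z\<close> are independent random matrices in \<open>posdef\<close>, defined on the
  probability space \<open>N\<close>, and \<open>Z\<close> satisfies the equation in distribution
  \<open>Z = T\<^sub>Y (I + Z)\<close>. The predicate \<open>indep_var\<close> includes the measurability of both
  variables into \<open>posdef_borel\<close>.\<close>

definition solves_eq ::
  "(real^'d^'d \<Rightarrow> real^'d^'d) \<Rightarrow> real \<Rightarrow> real \<Rightarrow> 'b measure \<Rightarrow>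
    ('b \<Rightarrow> real^'d^'d) \<Rightarrow> ('b \<Rightarrow> real^'d^'d) \<Rightarrow> bool"
  where "solves_eq w \<alpha> \<beta> N Y Z \<longleftrightarrow>
    prob_space N \<and>
    prob_space.indep_var N posdef_borel Y posdef_borel Z \<and>
    distr N borel Y = BetaII \<alpha> \<beta> \<and>
    distr N borel Z = distr N borel (\<lambda>\<omega>. T w (Y \<omega>) (mat 1 + Z \<omega>))"

end

(*
  Put d = CARD('d). The Lebesgue measure on symmetric matrices is multiplied by |det g|^-(d+1)
  under x -> g^T x g: up to a constant this is uniqueness of translation invariant measures, and
  the constant is a multiplicative function of g, hence determined by diagonal matrices and
  involutions. So mu is invariant under congruences, and Fubini together with such substitutions
  gives all the integrals that are needed: the Beta integral and an Euler type integral, which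
  together say that BetaII alpha (beta - alpha) solves the equation in distribution. Finiteness of
  the Gamma function for all parameters > (d-1)/2 comes from the fact that det x is affine in each
  diagonal entry, which allows to add one row and column at a time.

  For the perpetuity, let R_n = T_{X1}(I + T_{X2}(I + ... T_{Xn}(I + Z_0))) with Z_0 independent of
  the X_i and distributed according to any solution nu. Every R_n has law nu, and R_n is the n-th
  partial sum S_n of the series plus the image of Z_0 under T_{X1} ... T_{Xn}. As S_n <= R_n, the
  traces of the S_n are bounded in probability, so the series converges a.s.; its terms then tend
  to 0, hence so does the contribution of Z_0, and R_n converges a.s. to Z_inf. So Z_inf has law nu.
*)

theory Submission
  imports Defs
begin

section \<open>Positive definite matrices\<close>

text \<open>The Euler type integral is the equation written for densities.
  \<open>T w x (mat 1 + z)\<close> is \<open>x\<close> plus a congruence of \<open>z\<close>, and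
  \<open>mu\<close> is invariant under congruences, so the choice of the root \<open>w\<close>
  disappears once \<open>z\<close> is integrated. What remains at a point v is an integral over 0 <
  x < v of powers of |x|, |I + x| and |v - x|. The negative power of |I + x| is traded for a Gamma
  integral, after which only linear substitutions and Fubini occur. All these identities are stated
  for nonnegative extended integrals, with Gamma factors multiplied out instead of divided by.
  Integrability therefore enters only where constants are cancelled or \<open>mGamma\<close> is
  evaluated; there Gamma must be finite and non-zero. For the perpetuity, existence feeds into
  convergence: the bound on the partial sums presupposes some stationary law, and the Beta law
  supplies one. As \<open>w\<close> is measurable only on \<open>posdef\<close>, while laws live on
  all matrices, \<open>w\<close> is first extended to a total measurable function, and the equation
  is restated as the property \<open>stationary\<close> of a law alone.\<close>

lemma posdefI:
  "transpose x = x \<Longrightarrow> (\<And>v. v \<noteq> 0 \<Longrightarrow> v \<bullet> (x *v v) > 0) \<Longrightarrow> x \<in> posdef"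
  by (simp add: posdef_def)

lemma posdef_sym: "x \<in> posdef \<Longrightarrow> transpose x = x"
  and posdef_pos: "x \<in> posdef \<Longrightarrow> v \<noteq> 0 \<Longrightarrow> v \<bullet> (x *v v) > 0"
  and posdef_nonneg: "x \<in> posdef \<Longrightarrow> v \<bullet> (x *v v) \<ge> 0"
proof -
  assume x: "x \<in> posdef"
  show "transpose x = x" "v \<noteq> 0 \<Longrightarrow> v \<bullet> (x *v v) > 0" using x by (auto simp: posdef_def)
  show "v \<bullet> (x *v v) \<ge> 0" using x by (cases "v = 0") (auto simp: posdef_def intro: less_imp_le)
qed

lemma transpose_add: "transpose (x + y) = transpose x + transpose (y :: 'a::plus^'n^'m)"
  by (simp add: transpose_def vec_eq_iff)

lemma posdef_add:
  assumes "x \<in> posdef" "y \<in> posdef" shows "x + y \<in> posdef"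
  using assms by (auto simp: posdef_def transpose_add matrix_vector_mult_add_rdistrib inner_add_right
      intro: add_pos_pos)

lemma posdef_mat1: "mat 1 \<in> posdef"
  by (simp add: posdef_def transpose_mat)

lemma posdef_diag_pos: "x \<in> posdef \<Longrightarrow> x $ i $ i > 0"
  using posdef_pos[of x "axis i 1"]
  by (simp add: inner_axis' matrix_vector_mul_component inner_axis)

lemma inner_congr:
  fixes g x :: "real^'d^'d"
  shows "u \<bullet> ((transpose g ** x ** g) *v v) = (g *v u) \<bullet> (x *v (g *v v))"
  by (metis (no_types, lifting) dot_lmul_matrix matrix_vector_mul_assoc vector_transpose_matrix transpose_transpose)

lemma transpose_congr: "transpose x = x \<Longrightarrow> transpose (transpose g ** x ** g) = transpose g ** x ** (g::real^'d^'d)"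
  by (simp add: matrix_transpose_mul matrix_mul_assoc)

lemma posdef_congr:
  fixes g :: "real^'d^'d"
  assumes g: "invertible g" and x: "x \<in> posdef"
  shows "transpose g ** x ** g \<in> posdef"
proof (rule posdefI)
  show "transpose (transpose g ** x ** g) = transpose g ** x ** g"
    using x by (intro transpose_congr posdef_sym)
  fix v :: "real^'d" assume "v \<noteq> 0"
  then have "g *v v \<noteq> 0"
    using g by (metis inj_eq inj_matrix_vector_mult matrix_vector_mult_0_right)
  then show "0 < v \<bullet> ((transpose g ** x ** g) *v v)" unfolding inner_congr by (rule posdef_pos[OF x])
qed

lemma posdef_congr_iff:
  fixes g :: "real^'d^'d"
  assumes g: "invertible g"
  shows "transpose g ** x ** g \<in> posdef \<longleftrightarrow> x \<in> posdef"
proof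
  assume "transpose g ** x ** g \<in> posdef"
  moreover obtain h where h: "g ** h = mat 1" "h ** g = mat 1"
    using g by (auto simp: invertible_def)
  moreover from h have "invertible h" by (auto simp: invertible_def)
  ultimately have "transpose h ** (transpose g ** x ** g) ** h \<in> posdef"
    using posdef_congr by blast
  moreover have "transpose h ** (transpose g ** x ** g) ** h = transpose (g ** h) ** x ** (g ** h)"
    by (simp add: matrix_transpose_mul matrix_mul_assoc)
  ultimately show "x \<in> posdef" by (simp add: h transpose_mat)
qed (rule posdef_congr[OF g])

lemma posdef_invertible: "x \<in> posdef \<Longrightarrow> invertible x"
proof -
  assume x: "x \<in> posdef"
  have "inj ((*v) x)"
    unfolding linear_injective_0[OF matrix_vector_mul_linear] using posdef_pos[OF x]
    by (metis inner_zero_right less_irrefl)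
  then show ?thesis by (simp add: invertible_left_inverse matrix_left_invertible_injective)
qed

lemma continuous_on_det [continuous_intros]:
  fixes f :: "'a::topological_space \<Rightarrow> real^'d^'d"
  assumes "continuous_on S f" shows "continuous_on S (\<lambda>x. det (f x))"
  unfolding det_def using assms by (intro continuous_intros)

lemma continuous_on_matrix_mult [continuous_intros]:
  fixes f :: "'a::topological_space \<Rightarrow> real^'n^'m" and g :: "'a \<Rightarrow> real^'k^'n"
  assumes "continuous_on S f" "continuous_on S g" shows "continuous_on S (\<lambda>x. f x ** g x)"
  unfolding matrix_matrix_mult_def using assms by (intro continuous_intros)

lemma continuous_on_transpose [continuous_intros]:
  fixes f :: "'a::topological_space \<Rightarrow> real^'n^'m"
  assumes "continuous_on S f" shows "continuous_on S (\<lambda>x. transpose (f x))"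
  unfolding transpose_def using assms by (intro continuous_intros)

lemma continuous_on_trace [continuous_intros]:
  fixes f :: "'a::topological_space \<Rightarrow> real^'n^'n"
  assumes "continuous_on S f" shows "continuous_on S (\<lambda>x. trace (f x))"
  unfolding trace_def using assms by (intro continuous_intros)

text \<open>The segment from I to \<open>x\<close> stays in the cone, where every matrix is
  invertible, so by the intermediate value theorem the determinant cannot leave the sign it has at
  I.\<close>

lemma posdef_det_pos: "x \<in> posdef \<Longrightarrow> det (x :: real^'d^'d) > 0"
proof (rule ccontr)
  assume x: "x \<in> posdef" and n: "\<not> det x > 0"
  define p where "p t = t *\<^sub>R x + (1 - t) *\<^sub>R (mat 1 :: real^'d^'d)" for t :: real
  have pd: "p t \<in> posdef" if "0 \<le> t" "t \<le> 1" for t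
  proof (rule posdefI)
    show "transpose (p t) = p t"
      using posdef_sym[OF x] by (simp add: p_def transpose_add transpose_scalar transpose_mat scalar_mult_eq_scaleR[symmetric])
    fix v :: "real^'d" assume v: "v \<noteq> 0"
    have "v \<bullet> (p t *v v) = t * (v \<bullet> (x *v v)) + (1 - t) * (v \<bullet> v)"
      by (simp add: p_def matrix_vector_mult_add_rdistrib inner_add_right scaleR_matrix_vector_assoc[symmetric])
    moreover have "v \<bullet> (x *v v) > 0" "v \<bullet> v > 0" using v posdef_pos[OF x] by auto
    ultimately show "0 < v \<bullet> (p t *v v)" using that
      by (cases "t = 0") (auto intro!: add_pos_nonneg)
  qed
  have "continuous_on {0..1} (\<lambda>t. - det (p t))" unfolding p_def by (intro continuous_intros)
  moreover have "- det (p 0) \<le> 0" "0 \<le> - det (p 1)" using n by (auto simp: p_def)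
  ultimately have "\<exists>t\<ge>0. t \<le> 1 \<and> - det (p t) = 0" by (intro IVT') auto
  then obtain t where t: "0 \<le> t" "t \<le> 1" "det (p t) = 0" by auto
  from posdef_invertible[OF pd[OF t(1,2)]] t(3) show False by (simp add: invertible_det_nz)
qed

text \<open>Testing the quadratic form on the sum and the difference of two unit vectors gives twice
  the off-diagonal entry as at most the sum of the two diagonal ones. Semidefiniteness suffices, and
  it is in this generality that the terms of the series are bounded later.\<close>

lemma posdef_entry_le_trace:
  fixes x :: "real^'d^'d"
  assumes s: "transpose x = x" and p: "\<And>v. v \<bullet> (x *v v) \<ge> 0"
  shows "\<bar>x $ i $ j\<bar> \<le> trace x"
proof -
  have e: "axis a 1 \<bullet> (x *v axis b 1) = x $ a $ b" for a b
    by (simp add: inner_axis' matrix_vector_mul_component inner_axis)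
  have nn: "x $ a $ a \<ge> 0" for a using p[of "axis a 1"] by (simp add: e)
  have sy: "x $ j $ i = x $ i $ j" using s by (metis transpose_def vec_lambda_beta)
  show ?thesis
  proof (cases "i = j")
    case True
    have "x $ i $ i \<le> trace x" unfolding trace_def by (rule member_le_sum) (auto simp: nn)
    with True nn show ?thesis by simp
  next
    case False
    have "x $ i $ i + x $ j $ j = (\<Sum>k\<in>{i,j}. x $ k $ k)" using False by simp
    also have "\<dots> \<le> trace x" unfolding trace_def by (rule sum_mono2) (auto simp: nn)
    finally have t: "x $ i $ i + x $ j $ j \<le> trace x" .
    have "x $ i $ i + x $ j $ j + 2 * x $ i $ j \<ge> 0"
      using p[of "axis i 1 + axis j 1"] sy
      by (simp add: matrix_vector_right_distrib inner_add_left inner_add_right e)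
    moreover have "x $ i $ i + x $ j $ j - 2 * x $ i $ j \<ge> 0"
      using p[of "axis i 1 - axis j 1"] sy
      by (simp add: matrix_vector_mult_diff_distrib inner_diff_left inner_diff_right e)
    ultimately show ?thesis using t nn[of i] nn[of j] by linarith
  qed
qed

text \<open>The condition ranges over uncountably many vectors. Compactness of the unit sphere gives
  each positive definite matrix a uniform lower bound 1/(n+1), which exhibits the cone as a
  countable union of closed sets.\<close>

lemma posdef_measurable [measurable]: "(posdef :: (real^'d^'d) set) \<in> sets borel"
proof -
  let ?A = "\<lambda>n::nat. {x::real^'d^'d. transpose x = x} \<inter> (\<Inter>v. {x. v \<bullet> (x *v v) \<ge> (v \<bullet> v) / real (Suc n)})"
  have cont: "continuous_on UNIV (\<lambda>x::real^'d^'d. v \<bullet> (x *v v))" for v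
    unfolding inner_vec_def matrix_vector_mult_def by (intro continuous_intros)
  have "?A n \<in> sets borel" for n
    by (intro borel_closed closed_Int closed_INT ballI closed_Collect_eq closed_Collect_le continuous_intros cont)
  then have "(\<Union>n. ?A n) \<in> sets borel" by blast
  moreover have "posdef = (\<Union>n. ?A n)"
  proof (intro equalityI subsetI)
    fix x :: "real^'d^'d" assume x: "x \<in> posdef"
    have cont_v: "continuous_on (sphere 0 1) (\<lambda>v::real^'d. v \<bullet> (x *v v))"
      by (intro continuous_intros linear_continuous_on matrix_vector_mul_bounded_linear)
    have "axis undefined 1 \<in> (sphere 0 1 :: (real^'d) set)" by simp
    then have "sphere 0 1 \<noteq> ({} :: (real^'d) set)" by blast
    from continuous_attains_inf[OF compact_sphere this cont_v]
    obtain u where u: "u \<in> sphere 0 1" and le: "\<And>v. v \<in> sphere 0 1 \<Longrightarrow> u \<bullet> (x *v u) \<le> v \<bullet> (x *v v)"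
      by blast
    have "u \<bullet> (x *v u) > 0" using x u by (intro posdef_pos) auto
    then obtain n where n: "1 / real (Suc n) < u \<bullet> (x *v u)"
      using reals_Archimedean by (metis inverse_eq_divide)
    have "v \<bullet> (x *v v) \<ge> (v \<bullet> v) / real (Suc n)" for v
    proof (cases "v = 0")
      case False
      have "1 / real (Suc n) \<le> (v /\<^sub>R norm v) \<bullet> (x *v (v /\<^sub>R norm v))"
        using n False by (intro order.trans[OF less_imp_le le]) auto
      also have "\<dots> = (v \<bullet> (x *v v)) / (norm v)\<^sup>2"
        by (simp add: matrix_vector_mult_scaleR power2_eq_square divide_simps)
      finally show ?thesis using False by (simp add: power2_norm_eq_inner divide_simps mult.commute)
    qed auto
    with posdef_sym[OF x] show "x \<in> (\<Union>n. ?A n)" by auto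
  next
    fix x assume "x \<in> (\<Union>n. ?A n)"
    then obtain n where "transpose x = x" and n: "\<And>v. v \<bullet> (x *v v) \<ge> (v \<bullet> v) / real (Suc n)" by auto
    then show "x \<in> posdef"
      by (intro posdefI) (auto intro!: less_le_trans[OF _ n] divide_pos_pos)
  qed
  ultimately show ?thesis by (simp only:)
qed

section \<open>Diagonalisation and square roots\<close>

lemma sum_remove_pair: "finite A \<Longrightarrow> i \<in> A \<Longrightarrow> j \<in> A \<Longrightarrow> i \<noteq> j \<Longrightarrow> sum f A = f i + f j + sum f (A - {i,j})"
  for f :: "'b \<Rightarrow> 'a::comm_monoid_add"
proof -
  assume A: "finite A" "i \<in> A" "j \<in> A" "i \<noteq> j"
  have "sum f A = f i + sum f (A - {i})" by (rule sum.remove) (use A in auto)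
  also have "sum f (A - {i}) = f j + sum f (A - {i} - {j})" by (rule sum.remove) (use A in auto)
  also have "A - {i} - {j} = A - {i,j}" by auto
  finally show ?thesis by (simp add: add.assoc)
qed

text \<open>Among all orthonormal bases, one that maximises the sum of the squared diagonal entries
  diagonalises \<open>x\<close>: if an off-diagonal entry were non-zero, the rotation in the corresponding
  coordinate plane that annihilates it would increase this sum.\<close>

lemma symmetric_diagonalization:
  fixes x :: "real^'d^'d"
  assumes s: "transpose x = x"
  obtains Q where "orthogonal_matrix Q" "\<And>k l. k \<noteq> l \<Longrightarrow> (Q ** x ** transpose Q) $ k $ l = 0"
proof -
  define Ob where "Ob = {Q :: real^'d^'d. Q ** transpose Q = mat 1}"
  define m where "m Q k l = (Q $ k) \<bullet> (x *v (Q $ l))" for Q :: "real^'d^'d" and k l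
  define f where "f Q = (\<Sum>k\<in>UNIV. (m Q k k)\<^sup>2)" for Q
  have O_iff: "Q \<in> Ob \<longleftrightarrow> (\<forall>k l. (Q $ k) \<bullet> (Q $ l) = (if k = l then 1 else 0))" for Q
    by (simp add: Ob_def vec_eq_iff matrix_matrix_mult_def transpose_def mat_def inner_vec_def)
  have "closed Ob" unfolding Ob_def transpose_def
    by (intro closed_Collect_eq continuous_intros)
  moreover have "bounded Ob"
  proof (rule boundedI)
    fix Q assume Q: "Q \<in> Ob"
    have "norm Q \<le> (\<Sum>i\<in>UNIV. norm (Q $ i))" unfolding norm_vec_def by (rule L2_set_le_sum) simp
    also have "norm (Q $ i) = 1" for i using Q by (simp add: O_iff norm_eq_1)
    then have "(\<Sum>i\<in>UNIV. norm (Q $ i)) = real CARD('d)" by simp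
    finally show "norm Q \<le> real CARD('d)" by simp
  qed
  ultimately have "compact Ob" by (simp add: compact_eq_bounded_closed)
  moreover have "mat 1 \<in> Ob" by (simp add: Ob_def)
  moreover have "continuous_on Ob f" unfolding f_def m_def inner_vec_def matrix_vector_mult_def
    by (intro continuous_intros)
  ultimately obtain Q where Q: "Q \<in> Ob" and max: "\<And>R. R \<in> Ob \<Longrightarrow> f R \<le> f Q"
    using continuous_attains_sup[of Ob f] by blast
  have sym: "m Q k l = m Q l k" for k l
    unfolding m_def by (metis dot_lmul_matrix inner_commute s vector_transpose_matrix)
  have "m Q i j = 0" if ij: "i \<noteq> j" for i j
  proof (rule ccontr)
    assume b: "m Q i j \<noteq> 0"
    let ?a = "m Q i i" let ?c = "m Q j j" let ?b = "m Q i j"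
    \<comment> \<open>\<open>D\<close> is the gap between the eigenvalues of the 2 by 2 block with
      entries a, b, c. The point ((a - c)/D, 2b/D) of the unit circle determines twice the angle of
      the rotation that diagonalises the block.\<close>
    define D where "D = sqrt ((?a - ?c)\<^sup>2 + (2 * ?b)\<^sup>2)"
    have D2: "D\<^sup>2 = (?a - ?c)\<^sup>2 + (2 * ?b)\<^sup>2" by (simp add: D_def)
    have "D > 0" using b by (auto simp: D_def add_nonneg_pos)
    then have "((?a - ?c) / D)\<^sup>2 + (2 * ?b / D)\<^sup>2 = 1"
      by (simp only: power_divide add_divide_distrib[symmetric] D2[symmetric]) simp
    then obtain t where t: "(?a - ?c) / D = cos t" "2 * ?b / D = sin t"
      by (metis sincos_total_2pi)
    define C where "C = cos (t/2)" define S where "S = sin (t/2)"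
    have CS: "C * C + S * S = 1" unfolding C_def S_def
      using sin_cos_squared_add3[of "t/2"] by simp
    have ct: "cos t = C * C - S * S" "sin t = 2 * S * C"
      using cos_double[of "t/2"] sin_double[of "t/2"] by (auto simp: C_def S_def power2_eq_square)
    define R where "R = (\<chi> k. if k = i then C *\<^sub>R (Q $ i) + S *\<^sub>R (Q $ j)
        else if k = j then C *\<^sub>R (Q $ j) - S *\<^sub>R (Q $ i) else Q $ k)"
    have q: "(Q $ k) \<bullet> (Q $ l) = (if k = l then 1 else 0)" for k l using Q by (simp add: O_iff)
    have "R \<in> Ob"
      unfolding O_iff using ij CS
      by (auto simp: R_def inner_add_left inner_add_right inner_diff_left inner_diff_right q)
    then have le: "f R \<le> f Q" by (rule max)
    have ri: "m R i i = C * C * ?a + 2 * (S * C) * ?b + S * S * ?c"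
      using ij sym[of j i] by (simp add: R_def m_def inner_add_left inner_add_right matrix_vector_right_distrib
        matrix_vector_mult_scaleR algebra_simps)
    have rj: "m R j j = S * S * ?a - 2 * (S * C) * ?b + C * C * ?c"
      using ij sym[of j i] by (simp add: R_def m_def inner_diff_left inner_diff_right matrix_vector_mult_diff_distrib
        matrix_vector_mult_scaleR algebra_simps)
    have rk: "m R k k = m Q k k" if "k \<notin> {i,j}" for k using that by (auto simp: R_def m_def)
    have "f R = (m R i i)\<^sup>2 + (m R j j)\<^sup>2 + (\<Sum>k\<in>UNIV - {i,j}. (m R k k)\<^sup>2)"
      unfolding f_def using ij by (intro sum_remove_pair) auto
    moreover have "f Q = ?a\<^sup>2 + ?c\<^sup>2 + (\<Sum>k\<in>UNIV - {i,j}. (m Q k k)\<^sup>2)"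
      unfolding f_def using ij by (intro sum_remove_pair) auto
    moreover have "(\<Sum>k\<in>UNIV - {i,j}. (m R k k)\<^sup>2) = (\<Sum>k\<in>UNIV - {i,j}. (m Q k k)\<^sup>2)"
      by (intro sum.cong) (auto simp: rk)
    ultimately have le': "(m R i i)\<^sup>2 + (m R j j)\<^sup>2 \<le> ?a\<^sup>2 + ?c\<^sup>2" using le by linarith
    have sum: "m R i i + m R j j = ?a + ?c"
    proof -
      have "m R i i + m R j j = (C * C + S * S) * (?a + ?c)" unfolding ri rj by (simp add: algebra_simps)
      then show ?thesis using CS by simp
    qed
    have "m R i i - m R j j = (?a - ?c) * cos t + (2 * ?b) * sin t"
      unfolding ri rj ct by (simp add: algebra_simps)
    also have "\<dots> = ((?a - ?c)\<^sup>2 + (2 * ?b)\<^sup>2) / D"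
      unfolding t[symmetric] by (simp add: power2_eq_square add_divide_distrib)
    also have "\<dots> = D" using \<open>D > 0\<close> D2[symmetric] by (simp add: power2_eq_square)
    finally have diff: "m R i i - m R j j = D" .
    \<comment> \<open>The rotation keeps the trace of the block, so by this identity only the
      difference of the diagonal entries matters; its square grows from (a - c)^2 to D^2, that is,
      by (2b)^2.\<close>
    have par: "2 * (u\<^sup>2 + v\<^sup>2) = (u + v)\<^sup>2 + (u - v)\<^sup>2" for u v :: real
      by (simp add: power2_eq_square algebra_simps)
    have "2 * ((m R i i)\<^sup>2 + (m R j j)\<^sup>2) = (?a + ?c)\<^sup>2 + D\<^sup>2" unfolding par sum diff ..
    moreover have "2 * (?a\<^sup>2 + ?c\<^sup>2) = (?a + ?c)\<^sup>2 + (?a - ?c)\<^sup>2" by (rule par)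
    moreover have "2 * s = p + d \<Longrightarrow> 2 * q = p + e \<Longrightarrow> s \<le> q \<Longrightarrow> d = e + f \<Longrightarrow> f \<le> 0" for s p d q e f :: real
      by linarith
    ultimately have "(2 * ?b)\<^sup>2 \<le> 0" using le' D2 by blast
    then show False using b by simp
  qed
  moreover have "(Q ** x ** transpose Q) $ k $ l = m Q k l" for k l
  proof -
    have "(Q ** x ** transpose Q) $ k $ l = (\<Sum>j\<in>UNIV. \<Sum>i\<in>UNIV. Q $ k $ i * x $ i $ j * Q $ l $ j)"
      by (simp add: matrix_matrix_mult_def transpose_def sum_distrib_right)
    also have "\<dots> = (\<Sum>i\<in>UNIV. \<Sum>j\<in>UNIV. Q $ k $ i * x $ i $ j * Q $ l $ j)" by (rule sum.swap)
    also have "\<dots> = m Q k l"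
      by (simp add: m_def inner_vec_def matrix_vector_mult_def sum_distrib_left mult.assoc)
    finally show ?thesis .
  qed
  moreover have "orthogonal_matrix Q" using Q by (simp add: Ob_def orthogonal_matrix_def matrix_left_right_inverse)
  ultimately show ?thesis using that by metis
qed

text \<open>Take roots of the diagonal entries in a diagonalising basis and rotate back. Symmetry of
  the root makes \<open>c ** x ** c\<close> a congruence of \<open>x\<close>, and this is the
  substitution used in the integrals below.\<close>

lemma posdef_sqrt:
  fixes x :: "real^'d^'d"
  assumes x: "x \<in> posdef"
  obtains c where "transpose c = c" "invertible c" "c ** c = x"
proof -
  obtain Q where Q: "orthogonal_matrix Q" and off: "\<And>k l. k \<noteq> l \<Longrightarrow> (Q ** x ** transpose Q) $ k $ l = 0"
    using symmetric_diagonalization[OF posdef_sym[OF x]] by blast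
  have QQ: "transpose Q ** Q = mat 1" "Q ** transpose Q = mat 1"
    using Q by (auto simp: orthogonal_matrix_def)
  then have "invertible (transpose Q)" by (auto simp: invertible_def)
  from posdef_congr[OF this x] have "Q ** x ** transpose Q \<in> posdef" by simp
  then obtain P where P: "P = Q ** x ** transpose Q" and pd: "P \<in> posdef" by blast
  have off': "P $ k $ l = 0" if "k \<noteq> l" for k l using off that by (simp add: P)
  define e where "e = (\<chi> i j. if i = j then sqrt (P $ i $ i) else 0)"
  have "(e ** e) $ i $ j = P $ i $ j" for i j
  proof -
    have "(e ** e) $ i $ j = (\<Sum>k\<in>UNIV. e $ i $ k * e $ k $ j)" by (simp add: matrix_matrix_mult_def)
    also have "\<dots> = (\<Sum>k\<in>UNIV. if k = i then sqrt (P $ i $ i) * e $ i $ j else 0)"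
      by (intro sum.cong refl) (auto simp: e_def)
    also have "\<dots> = sqrt (P $ i $ i) * e $ i $ j" by simp
    also have "\<dots> = P $ i $ j"
      using posdef_diag_pos[OF pd, of i] off'[of i j] by (cases "i = j") (auto simp: e_def)
    finally show ?thesis .
  qed
  then have ee: "e ** e = Q ** x ** transpose Q" by (simp add: vec_eq_iff P[symmetric])
  have "(transpose Q ** e ** Q) ** (transpose Q ** e ** Q) = transpose Q ** e ** (Q ** transpose Q) ** e ** Q"
    by (simp only: matrix_mul_assoc)
  also have "\<dots> = transpose Q ** (e ** e) ** Q" by (simp add: QQ matrix_mul_assoc)
  also have "\<dots> = (transpose Q ** Q) ** x ** (transpose Q ** Q)" by (simp only: ee matrix_mul_assoc)
  finally have cc: "(transpose Q ** e ** Q) ** (transpose Q ** e ** Q) = x" by (simp add: QQ)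
  moreover have "transpose e = e" by (auto simp: e_def transpose_def vec_eq_iff)
  then have "transpose (transpose Q ** e ** Q) = transpose Q ** e ** Q" by (rule transpose_congr)
  moreover have "det (transpose Q ** e ** Q) \<noteq> 0"
  proof -
    have "det x = det (transpose Q ** e ** Q) * det (transpose Q ** e ** Q)" by (simp only: cc[symmetric] det_mul[of "transpose Q ** e ** Q"])
    then show ?thesis using posdef_det_pos[OF x] by (metis less_irrefl mult_zero_left)
  qed
  then have "invertible (transpose Q ** e ** Q)" by (simp only: invertible_det_nz not_False_eq_True)
  ultimately show ?thesis by (intro that)
qed


section \<open>Lebesgue measure on symmetric matrices\<close>

lemma borel_measurable_matrixI:
  fixes f :: "'a \<Rightarrow> real^'n^'m"
  assumes "\<And>i j. (\<lambda>x. f x $ i $ j) \<in> borel_measurable M"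
  shows "f \<in> borel_measurable M"
  unfolding borel_measurable_euclidean_space[of f]
  using assms by (auto simp: Basis_vec_def inner_axis)

lemma borel_measurable_det [measurable (raw)]:
  "f \<in> borel_measurable M \<Longrightarrow> (\<lambda>x. det (f x :: real^'d^'d)) \<in> borel_measurable M"
  by (rule measurable_compose[OF _ borel_measurable_continuous_onI]) (auto intro!: continuous_intros)

lemma borel_measurable_trace [measurable (raw)]:
  "f \<in> borel_measurable M \<Longrightarrow> (\<lambda>x. trace (f x :: real^'d^'d)) \<in> borel_measurable M"
  by (rule measurable_compose[OF _ borel_measurable_continuous_onI]) (auto intro!: continuous_intros)

lemma borel_measurable_transpose [measurable (raw)]:
  "f \<in> borel_measurable M \<Longrightarrow> (\<lambda>x. transpose (f x :: real^'n^'m)) \<in> borel_measurable M"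
  by (rule measurable_compose[OF _ borel_measurable_continuous_onI]) (auto intro!: continuous_intros)

lemma borel_measurable_matrix_mult [measurable (raw)]:
  fixes f :: "'a \<Rightarrow> real^'n^'m" and g :: "'a \<Rightarrow> real^'k^'n"
  assumes "f \<in> borel_measurable M" "g \<in> borel_measurable M"
  shows "(\<lambda>x. f x ** g x) \<in> borel_measurable M"
  by (rule borel_measurable_continuous_Pair[OF assms]) (auto intro!: continuous_intros)

lemma borel_measurable_matrix_component [measurable (raw)]:
  fixes f :: "'a \<Rightarrow> real^'n^'m"
  shows "f \<in> borel_measurable M \<Longrightarrow> (\<lambda>x. f x $ i $ j) \<in> borel_measurable M"
  by (rule measurable_compose[OF _ borel_measurable_continuous_onI]) (auto intro!: continuous_intros)

definition pairs :: "'d set set" where "pairs = {{i, j} | i j. True}"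

lemma doubleton_in_pairs [simp, intro]: "{i, j} \<in> pairs"
  and pairsE: "p \<in> pairs \<Longrightarrow> (\<And>i j. p = {i, j} \<Longrightarrow> P) \<Longrightarrow> P"
  by (auto simp: pairs_def)

lemma sym_lebesgue_eq: "sym_lebesgue = distr (\<Pi>\<^sub>M p\<in>pairs. (lborel :: real measure)) borel sym_of_coords"
  by (simp only: sym_lebesgue_def pairs_def)

interpretation lborel_product: product_sigma_finite "\<lambda>_::'i. lborel :: real measure"
  by standard (rule lborel.sigma_finite_countable)

lemma sets_sym_lebesgue [measurable_cong, simp]: "sets sym_lebesgue = sets borel"
  and space_sym_lebesgue [simp]: "space sym_lebesgue = UNIV"
  by (auto simp: sym_lebesgue_eq)

lemma sym_of_coords_measurable [measurable]:
  "sym_of_coords \<in> borel_measurable (\<Pi>\<^sub>M p\<in>pairs. (lborel :: real measure))"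
proof (rule borel_measurable_matrixI)
  fix i j :: 'a
  have "(\<lambda>f. f {i,j}) \<in> borel_measurable (\<Pi>\<^sub>M p\<in>pairs. (lborel :: real measure))"
    using measurable_component_singleton[of "{i,j}" pairs "\<lambda>_. lborel :: real measure"] by simp
  then show "(\<lambda>f. sym_of_coords f $ i $ j) \<in> borel_measurable (\<Pi>\<^sub>M p\<in>pairs. (lborel :: real measure))"
    by (simp add: sym_of_coords_def)
qed

lemma transpose_sym_of_coords: "transpose (sym_of_coords f) = sym_of_coords f"
  by (simp add: sym_of_coords_def transpose_def insert_commute)

lemma sym_of_coords_surj:
  assumes "transpose z = z"
  obtains f where "sym_of_coords f = z"
proof -
  have sym: "z $ i $ j = z $ j $ i" for i j
    using assms by (metis transpose_def vec_lambda_beta)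
  \<comment> \<open>An unordered pair has no first element; symmetry of \<open>z\<close> makes the
    described value independent of how the pair is written.\<close>
  define f where "f p = (THE c. \<exists>i j. p = {i, j} \<and> c = z $ i $ j)" for p
  have "f {i, j} = z $ i $ j" for i j
    unfolding f_def by (rule the_equality) (auto simp: doubleton_eq_iff sym)
  then show ?thesis by (intro that[of f]) (simp add: sym_of_coords_def vec_eq_iff)
qed

lemma AE_sym_lebesgue: "AE x in sym_lebesgue. transpose x = x"
  unfolding sym_lebesgue_eq by (subst AE_distr_iff) (auto simp: transpose_sym_of_coords)

lemma PiM_lborel_translation:
  assumes "finite I"
  shows "distr (Pi\<^sub>M I (\<lambda>_. lborel :: real measure)) (Pi\<^sub>M I (\<lambda>_. lborel)) (\<lambda>f. \<lambda>p\<in>I. f p + c p)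
    = Pi\<^sub>M I (\<lambda>_. lborel)"
proof (rule lborel_product.PiM_eqI[OF assms])
  fix A :: "'a \<Rightarrow> real set" assume A: "\<And>i. i \<in> I \<Longrightarrow> A i \<in> sets lborel"
  have m: "(\<lambda>f. \<lambda>p\<in>I. f p + c p) \<in> measurable (Pi\<^sub>M I (\<lambda>_. lborel :: real measure)) (Pi\<^sub>M I (\<lambda>_. lborel))"
    by (intro measurable_restrict) measurable
  have "(\<lambda>f. \<lambda>p\<in>I. f p + c p) -` Pi\<^sub>E I A \<inter> space (Pi\<^sub>M I (\<lambda>_. lborel :: real measure))
      = Pi\<^sub>E I (\<lambda>p. (\<lambda>x. x + c p) -` A p)"
    by (auto simp: space_PiM PiE_def Pi_def extensional_def)
  then have "emeasure (distr (Pi\<^sub>M I (\<lambda>_. lborel :: real measure)) (Pi\<^sub>M I (\<lambda>_. lborel)) (\<lambda>f. \<lambda>p\<in>I. f p + c p)) (Pi\<^sub>E I A)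
    = emeasure (Pi\<^sub>M I (\<lambda>_. lborel)) (Pi\<^sub>E I (\<lambda>p. (\<lambda>x. x + c p) -` A p))"
    by (subst emeasure_distr[OF m]) (auto intro!: sets_PiM_I_finite assms A)
  also have "\<dots> = (\<Prod>p\<in>I. emeasure lborel ((\<lambda>x. x + c p) -` A p))"
    by (rule lborel_product.emeasure_PiM[OF assms]) (use A in \<open>auto intro!: measurable_sets_borel[of _ borel]\<close>)
  also have "\<dots> = (\<Prod>p\<in>I. emeasure lborel (A p))"
  proof (rule prod.cong[OF refl])
    fix p assume "p \<in> I"
    have *: "(+) (c p) = (\<lambda>x. x + c p)" by (simp add: fun_eq_iff add.commute)
    have "emeasure lborel (A p) = emeasure (distr lborel borel ((+) (c p))) (A p)"
      by (simp only: lborel_distr_plus)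
    also have "\<dots> = emeasure lborel ((\<lambda>x. x + c p) -` A p)"
      unfolding * using A[OF \<open>p \<in> I\<close>] by (subst emeasure_distr) simp_all
    finally show "emeasure lborel ((\<lambda>x. x + c p) -` A p) = emeasure lborel (A p)" ..
  qed
  finally show "emeasure (distr (Pi\<^sub>M I (\<lambda>_. lborel :: real measure)) (Pi\<^sub>M I (\<lambda>_. lborel)) (\<lambda>f. \<lambda>p\<in>I. f p + c p)) (Pi\<^sub>E I A)
    = (\<Prod>p\<in>I. emeasure lborel (A p))" .
qed simp

lemma nn_integral_sym_lebesgue:
  assumes [measurable]: "F \<in> borel_measurable borel"
  shows "(\<integral>\<^sup>+x. F x \<partial>sym_lebesgue) = (\<integral>\<^sup>+f. F (sym_of_coords f) \<partial>(\<Pi>\<^sub>M p\<in>pairs. lborel))"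
  unfolding sym_lebesgue_eq by (rule nn_integral_distr) measurable

lemma nn_integral_sym_lebesgue_translation:
  assumes z: "transpose z = z" and [measurable]: "F \<in> borel_measurable borel"
  shows "(\<integral>\<^sup>+x. F (x + z) \<partial>sym_lebesgue) = (\<integral>\<^sup>+x. F x \<partial>sym_lebesgue)"
proof -
  obtain c where c: "sym_of_coords c = z" using sym_of_coords_surj[OF z] .
  have *: "sym_of_coords (\<lambda>p\<in>pairs. f p + c p) = sym_of_coords f + z" for f
    unfolding c[symmetric] by (simp add: sym_of_coords_def vec_eq_iff)
  have m: "(\<lambda>f. \<lambda>p\<in>pairs. f p + c p) \<in> measurable (Pi\<^sub>M pairs (\<lambda>_. lborel :: real measure)) (Pi\<^sub>M pairs (\<lambda>_. lborel))"
    by (intro measurable_restrict) measurable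
  have "(\<integral>\<^sup>+x. F x \<partial>sym_lebesgue) = (\<integral>\<^sup>+f. F (sym_of_coords f) \<partial>(\<Pi>\<^sub>M p\<in>pairs. lborel))"
    by (rule nn_integral_sym_lebesgue) simp
  also have "\<dots> = (\<integral>\<^sup>+f. F (sym_of_coords f) \<partial>(distr (\<Pi>\<^sub>M p\<in>pairs. lborel) (\<Pi>\<^sub>M p\<in>pairs. lborel) (\<lambda>f. \<lambda>p\<in>pairs. f p + c p)))"
    by (simp add: PiM_lborel_translation)
  also have "\<dots> = (\<integral>\<^sup>+f. F (sym_of_coords f + z) \<partial>(\<Pi>\<^sub>M p\<in>pairs. lborel))"
    by (subst nn_integral_distr[OF m]) (simp_all add: *)
  also have "\<dots> = (\<integral>\<^sup>+x. F (x + z) \<partial>sym_lebesgue)"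
    by (rule nn_integral_sym_lebesgue[symmetric]) simp
  finally show ?thesis ..
qed

text \<open>This explicit volume gives sigma-finiteness, the size of the reference box, and the
  effect of diagonal congruences. The side lengths are indexed by pairs so that they may depend on
  the coordinate.\<close>

lemma emeasure_sym_lebesgue_box:
  assumes r: "\<And>p. r p \<ge> 0"
  shows "emeasure sym_lebesgue {x. \<forall>i j. \<bar>x $ i $ j\<bar> \<le> r {i, j}} = (\<Prod>p\<in>pairs. ennreal (2 * r p))"
proof -
  have "emeasure sym_lebesgue {x. \<forall>i j. \<bar>x $ i $ j\<bar> \<le> r {i, j}}
      = emeasure (Pi\<^sub>M pairs (\<lambda>_. lborel)) (Pi\<^sub>E pairs (\<lambda>p. {- r p .. r p}))"
    unfolding sym_lebesgue_eq
  proof (subst emeasure_distr)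
    have "sym_of_coords -` {x. \<forall>i j. \<bar>x $ i $ j\<bar> \<le> r {i, j}} \<inter> space (Pi\<^sub>M pairs (\<lambda>_. lborel))
        = Pi\<^sub>E pairs (\<lambda>p. {- r p .. r p})"
      by (auto simp: sym_of_coords_def space_PiM PiE_iff abs_le_iff minus_le_iff elim!: pairsE)
    then show "emeasure (Pi\<^sub>M pairs (\<lambda>_. lborel)) (sym_of_coords -` {x. \<forall>i j. \<bar>x $ i $ j\<bar> \<le> r {i, j}} \<inter> space (Pi\<^sub>M pairs (\<lambda>_. lborel)))
      = emeasure (Pi\<^sub>M pairs (\<lambda>_. lborel)) (Pi\<^sub>E pairs (\<lambda>p. {- r p .. r p}))" by simp
  qed simp_all
  also have "\<dots> = (\<Prod>p\<in>pairs. emeasure lborel {- r p .. r p})"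
    by (rule lborel_product.emeasure_PiM) auto
  also have "\<dots> = (\<Prod>p\<in>pairs. ennreal (2 * r p))"
    using r by (intro prod.cong refl, subst emeasure_lborel_Icc) auto
  finally show ?thesis .
qed

lemma sigma_finite_sym_lebesgue: "sigma_finite_measure (sym_lebesgue :: (real^'d^'d) measure)"
proof
  let ?A = "\<lambda>n::nat. {x :: real^'d^'d. \<forall>i j. \<bar>x $ i $ j\<bar> \<le> real n}"
  have "(\<Union>n. ?A n) = UNIV"
  proof (intro equalityI subset_UNIV subsetI)
    fix x :: "real^'d^'d"
    obtain n where n: "norm x \<le> real n" using real_arch_simple by blast
    have "\<bar>x $ i $ j\<bar> \<le> norm x" for i j
      by (rule order.trans[OF component_le_norm_cart Finite_Cartesian_Product.norm_nth_le])
    with n have "x \<in> ?A n" by (auto intro: order.trans)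
    then show "x \<in> (\<Union>n. ?A n)" by blast
  qed
  moreover have "emeasure sym_lebesgue (?A n) \<noteq> \<infinity>" for n
    using emeasure_sym_lebesgue_box[of "\<lambda>_::'d set. real n"] by (simp add: power_eq_top_ennreal)
  ultimately show "\<exists>A::(real^'d^'d) set set. countable A \<and> A \<subseteq> sets sym_lebesgue \<and> \<Union> A = space sym_lebesgue \<and> (\<forall>a\<in>A. emeasure sym_lebesgue a \<noteq> \<infinity>)"
    by (intro exI[of _ "range ?A"]) (simp add: image_subset_iff)
qed

interpretation sym_lebesgue: sigma_finite_measure "sym_lebesgue :: (real^'d^'d) measure"
  by (rule sigma_finite_sym_lebesgue)

section \<open>Lebesgue measure under congruences\<close>

lemma matrix_mult_add_rdistrib: "((A :: 'a::semiring_1^'n^'m) + B) ** C = A ** C + B ** C"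
  by (simp add: matrix_matrix_mult_def vec_eq_iff sum.distrib distrib_right)

lemma matrix_mult_diagonal_component:
  "(A ** (\<chi> i j. if i = j then c j else 0)) $ i $ j = A $ i $ j * (c j :: 'a::semiring_1)"
proof -
  have "(A ** (\<chi> i j. if i = j then c j else 0)) $ i $ j = (\<Sum>k\<in>UNIV. A $ i $ k * (if k = j then c j else 0))"
    by (simp add: matrix_matrix_mult_def)
  also have "\<dots> = (\<Sum>k\<in>UNIV. if k = j then A $ i $ j * c j else 0)" by (rule sum.cong) auto
  finally show ?thesis by simp
qed

lemma ennreal_eq_divideI:
  fixes a b c :: ennreal
  assumes "a * b = c" "b \<noteq> 0" "b \<noteq> \<infinity>"
  shows "a = c / b"
  using assms mult_divide_eq_ennreal[of b a] by simp

text \<open>This is the usual proof that a translation invariant measure is unique up to a factor,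
  applied to \<open>sym_lebesgue\<close> and its image under \<open>L\<close>.\<close>

lemma sym_lebesgue_exchange:
  fixes L L' :: "real^'d^'d \<Rightarrow> real^'d^'d"
  assumes [measurable]: "L \<in> borel_measurable borel" "A \<in> sets borel" "B \<in> sets borel"
    and add: "\<And>x y. L (x + y) = L x + L y"
    and L: "\<And>x. transpose x = x \<Longrightarrow> transpose (L x) = L x"
    and L': "\<And>x. transpose x = x \<Longrightarrow> transpose (L' x) = L' x"
    and inv: "\<And>x. L (L' x) = x"
    and B: "\<And>x. - x \<in> B \<longleftrightarrow> x \<in> B"
  shows "emeasure sym_lebesgue {x. L x \<in> A} * emeasure sym_lebesgue B
    = emeasure sym_lebesgue A * emeasure sym_lebesgue {x. L x \<in> B}"
proof -
  let ?S = "sym_lebesgue :: (real^'d^'d) measure"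
  let ?a = "indicator A :: real^'d^'d \<Rightarrow> ennreal" and ?b = "indicator B :: real^'d^'d \<Rightarrow> ennreal"
  interpret pair_sigma_finite ?S ?S by unfold_locales
  have sh: "(\<integral>\<^sup>+x. F (x + z) \<partial>?S) = (\<integral>\<^sup>+x. F x \<partial>?S)"
    if "F \<in> borel_measurable borel" "transpose z = z" for F z
    using that nn_integral_sym_lebesgue_translation by blast
  have e: "emeasure ?S {x. L x \<in> C} = (\<integral>\<^sup>+x. indicator C (L x) \<partial>?S)" if [measurable]: "C \<in> sets borel" for C
  proof -
    have "emeasure ?S {x. L x \<in> C} = (\<integral>\<^sup>+x. indicator {x. L x \<in> C} x \<partial>?S)"
      by (subst nn_integral_indicator) simp_all
    then show ?thesis by (simp add: indicator_def)
  qed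
  have "emeasure ?S {x. L x \<in> A} * emeasure ?S B = (\<integral>\<^sup>+y. ?b y * (\<integral>\<^sup>+x. ?a (L x) \<partial>?S) \<partial>?S)"
    by (simp add: e nn_integral_multc mult.commute)
  also have "\<dots> = (\<integral>\<^sup>+y. (\<integral>\<^sup>+x. ?b y * ?a (L x + y) \<partial>?S) \<partial>?S)"
  proof (rule nn_integral_cong_AE, use AE_sym_lebesgue in eventually_elim)
    \<comment> \<open>The shift by \<open>L' y\<close> turns \<open>L x\<close> into
      \<open>L x + y\<close>. Only symmetric shifts preserve the measure, and almost every
      \<open>y\<close> is symmetric.\<close>
    fix y :: "real^'d^'d" assume y: "transpose y = y"
    have "(\<integral>\<^sup>+x. ?a (L x) \<partial>?S) = (\<integral>\<^sup>+x. ?a (L (x + L' y)) \<partial>?S)"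
      by (rule sh[symmetric]) (auto intro: L' y)
    also have "\<dots> = (\<integral>\<^sup>+x. ?a (L x + y) \<partial>?S)" by (simp add: add inv)
    finally show "?b y * (\<integral>\<^sup>+x. ?a (L x) \<partial>?S) = (\<integral>\<^sup>+x. ?b y * ?a (L x + y) \<partial>?S)"
      by (simp add: nn_integral_cmult)
  qed
  also have "\<dots> = (\<integral>\<^sup>+x. (\<integral>\<^sup>+y. ?b y * ?a (L x + y) \<partial>?S) \<partial>?S)"
    by (rule Fubini') measurable
  also have "\<dots> = (\<integral>\<^sup>+x. (\<integral>\<^sup>+y. ?b (L x - y) * ?a y \<partial>?S) \<partial>?S)"
  proof (rule nn_integral_cong_AE, use AE_sym_lebesgue in eventually_elim)
    fix x :: "real^'d^'d" assume x: "transpose x = x"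
    have "(\<integral>\<^sup>+y. ?b (L x - y) * ?a y \<partial>?S) = (\<integral>\<^sup>+y. ?b (L x - (y + L x)) * ?a (y + L x) \<partial>?S)"
      by (rule sh[symmetric]) (auto intro: L x)
    also have "\<dots> = (\<integral>\<^sup>+y. ?b y * ?a (L x + y) \<partial>?S)"
      by (intro nn_integral_cong) (auto simp: indicator_def B add.commute)
    finally show "(\<integral>\<^sup>+y. ?b y * ?a (L x + y) \<partial>?S) = (\<integral>\<^sup>+y. ?b (L x - y) * ?a y \<partial>?S)" ..
  qed
  also have "\<dots> = (\<integral>\<^sup>+y. (\<integral>\<^sup>+x. ?b (L x - y) * ?a y \<partial>?S) \<partial>?S)"
    by (rule Fubini') measurable
  also have "\<dots> = (\<integral>\<^sup>+y. ?a y * (\<integral>\<^sup>+x. ?b (L x) \<partial>?S) \<partial>?S)"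
  proof (rule nn_integral_cong_AE, use AE_sym_lebesgue in eventually_elim)
    fix y :: "real^'d^'d" assume y: "transpose y = y"
    have "(\<integral>\<^sup>+x. ?b (L x - y) \<partial>?S) = (\<integral>\<^sup>+x. ?b (L (x + L' y) - y) \<partial>?S)"
      by (rule sh[symmetric]) (auto intro: L' y)
    also have "\<dots> = (\<integral>\<^sup>+x. ?b (L x) \<partial>?S)" by (simp add: add inv)
    finally show "(\<integral>\<^sup>+x. ?b (L x - y) * ?a y \<partial>?S) = ?a y * (\<integral>\<^sup>+x. ?b (L x) \<partial>?S)"
      by (simp add: nn_integral_multc mult.commute[of "?a y"])
  qed
  also have "\<dots> = emeasure ?S A * emeasure ?S {x. L x \<in> B}"
    by (simp add: e nn_integral_multc)
  finally show ?thesis .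
qed

text \<open>A reference set that is symmetric under negation and has positive finite measure, so
  that the factor by which a congruence scales the measure can be read off as a ratio.\<close>

definition unit_box :: "(real^'d^'d) set" where
  "unit_box = {x. \<forall>i j. \<bar>x $ i $ j\<bar> \<le> 1}"

lemma unit_box_measurable [measurable]: "unit_box \<in> sets borel"
  unfolding unit_box_def by measurable

lemma emeasure_unit_box:
  "emeasure sym_lebesgue (unit_box :: (real^'d^'d) set) \<noteq> 0"
  "emeasure sym_lebesgue (unit_box :: (real^'d^'d) set) \<noteq> \<infinity>"
  using emeasure_sym_lebesgue_box[of "\<lambda>_::'d set. 1"]
  by (simp_all add: unit_box_def power_eq_top_ennreal)

text \<open>The exchange identity with \<open>unit_box\<close> as second set says that the image
  measure is proportional to \<open>sym_lebesgue\<close>. The factor is left as a ratio here; its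
  value is found below by multiplicativity.\<close>

lemma nn_integral_congr_factor:
  fixes g :: "real^'d^'d"
  assumes g: "invertible g" and [measurable]: "F \<in> borel_measurable borel"
  shows "(\<integral>\<^sup>+x. F (transpose g ** x ** g) \<partial>sym_lebesgue)
    = emeasure sym_lebesgue {x. transpose g ** x ** g \<in> unit_box} / emeasure sym_lebesgue (unit_box :: (real^'d^'d) set)
      * (\<integral>\<^sup>+x. F x \<partial>sym_lebesgue)"
proof -
  let ?L = "\<lambda>x. transpose g ** x ** g"
  let ?c = "emeasure sym_lebesgue {x. ?L x \<in> unit_box} / emeasure sym_lebesgue (unit_box :: (real^'d^'d) set)"
  obtain h where h: "g ** h = mat 1" "h ** g = mat 1" using g by (auto simp: invertible_def)
  have "distr sym_lebesgue borel ?L = density sym_lebesgue (\<lambda>_. ?c)"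
  proof (rule measure_eqI)
    fix A :: "(real^'d^'d) set" assume "A \<in> sets (distr sym_lebesgue borel ?L)"
    then have [measurable]: "A \<in> sets borel" by simp
    have "emeasure sym_lebesgue {x. ?L x \<in> A} * emeasure sym_lebesgue (unit_box :: (real^'d^'d) set)
      = emeasure sym_lebesgue A * emeasure sym_lebesgue {x. ?L x \<in> unit_box}"
    proof (rule sym_lebesgue_exchange[where L' = "\<lambda>x. transpose h ** x ** h"])
      fix x y :: "real^'d^'d"
      show "transpose g ** (x + y) ** g = transpose g ** x ** g + transpose g ** y ** g"
        by (simp add: matrix_add_ldistrib matrix_mult_add_rdistrib)
      have "transpose g ** (transpose h ** x ** h) ** g = transpose (h ** g) ** x ** (h ** g)"
        by (simp add: matrix_transpose_mul matrix_mul_assoc)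
      then show "transpose g ** (transpose h ** x ** h) ** g = x" by (simp add: h transpose_mat)
    qed (auto simp: transpose_congr unit_box_def)
    then have "emeasure sym_lebesgue {x. ?L x \<in> A} = emeasure sym_lebesgue A * emeasure sym_lebesgue {x. ?L x \<in> unit_box}
       / emeasure sym_lebesgue (unit_box :: (real^'d^'d) set)"
      by (rule ennreal_eq_divideI[OF _ emeasure_unit_box])
    also have "\<dots> = ?c * emeasure sym_lebesgue A" by (simp add: divide_ennreal_def mult_ac)
    finally show "emeasure (distr sym_lebesgue borel ?L) A = emeasure (density sym_lebesgue (\<lambda>_. ?c)) A"
      by (simp add: emeasure_distr emeasure_density vimage_def nn_integral_cmult)
  qed simp
  then have "(\<integral>\<^sup>+x. F x \<partial>distr sym_lebesgue borel ?L) = (\<integral>\<^sup>+x. F x \<partial>density sym_lebesgue (\<lambda>_. ?c))" by simp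
  then show ?thesis by (simp add: nn_integral_distr nn_integral_density nn_integral_cmult)
qed

text \<open>The guard on the determinant sits inside the predicate because the induction over
  elementary matrices also passes through singular ones, for which the claim must hold vacuously.
  Quantifying over all integrands makes it stable under products.\<close>

definition congr_scaling :: "real^'d^'d \<Rightarrow> bool" where
  "congr_scaling g \<longleftrightarrow> (det g \<noteq> 0 \<longrightarrow> (\<forall>F\<in>borel_measurable borel.
    (\<integral>\<^sup>+x. F (transpose g ** x ** g) \<partial>sym_lebesgue)
      = ennreal ((1 / \<bar>det g\<bar>) ^ (CARD('d) + 1)) * (\<integral>\<^sup>+x. F x \<partial>sym_lebesgue)))"

lemma congr_scaling_mult:
  fixes A B :: "real^'d^'d"
  assumes "congr_scaling A" "congr_scaling B"
  shows "congr_scaling (A ** B)"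
  unfolding congr_scaling_def
proof (intro impI ballI)
  assume "det (A ** B) \<noteq> 0"
  then have d: "det A \<noteq> 0" "det B \<noteq> 0" by (auto simp: det_mul)
  fix F :: "real^'d^'d \<Rightarrow> ennreal" assume [measurable]: "F \<in> borel_measurable borel"
  define cA cB where "cA = ennreal ((1 / \<bar>det A\<bar>) ^ (CARD('d) + 1))" "cB = ennreal ((1 / \<bar>det B\<bar>) ^ (CARD('d) + 1))"
  have "(\<integral>\<^sup>+x. F (transpose (A ** B) ** x ** (A ** B)) \<partial>sym_lebesgue)
    = (\<integral>\<^sup>+x. F (transpose B ** (transpose A ** x ** A) ** B) \<partial>sym_lebesgue)"
    by (simp add: matrix_transpose_mul matrix_mul_assoc)
  also have "\<dots> = cA * (\<integral>\<^sup>+x. F (transpose B ** x ** B) \<partial>sym_lebesgue)"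
    using assms(1)[unfolded congr_scaling_def, rule_format, OF d(1), of "\<lambda>x. F (transpose B ** x ** B)"]
    by (simp add: cA_cB_def)
  also have "\<dots> = cA * (cB * (\<integral>\<^sup>+x. F x \<partial>sym_lebesgue))"
    using assms(2)[unfolded congr_scaling_def, rule_format, OF d(2), of F]
    by (simp add: cA_cB_def)
  also have "\<dots> = (cA * cB) * (\<integral>\<^sup>+x. F x \<partial>sym_lebesgue)" by (simp add: mult.assoc)
  also have "cA * cB = ennreal ((1 / \<bar>det (A ** B)\<bar>) ^ (CARD('d) + 1))"
    by (simp add: cA_cB_def ennreal_mult[symmetric] det_mul abs_mult power_divide power_mult_distrib)
  finally show "(\<integral>\<^sup>+x. F (transpose (A ** B) ** x ** (A ** B)) \<partial>sym_lebesgue)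
    = ennreal ((1 / \<bar>det (A ** B)\<bar>) ^ (CARD('d) + 1)) * (\<integral>\<^sup>+x. F x \<partial>sym_lebesgue)" .
qed

text \<open>Applying the congruence twice changes nothing, so the unknown factor has square 1 and,
  being nonnegative, equals 1. The determinant also has square 1, so the claimed factor is 1 as
  well.\<close>

lemma congr_scaling_involution:
  fixes g :: "real^'d^'d"
  assumes gg: "g ** g = mat 1"
  shows "congr_scaling g"
  unfolding congr_scaling_def
proof (intro impI ballI)
  have inv: "invertible g" using gg by (auto simp: invertible_def)
  let ?B = "unit_box :: (real^'d^'d) set"
  define c where "c = emeasure sym_lebesgue {x. transpose g ** x ** g \<in> unit_box} / emeasure sym_lebesgue ?B"
  have c: "(\<integral>\<^sup>+x. F (transpose g ** x ** g) \<partial>sym_lebesgue) = c * (\<integral>\<^sup>+x. F x \<partial>sym_lebesgue)"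
    if "F \<in> borel_measurable borel" for F
    unfolding c_def by (rule nn_integral_congr_factor[OF inv that])
  have "emeasure sym_lebesgue ?B = (\<integral>\<^sup>+x. indicator ?B x \<partial>sym_lebesgue)" by simp
  also have "\<dots> = (\<integral>\<^sup>+x. indicator ?B (transpose g ** (transpose g ** x ** g) ** g) \<partial>sym_lebesgue)"
  proof -
    have "transpose g ** (transpose g ** x ** g) ** g = transpose (g ** g) ** x ** (g ** g)" for x
      by (simp add: matrix_transpose_mul matrix_mul_assoc)
    then show ?thesis by (simp add: gg transpose_mat)
  qed
  also have "\<dots> = c * (c * (\<integral>\<^sup>+x. indicator ?B x \<partial>sym_lebesgue))"
    by (subst c[symmetric], measurable, subst c[symmetric]) auto
  also have "\<dots> = (c * c) * emeasure sym_lebesgue ?B" by (simp add: mult.assoc)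
  finally have "1 * emeasure sym_lebesgue ?B = (c * c) * emeasure sym_lebesgue ?B" by simp
  then have "c * c = (1 * emeasure sym_lebesgue ?B) / emeasure sym_lebesgue ?B"
    by (intro ennreal_eq_divideI[OF _ emeasure_unit_box]) (rule sym)
  also have "\<dots> = 1" by (rule ennreal_eq_divideI[OF refl emeasure_unit_box, symmetric])
  finally have "c * c = 1" .
  then have "c = 1"
  proof (cases c)
    case (real r)
    then have "r * r = 1" using \<open>c * c = 1\<close> by (simp add: ennreal_mult[symmetric] flip: ennreal_1)
    then have "r = 1" using real abs_square_eq_1[of r] by (simp add: power2_eq_square)
    then show ?thesis using real by simp
  qed (simp add: ennreal_top_mult)
  moreover have "\<bar>det g\<bar> = 1"
  proof -
    have "det g * det g = 1" using gg det_mul[of g g] by simp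
    then show ?thesis using abs_square_eq_1[of "det g"] by (simp add: power2_eq_square)
  qed
  moreover fix F :: "real^'d^'d \<Rightarrow> ennreal" assume "F \<in> borel_measurable borel"
  ultimately show "(\<integral>\<^sup>+x. F (transpose g ** x ** g) \<partial>sym_lebesgue)
    = ennreal ((1 / \<bar>det g\<bar>) ^ (CARD('d) + 1)) * (\<integral>\<^sup>+x. F x \<partial>sym_lebesgue)"
    using c by simp
qed

text \<open>Origin of the exponent d + 1: an index k counts twice in its diagonal coordinate and
  once in each of the d - 1 others that involve it.\<close>

lemma prod_pairs:
  fixes a :: "'d::finite \<Rightarrow> real"
  shows "(\<Prod>p\<in>pairs. \<Prod>k\<in>UNIV. a k ^ (if k \<in> p then if p = {k} then 2 else 1 else 0))
    = (\<Prod>k\<in>UNIV. a k) ^ (CARD('d) + 1)"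
proof -
  have "(\<Prod>p\<in>pairs. \<Prod>k\<in>UNIV. a k ^ (if k \<in> p then if p = {k} then 2 else 1 else 0))
    = (\<Prod>k\<in>UNIV. a k ^ (\<Sum>p\<in>pairs. if k \<in> p then if p = {k} then 2 else 1 else 0))"
    by (subst prod.swap) (simp add: power_sum)
  also have "\<dots> = (\<Prod>k\<in>UNIV. a k ^ (CARD('d) + 1))"
  proof (intro prod.cong refl arg_cong[where f="\<lambda>n. _ ^ n"])
    fix k :: 'd
    have "(\<Sum>p\<in>pairs. if k \<in> p then if p = {k} then 2 else 1 else 0)
      = (\<Sum>p\<in>(\<lambda>j. {k, j}) ` UNIV. if p = {k} then 2 else 1 :: nat)"
      by (rule sum.mono_neutral_cong_right) (auto elim!: pairsE)
    also have "\<dots> = (\<Sum>j\<in>UNIV. if j = k then 2 else 1)"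
      by (subst sum.reindex) (auto simp: inj_on_def doubleton_eq_iff intro!: sum.cong)
    also have "\<dots> = (\<Sum>j\<in>UNIV. 1 + (if j = k then 1 else 0))" by (rule sum.cong) auto
    also have "\<dots> = CARD('d) + 1" by (subst sum.distrib) simp
    finally show "(\<Sum>p\<in>pairs. if k \<in> p then if p = {k} then 2 else 1 else 0) = CARD('d) + 1" .
  qed
  finally show ?thesis by (simp only: prod_power_distrib)
qed

text \<open>A diagonal congruence rescales each coordinate separately, so the preimage of the
  reference box is again a box and its volume is known.\<close>

lemma congr_scaling_diagonal:
  fixes A :: "real^'d^'d"
  assumes off: "\<And>i j. i \<noteq> j \<Longrightarrow> A $ i $ j = 0"
  shows "congr_scaling A"
  unfolding congr_scaling_def
proof (intro impI ballI)
  assume nz: "det A \<noteq> 0"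
  define a where "a k = \<bar>A $ k $ k\<bar>" for k
  have det: "\<bar>det A\<bar> = (\<Prod>k\<in>UNIV. a k)"
    by (subst det_diagonal) (auto simp: off abs_prod a_def)
  have "(\<Prod>k\<in>UNIV. a k) \<noteq> 0" unfolding det[symmetric] using nz by simp
  then have "a k \<noteq> 0" for k by (metis finite prod_zero UNIV_I)
  then have pos: "a k > 0" for k by (simp add: a_def)
  \<comment> \<open>The half side 1/(a i * a j), written as a function of the set {i, j} alone: the
    exponent 2 covers the diagonal case, where the pair collapses to a singleton.\<close>
  define r where "r p = (\<Prod>k\<in>UNIV. (1 / a k) ^ (if k \<in> p then if p = {k} then 2 else 1 else 0))" for p
  have r: "r {i, j} = 1 / (a i * a j)" for i j
  proof (cases "i = j")
    case True
    have "r {i, i} = (\<Prod>k\<in>{i}. (1 / a k) ^ 2)"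
      unfolding r_def by (intro prod.mono_neutral_cong_right) auto
    then show ?thesis using True by (simp add: power2_eq_square)
  next
    case False
    have "r {i, j} = (\<Prod>k\<in>{i, j}. 1 / a k)"
      unfolding r_def using False by (intro prod.mono_neutral_cong_right) auto
    then show ?thesis using False by simp
  qed
  have entry: "(transpose A ** x ** A) $ i $ j = A $ i $ i * x $ i $ j * A $ j $ j" for x i j
  proof -
    have "(transpose A ** x ** A) $ i $ j = (\<Sum>k\<in>UNIV. (\<Sum>l\<in>UNIV. A $ l $ i * x $ l $ k) * A $ k $ j)"
      by (simp add: matrix_matrix_mult_def transpose_def)
    also have "\<dots> = (\<Sum>k\<in>UNIV. if k = j then (\<Sum>l\<in>UNIV. A $ l $ i * x $ l $ j) * A $ j $ j else 0)"
      by (rule sum.cong) (auto simp: off)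
    also have "\<dots> = (\<Sum>l\<in>UNIV. A $ l $ i * x $ l $ j) * A $ j $ j" by simp
    also have "(\<Sum>l\<in>UNIV. A $ l $ i * x $ l $ j) = (\<Sum>l\<in>UNIV. if l = i then A $ i $ i * x $ i $ j else 0)"
      by (rule sum.cong) (auto simp: off)
    finally show ?thesis by simp
  qed
  have box: "{x. transpose A ** x ** A \<in> unit_box} = {x. \<forall>i j. \<bar>x $ i $ j\<bar> \<le> r {i, j}}"
  proof -
    have "\<bar>(transpose A ** x ** A) $ i $ j\<bar> \<le> 1 \<longleftrightarrow> \<bar>x $ i $ j\<bar> \<le> r {i, j}" for x i j
    proof -
      have "\<bar>(transpose A ** x ** A) $ i $ j\<bar> = \<bar>x $ i $ j\<bar> * (a i * a j)"
        by (simp only: entry abs_mult a_def mult_ac)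
      then show ?thesis using pos[of i] pos[of j] by (simp add: r pos_le_divide_eq)
    qed
    then show ?thesis by (simp add: unit_box_def)
  qed
  have r0: "r p \<ge> 0" for p unfolding r_def by (intro prod_nonneg) (simp add: a_def)
  have "emeasure sym_lebesgue {x. transpose A ** x ** A \<in> unit_box}
    = (\<Prod>p\<in>pairs. ennreal 2 * ennreal (r p))"
    unfolding box using r0 by (subst emeasure_sym_lebesgue_box) (auto intro!: prod.cong simp: ennreal_mult)
  also have "\<dots> = (\<Prod>p\<in>(pairs :: 'd set set). ennreal (2 * 1)) * (\<Prod>p\<in>pairs. ennreal (r p))"
    by (simp add: prod.distrib)
  also have "(\<Prod>p\<in>(pairs :: 'd set set). ennreal (2 * 1)) = emeasure sym_lebesgue (unit_box :: (real^'d^'d) set)"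
    unfolding unit_box_def by (subst emeasure_sym_lebesgue_box[symmetric]) auto
  also have "(\<Prod>p\<in>pairs. ennreal (r p)) = ennreal (\<Prod>p\<in>pairs. r p)"
    using r0 by (simp add: prod_ennreal)
  also have "(\<Prod>p\<in>pairs. r p) = (\<Prod>k\<in>UNIV. 1 / a k) ^ (CARD('d) + 1)"
    unfolding r_def by (rule prod_pairs)
  also have "(\<Prod>k\<in>UNIV. 1 / a k) = 1 / \<bar>det A\<bar>" by (simp add: det prod_dividef)
  finally have *: "emeasure sym_lebesgue {x. transpose A ** x ** A \<in> unit_box} / emeasure sym_lebesgue (unit_box :: (real^'d^'d) set)
    = ennreal ((1 / \<bar>det A\<bar>) ^ (CARD('d) + 1))"
    by (intro ennreal_eq_divideI[OF _ emeasure_unit_box, symmetric]) (simp add: mult.commute)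
  fix F :: "real^'d^'d \<Rightarrow> ennreal" assume F: "F \<in> borel_measurable borel"
  show "(\<integral>\<^sup>+x. F (transpose A ** x ** A) \<partial>sym_lebesgue)
    = ennreal ((1 / \<bar>det A\<bar>) ^ (CARD('d) + 1)) * (\<integral>\<^sup>+x. F x \<partial>sym_lebesgue)"
    unfolding *[symmetric] using nz F by (intro nn_integral_congr_factor) (simp_all add: invertible_det_nz)
qed

text \<open>Every matrix is a product of matrices that have a zero row, are diagonal, swap two
  coordinates, or are shears. The first kind is singular, swaps are involutions, and a shear reduces
  to the other cases, so no Jacobian of a shear is computed.\<close>

lemma congr_scaling: "congr_scaling (g :: real^'d^'d)"
proof (rule induct_matrix_elementary_alt)
  fix A B :: "real^'d^'d" assume "congr_scaling A" "congr_scaling B" then show "congr_scaling (A ** B)" by (rule congr_scaling_mult)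
next
  fix A :: "real^'d^'d" and i assume "row i A = 0"
  then have "det A = 0" by (rule det_zero_row(2))
  then show "congr_scaling A" by (simp add: congr_scaling_def)
next
  fix A :: "real^'d^'d" assume "\<And>i j. i \<noteq> j \<Longrightarrow> A $ i $ j = 0" then show "congr_scaling A" by (rule congr_scaling_diagonal)
next
  fix m n :: 'd
  show "congr_scaling (\<chi> i j. mat 1 $ i $ Transposition.transpose m n j)"
  proof (rule congr_scaling_involution)
    let ?S = "\<chi> i j. mat 1 $ i $ Transposition.transpose m n j :: real^'d^'d"
    have "(?S ** ?S) $ i $ j = (mat 1 :: real^'d^'d) $ i $ j" for i j
    proof -
      have "(?S ** ?S) $ i $ j = (\<Sum>k\<in>UNIV. ?S $ i $ k * ?S $ k $ j)"
        by (simp add: matrix_matrix_mult_def)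
      also have "\<dots> = (\<Sum>k\<in>UNIV. if k = Transposition.transpose m n i then if i = j then 1 else 0 else 0)"
        by (rule sum.cong) (auto simp: mat_def transpose_eq_iff)
      also have "\<dots> = (if i = j then 1 else 0)" by simp
      finally show ?thesis by (simp add: mat_def)
    qed
    then show "?S ** ?S = mat 1" by (simp add: vec_eq_iff)
  qed
next
  fix m n :: 'd assume mn: "m \<noteq> n"
  \<comment> \<open>the shear \<open>S\<close> is the product of the involutions \<open>S ** D\<close> and \<open>D\<close>\<close>
  define S where "S = (\<chi> i j. of_bool (i = m \<and> j = n \<or> i = j) :: real^'d^'d)"
  have S: "S $ i $ j = (if i = m \<and> j = n \<or> i = j then 1 else 0)" for i j by (simp add: S_def)
  define D where "D = (\<chi> i j. if i = j then if j = m then -1 else 1 else 0 :: real^'d^'d)"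
  have SD: "(S ** D) $ i $ j = (if i = j then if i = m then -1 else 1 else if i = m \<and> j = n then 1 else 0)" for i j
    unfolding D_def matrix_mult_diagonal_component S using mn by auto
  have "(S ** D) ** (S ** D) = mat 1"
  proof -
    have "((S ** D) ** (S ** D)) $ i $ j = (mat 1 :: real^'d^'d) $ i $ j" for i j
    proof -
      have "((S ** D) ** (S ** D)) $ i $ j = (\<Sum>k\<in>UNIV. (S ** D) $ i $ k * (S ** D) $ k $ j)"
        by (simp add: matrix_matrix_mult_def)
      also have "\<dots> = (\<Sum>k\<in>{i, n}. (S ** D) $ i $ k * (S ** D) $ k $ j)"
        by (rule sum.mono_neutral_right) (auto simp: SD)
      also have "\<dots> = (mat 1 :: real^'d^'d) $ i $ j"
        using mn by (cases "i = n") (auto simp: SD mat_def)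
      finally show ?thesis .
    qed
    then show ?thesis by (simp add: vec_eq_iff)
  qed
  then have "congr_scaling (S ** D)" by (rule congr_scaling_involution)
  moreover have "congr_scaling D" by (rule congr_scaling_diagonal) (simp add: D_def)
  ultimately have "congr_scaling (S ** D ** D)" by (rule congr_scaling_mult)
  moreover have "S ** D ** D = S"
  proof -
    have "(S ** D ** D) $ i $ j = S $ i $ j" for i j
    proof -
      have "(S ** D ** D) $ i $ j = (S ** D) $ i $ j * (if j = m then -1 else 1)"
        by (subst (2) D_def) (rule matrix_mult_diagonal_component)
      then show ?thesis using mn by (auto simp: SD S)
    qed
    then show ?thesis by (simp add: vec_eq_iff)
  qed
  ultimately show "congr_scaling (\<chi> i j. of_bool (i = m \<and> j = n \<or> i = j))" by (simp only: S_def)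
qed

section \<open>Finiteness of the Gamma function\<close>

lemma nn_integral_powr_unit_interval:
  assumes "-1 < p"
  shows "(\<integral>\<^sup>+s. indicator {0<..1} s * ennreal (s powr p) \<partial>lborel) = ennreal (1 / (p + 1))"
proof -
  have "(\<integral>\<^sup>+s. indicator {0<..1} s * ennreal (s powr p) \<partial>lborel) = (\<integral>\<^sup>+s. ennreal (s powr p) * indicator {0..1} s \<partial>lborel)"
    by (intro nn_integral_cong) (auto simp: indicator_def)
  also have "\<dots> = ennreal (1 / (p + 1))"
    using has_integral_powr_from_0[OF assms, of 1] by (intro nn_integral_has_integral_lebesgue') auto
  finally show ?thesis .
qed

text \<open>With s = a/b + t the integrand becomes b^p s^p. The part s \<le> 1 contributes at most
  1/(p+1); for s > 1 the power is at most 1 because p \<le> 0, and the interval has length 2. The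
  bound is uniform in \<open>a\<close> and keeps exactly the factor b^p, which is what the induction
  on the block size needs.\<close>

lemma nn_integral_affine_powr_le:
  fixes a b p :: real
  assumes p: "-1 < p" "p \<le> 0" and b: "b > 0"
  shows "(\<integral>\<^sup>+t. indicator {-1..1} t * (indicator {t. a + b * t > 0} t * ennreal ((a + b * t) powr p)) \<partial>lborel)
    \<le> ennreal (1 / (p + 1) + 2) * ennreal (b powr p)"
proof -
  let ?c = "a / b"
  have eq: "a + b * t = b * (?c + t)" for t using b by (simp add: field_simps)
  have "(\<integral>\<^sup>+t. indicator {-1..1} t * (indicator {t. a + b * t > 0} t * ennreal ((a + b * t) powr p)) \<partial>lborel)
    \<le> (\<integral>\<^sup>+t. ennreal (b powr p) * (indicator {0<..1} (?c + t) * ennreal ((?c + t) powr p) + indicator {-1..1} t) \<partial>lborel)"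
  proof (rule nn_integral_mono)
    fix t :: real
    show "indicator {-1..1} t * (indicator {t. a + b * t > 0} t * ennreal ((a + b * t) powr p))
      \<le> ennreal (b powr p) * (indicator {0<..1} (?c + t) * ennreal ((?c + t) powr p) + indicator {-1..1} t)"
    proof (cases "t \<in> {-1..1} \<and> a + b * t > 0")
      case True
      then have pos: "?c + t > 0" unfolding eq using b by (simp add: zero_less_mult_iff)
      have "ennreal ((a + b * t) powr p) = ennreal (b powr p) * ennreal ((?c + t) powr p)"
        unfolding eq using b pos by (simp add: powr_mult ennreal_mult)
      moreover have "ennreal ((?c + t) powr p) \<le> indicator {0<..1} (?c + t) * ennreal ((?c + t) powr p) + indicator {-1..1} t"
      proof (cases "?c + t \<le> 1")
        case True with pos show ?thesis by (simp add: indicator_def)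
      next
        case False
        then have "(?c + t) powr p \<le> (?c + t) powr 0" using p by (intro powr_mono) auto
        then have "ennreal ((?c + t) powr p) \<le> 1" using pos by simp
        then show ?thesis using True False by (simp add: indicator_def)
      qed
      ultimately show ?thesis using True by (simp add: mult_left_mono)
    qed (auto simp: indicator_def)
  qed
  also have "\<dots> = ennreal (b powr p) * ((\<integral>\<^sup>+t. indicator {0<..1} (?c + t) * ennreal ((?c + t) powr p) \<partial>lborel) + 2)"
    by (simp add: nn_integral_cmult nn_integral_add)
  also have "(\<integral>\<^sup>+t. indicator {0<..1} (?c + t) * ennreal ((?c + t) powr p) \<partial>lborel)
      = (\<integral>\<^sup>+s. indicator {0<..1} s * ennreal (s powr p) \<partial>lborel)"
    using nn_integral_real_affine[of "\<lambda>s. indicator {0<..1} s * ennreal (s powr p)" 1 ?c] by simp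
  also have "\<dots> = ennreal (1 / (p + 1))" by (rule nn_integral_powr_unit_interval[OF p(1)])
  also have "ennreal (1 / (p + 1)) + 2 = ennreal (1 / (p + 1) + 2)" using p by (simp add: ennreal_plus)
  finally show ?thesis by (simp add: mult.commute)
qed

text \<open>As row k of \<open>B\<close> is a unit vector, the solution x of B x = c has k-th
  component c k = 1; Cramer's rule then compares the two determinants.\<close>

lemma det_replace_column:
  fixes B :: "real^'d^'d"
  assumes "invertible B" "\<And>j. B $ k $ j = (if j = k then 1 else 0)" "c $ k = 1"
  shows "det (\<chi> i j. if j = k then c $ i else B $ i $ j) = det B"
proof -
  obtain B' where B': "B ** B' = mat 1" using assms(1) by (auto simp: invertible_def)
  define x where "x = B' *v c"
  have Bx: "B *v x = c" by (simp add: x_def matrix_vector_mul_assoc B')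
  have "x $ k = (\<Sum>j\<in>UNIV. if j = k then x $ k else 0)" by simp
  also have "\<dots> = (B *v x) $ k"
    unfolding matrix_vector_mult_def vec_lambda_beta assms(2) by (rule sum.cong) auto
  finally have "x $ k = 1" using Bx assms(3) by simp
  then show ?thesis using cramer_lemma[of k B x] unfolding Bx by simp
qed

lemma det_affine_row:
  fixes R :: "'d \<Rightarrow> real^'d"
  shows "det (\<chi> i. if i = k then r + t *s u else R i)
    = det (\<chi> i. if i = k then r else R i) + t * det (\<chi> i. if i = k then u else R i)"
  by (simp only: det_row_add[where a="\<lambda>_. r" and b="\<lambda>_. t *s u"] det_row_mul[where a="\<lambda>_. u"])

text \<open>The principal submatrix on \<open>J\<close>, padded with the identity. All sizes thus
  live in one matrix type, and the padding changes neither the determinant nor positive definiteness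
  of the submatrix.\<close>

definition block :: "'d set \<Rightarrow> ('d set \<Rightarrow> real) \<Rightarrow> real^'d^'d" where
  "block J f = (\<chi> i j. if i \<in> J \<and> j \<in> J then f {i, j} else if i = j then 1 else 0)"

lemma block_UNIV: "block UNIV f = sym_of_coords f"
  by (simp add: block_def sym_of_coords_def)

lemma block_empty: "block {} f = mat 1"
  by (simp add: block_def mat_def)

lemma transpose_block: "transpose (block J f) = block J f"
  by (auto simp: block_def transpose_def vec_eq_iff insert_commute)

lemma block_measurable [measurable]:
  "block J \<in> borel_measurable (\<Pi>\<^sub>M p\<in>pairs. (lborel :: real measure))"
proof (rule borel_measurable_matrixI)
  fix i j :: 'a
  have "(\<lambda>f. f {i,j}) \<in> borel_measurable (\<Pi>\<^sub>M p\<in>pairs. (lborel :: real measure))"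
    using measurable_component_singleton[of "{i,j}" pairs "\<lambda>_. lborel :: real measure"] by simp
  then show "(\<lambda>f. block J f $ i $ j) \<in> borel_measurable (\<Pi>\<^sub>M p\<in>pairs. (lborel :: real measure))"
    by (simp add: block_def)
qed

lemma block_upd:
  "k \<notin> J \<Longrightarrow> block J (f({k} := t)) = block J f"
  by (auto simp: block_def vec_eq_iff doubleton_eq_iff)

text \<open>With \<open>u\<close> obtained from \<open>v\<close> by deleting the k-th coordinate,
  the quadratic form of the smaller block at \<open>v\<close> is that of the larger block at
  \<open>u\<close> plus the square of the k-th coordinate.\<close>

lemma posdef_block_subset:
  fixes f :: "'d::finite set \<Rightarrow> real"
  assumes pd: "block (insert k J) f \<in> posdef" and k: "k \<notin> J"
  shows "block J f \<in> posdef"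
proof (rule posdefI[OF transpose_block])
  fix v :: "real^'d" assume v: "v \<noteq> 0"
  let ?M = "block (insert k J) f"
  define u where "u = (\<chi> i. if i = k then 0 else v $ i)"
  have quad: "x \<bullet> (A *v x) = (\<Sum>i\<in>UNIV. \<Sum>j\<in>UNIV. x $ i * A $ i $ j * x $ j)" for x :: "real^'d" and A
    by (simp add: inner_vec_def matrix_vector_mult_def sum_distrib_left mult.assoc)
  have "v \<bullet> (block J f *v v) = (\<Sum>i\<in>UNIV. \<Sum>j\<in>UNIV. u $ i * ?M $ i $ j * u $ j + (if j = k then if i = k then v $ k * v $ k else 0 else 0))"
    unfolding quad using k by (intro sum.cong refl) (auto simp: u_def block_def)
  also have "\<dots> = u \<bullet> (?M *v u) + v $ k * v $ k"
    unfolding quad by (simp add: sum.distrib)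
  finally have *: "v \<bullet> (block J f *v v) = u \<bullet> (?M *v u) + v $ k * v $ k" .
  show "0 < v \<bullet> (block J f *v v)"
  proof (cases "u = 0")
    case True
    then have "v $ k \<noteq> 0" using v by (auto simp: u_def vec_eq_iff split: if_splits)
    then show ?thesis using True unfolding * by (auto simp: zero_less_mult_iff)
  next
    case False
    then show ?thesis unfolding * using posdef_pos[OF pd] by (intro add_pos_nonneg) auto
  qed
qed

text \<open>Split row k as \<open>r\<close> plus t times a unit vector and expand linearly. The
  slope has a unit vector as row k, so its column k may be replaced by that of the smaller block
  without changing the determinant.\<close>

lemma det_block_insert:
  fixes f :: "'d::finite set \<Rightarrow> real"
  assumes inv: "invertible (block J f)" and k: "k \<notin> J"
  obtains a where "\<And>t. det (block (insert k J) (f({k} := t))) = a + det (block J f) * t"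
proof -
  define c :: "real^'d" where "c = (\<chi> j. if j = k then 1 else if j \<in> J then f {k, j} else 0)"
  define r :: "real^'d" where "r = (\<chi> j. if j = k then 0 else c $ j)"
  define R where "R i = (\<chi> j. if j = k then c $ i else block J f $ i $ j)" for i
  have "block (insert k J) (f({k} := t)) = (\<chi> i. if i = k then r + t *s axis k 1 else R i)" for t
    using k by (auto simp: block_def vec_eq_iff r_def R_def c_def axis_def doubleton_eq_iff insert_commute)
  then have *: "det (block (insert k J) (f({k} := t)))
      = det (\<chi> i. if i = k then r else R i) + t * det (\<chi> i. if i = k then axis k 1 else R i)" for t
    by (simp only: det_affine_row)
  have "(\<chi> i. if i = k then axis k 1 else R i) = (\<chi> i j. if j = k then c $ i else block J f $ i $ j)"
    using k by (auto simp: vec_eq_iff R_def axis_def c_def block_def)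
  moreover have "det (\<chi> i j. if j = k then c $ i else block J f $ i $ j) = det (block J f)"
    using inv k by (intro det_replace_column) (auto simp: c_def block_def)
  ultimately have "det (\<chi> i. if i = k then axis k 1 else R i) = det (block J f)" by simp
  with * show ?thesis by (intro that[of "det (\<chi> i. if i = k then r else R i)"]) (simp add: mult.commute)
qed


text \<open>When k joins \<open>J\<close>, the diagonal coordinate at k is integrated first. There
  the determinant is affine with slope the determinant b of the smaller block, so the
  one-dimensional bound returns a constant times b^p, whatever the off-diagonal entries of the new
  row are. The same condition p > -1 thus works for every size.\<close>

lemma nn_integral_block_finite:
  fixes J :: "'d::finite set"
  assumes p: "-1 < p" "p \<le> 0"
  shows "(\<integral>\<^sup>+f. indicator (Pi\<^sub>E pairs (\<lambda>_. {-1..1})) f *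
      (indicator posdef (block J f) * ennreal (det (block J f) powr p)) \<partial>(\<Pi>\<^sub>M p\<in>pairs. (lborel :: real measure))) < \<infinity>"
  using finite[of J]
proof (induction J rule: finite_induct)
  case empty
  have "emeasure (\<Pi>\<^sub>M p\<in>(pairs :: 'd set set). (lborel :: real measure)) (Pi\<^sub>E pairs (\<lambda>_. {-1..1})) = 2 ^ card (pairs :: 'd set set)"
    by (subst lborel_product.emeasure_PiM) auto
  moreover have "(\<integral>\<^sup>+f. indicator (Pi\<^sub>E pairs (\<lambda>_. {-1..1})) f *
      (indicator posdef (block ({} :: 'd set) f) * ennreal (det (block ({} :: 'd set) f) powr p)) \<partial>(\<Pi>\<^sub>M p\<in>pairs. (lborel :: real measure)))
    = emeasure (\<Pi>\<^sub>M p\<in>(pairs :: 'd set set). (lborel :: real measure)) (Pi\<^sub>E pairs (\<lambda>_. {-1..1}))"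
    by (simp add: block_empty posdef_mat1)
  ultimately show ?case by (simp add: power_less_top_ennreal)
next
  case (insert k J)
  let ?P = "\<lambda>I. \<Pi>\<^sub>M p\<in>I. (lborel :: real measure)"
  define \<Phi> where "\<Phi> J f = indicator (Pi\<^sub>E pairs (\<lambda>_. {-1..1})) f *
      (indicator posdef (block J f) * ennreal (det (block J f) powr p))" for J and f :: "'d set \<Rightarrow> real"
  have \<Phi>_meas [measurable]: "\<Phi> J \<in> borel_measurable (?P pairs)" for J
  proof -
    have [measurable]: "Pi\<^sub>E pairs (\<lambda>_. {-1..1::real}) \<in> sets (?P (pairs :: 'd set set))"
      by (intro sets_PiM_I_finite) auto
    show ?thesis unfolding \<Phi>_def by measurable
  qed
  define C where "C = ennreal (1 / (p + 1) + 2)"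
  \<comment> \<open>All coordinates except the diagonal one at \<open>k\<close>; the new
    off-diagonal entries stay among these and are fixed while \<open>t\<close> is
    integrated.\<close>
  define E' where "E' = (pairs :: 'd set set) - {{k}}"
  have "{k} \<in> pairs" using doubleton_in_pairs[of k k] by simp
  then have E': "insert {k} E' = pairs" "finite E'" "{k} \<notin> E'" by (auto simp: E'_def)
  have ins: "(\<integral>\<^sup>+f. F f \<partial>?P pairs) = (\<integral>\<^sup>+f. (\<integral>\<^sup>+t. F (f({k} := t)) \<partial>lborel) \<partial>?P E')"
    if "F \<in> borel_measurable (?P pairs)" for F
    using lborel_product.product_nn_integral_insert[OF E'(2,3), of F] that by (simp add: E'(1))
  have "(\<integral>\<^sup>+f. \<Phi> (insert k J) f \<partial>?P pairs) = (\<integral>\<^sup>+f. (\<integral>\<^sup>+t. \<Phi> (insert k J) (f({k} := t)) \<partial>lborel) \<partial>?P E')"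
    by (rule ins) measurable
  also have "\<dots> \<le> (\<integral>\<^sup>+f. (\<integral>\<^sup>+t. C * \<Phi> J (f({k} := t)) \<partial>lborel) \<partial>?P E')"
  proof (rule nn_integral_mono)
    fix f assume "f \<in> space (?P E')"
    then have f: "f \<in> extensional E'" by (simp add: space_PiM PiE_def)
    define \<iota> :: ennreal where "\<iota> = indicator (Pi\<^sub>E E' (\<lambda>_. {-1..1})) f"
    have box: "indicator (Pi\<^sub>E pairs (\<lambda>_. {-1..1})) (f({k} := t)) = \<iota> * indicator {-1..1} t" for t
      using f E'(3) unfolding \<iota>_def E'(1)[symmetric]
      by (auto simp: indicator_def PiE_iff extensional_def)
    show "(\<integral>\<^sup>+t. \<Phi> (insert k J) (f({k} := t)) \<partial>lborel) \<le> (\<integral>\<^sup>+t. C * \<Phi> J (f({k} := t)) \<partial>lborel)"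
    proof (cases "block J f \<in> posdef")
      case False
      have "block (insert k J) (f({k} := t)) \<notin> posdef" for t
        using posdef_block_subset[of k J "f({k} := t)"] False insert.hyps(2) by (auto simp: block_upd)
      then show ?thesis by (simp add: \<Phi>_def)
    next
      case True
      let ?b = "det (block J f)"
      obtain a where a: "\<And>t. det (block (insert k J) (f({k} := t))) = a + ?b * t"
        using det_block_insert[OF posdef_invertible[OF True] insert.hyps(2)] by blast
      have "(\<integral>\<^sup>+t. \<Phi> (insert k J) (f({k} := t)) \<partial>lborel)
        \<le> (\<integral>\<^sup>+t. \<iota> * (indicator {-1..1} t * (indicator {t. a + ?b * t > 0} t * ennreal ((a + ?b * t) powr p))) \<partial>lborel)"
        unfolding \<Phi>_def box a mult.assoc
        by (intro nn_integral_mono mult_left_mono mult_right_mono) (use posdef_det_pos a in \<open>force simp: indicator_def\<close>)+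
      also have "\<dots> \<le> \<iota> * (C * ennreal (?b powr p))"
        unfolding C_def using nn_integral_affine_powr_le[OF p posdef_det_pos[OF True], of a]
        by (subst nn_integral_cmult) (auto intro: mult_left_mono)
      \<comment> \<open>The 2 is the length of [-1, 1]. It restores an integration over
        \<open>t\<close>, on which the smaller block does not depend, so that the induction
        hypothesis applies on the same product space.\<close>
      also have "\<dots> \<le> \<iota> * (C * ennreal (?b powr p)) * 2"
        using mult_left_mono[of 1 2 "\<iota> * (C * ennreal (?b powr p))"] by simp
      also have "\<dots> = (\<integral>\<^sup>+t. \<iota> * (C * ennreal (?b powr p)) * indicator {-1..1::real} t \<partial>lborel)"
        by (simp add: nn_integral_cmult)
      also have "\<dots> = (\<integral>\<^sup>+t. C * \<Phi> J (f({k} := t)) \<partial>lborel)"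
        unfolding \<Phi>_def box block_upd[OF insert.hyps(2)] using True by (simp add: mult_ac)
      finally show ?thesis .
    qed
  qed
  also have "\<dots> = (\<integral>\<^sup>+f. C * \<Phi> J f \<partial>?P pairs)"
    by (rule ins[symmetric]) measurable
  also have "\<dots> = C * (\<integral>\<^sup>+f. \<Phi> J f \<partial>?P pairs)"
    by (rule nn_integral_cmult) measurable
  also have "\<dots> < \<infinity>"
    using insert.IH by (simp add: \<Phi>_def C_def ennreal_mult_less_top)
  finally show ?case by (simp add: \<Phi>_def)
qed

text \<open>Each term of the Leibniz formula is at most 1 in absolute value. The crude bound serves
  positive exponents, which are compared with the exponent 0.\<close>

lemma det_unit_box_le: "x \<in> unit_box \<Longrightarrow> \<bar>det (x :: real^'d^'d)\<bar> \<le> real (card {\<pi> :: 'd \<Rightarrow> 'd. \<pi> permutes UNIV})"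
proof -
  assume x: "x \<in> unit_box"
  have "\<bar>det x\<bar> \<le> (\<Sum>\<pi>\<in>{\<pi>. \<pi> permutes UNIV}. \<bar>of_int (sign \<pi>) * (\<Prod>i\<in>UNIV. x $ i $ \<pi> i)\<bar>)"
    unfolding det_def by (rule sum_abs)
  also have "\<dots> \<le> (\<Sum>\<pi>\<in>{\<pi> :: 'd \<Rightarrow> 'd. \<pi> permutes UNIV}. 1)"
  proof (rule sum_mono)
    fix \<pi> :: "'d \<Rightarrow> 'd"
    have "(\<Prod>i\<in>UNIV. \<bar>x $ i $ \<pi> i\<bar>) \<le> 1" using x by (intro prod_le_1) (auto simp: unit_box_def)
    then show "\<bar>of_int (sign \<pi>) * (\<Prod>i\<in>UNIV. x $ i $ \<pi> i)\<bar> \<le> (1 :: real)"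
      by (simp add: abs_mult abs_prod sign_def)
  qed
  finally show ?thesis by simp
qed

lemma nn_integral_det_powr_unit_box_finite:
  assumes p: "-1 < p"
  shows "(\<integral>\<^sup>+x. indicator unit_box x * (indicator posdef x * ennreal (det x powr p)) \<partial>(sym_lebesgue :: (real^'d^'d) measure)) < \<infinity>"
proof -
  let ?I = "\<lambda>p. (\<integral>\<^sup>+x. indicator unit_box x * (indicator posdef x * ennreal (det x powr p)) \<partial>(sym_lebesgue :: (real^'d^'d) measure))"
  have fin: "?I q < \<infinity>" if q: "-1 < q" "q \<le> 0" for q
  proof -
    have "?I q = (\<integral>\<^sup>+f. indicator unit_box (sym_of_coords f :: real^'d^'d) * (indicator posdef (sym_of_coords f :: real^'d^'d) * ennreal (det (sym_of_coords f :: real^'d^'d) powr q)) \<partial>(\<Pi>\<^sub>M p\<in>pairs. lborel))"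
      by (rule nn_integral_sym_lebesgue) measurable
    also have "\<dots> = (\<integral>\<^sup>+f. indicator (Pi\<^sub>E pairs (\<lambda>_. {-1..1})) f *
      (indicator posdef (block UNIV f :: real^'d^'d) * ennreal (det (block UNIV f :: real^'d^'d) powr q)) \<partial>(\<Pi>\<^sub>M p\<in>pairs. (lborel :: real measure)))"
    proof (intro nn_integral_cong arg_cong2[where f="(*)"])
      fix f :: "'d set \<Rightarrow> real" assume "f \<in> space (\<Pi>\<^sub>M p\<in>pairs. (lborel :: real measure))"
      then have "sym_of_coords f \<in> unit_box \<longleftrightarrow> f \<in> Pi\<^sub>E pairs (\<lambda>_. {-1..1})"
        by (auto simp: space_PiM PiE_iff unit_box_def sym_of_coords_def abs_le_iff minus_le_iff elim!: pairsE)
      then show "(indicator unit_box (sym_of_coords f :: real^'d^'d) :: ennreal) = indicator (Pi\<^sub>E pairs (\<lambda>_. {-1..1})) f"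
        by (simp add: indicator_def)
    qed (simp_all add: block_UNIV)
    also have "\<dots> < \<infinity>" by (rule nn_integral_block_finite[OF q])
    finally show ?thesis .
  qed
  show ?thesis
  proof (cases "p \<le> 0")
    case False
    define K where "K = real (card {\<pi> :: 'd \<Rightarrow> 'd. \<pi> permutes UNIV})"
    have "?I p \<le> (\<integral>\<^sup>+x. ennreal (K powr p) * (indicator unit_box x * (indicator posdef x * ennreal (det x powr 0))) \<partial>(sym_lebesgue :: (real^'d^'d) measure))"
    proof (rule nn_integral_mono)
      fix x :: "real^'d^'d"
      show "indicator unit_box x * (indicator posdef x * ennreal (det x powr p))
        \<le> ennreal (K powr p) * (indicator unit_box x * (indicator posdef x * ennreal (det x powr 0)))"
      proof (cases "x \<in> unit_box \<and> x \<in> posdef")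
        case True
        then have "det x > 0" "det x \<le> K" using posdef_det_pos[of x] det_unit_box_le[of x] by (auto simp: K_def)
        then show ?thesis using True False by (simp add: powr_mono2 ennreal_leI)
      qed (auto simp: indicator_def)
    qed
    also have "\<dots> = ennreal (K powr p) * ?I 0" by (rule nn_integral_cmult) measurable
    also have "\<dots> < \<infinity>" using fin[of 0] by (simp add: ennreal_mult_less_top)
    finally show ?thesis .
  qed (use fin p in auto)
qed

section \<open>The congruence invariant measure and the Gamma function\<close>

definition dpow :: "real \<Rightarrow> real^'d^'d \<Rightarrow> ennreal" where
  "dpow s x = ennreal (det x powr s)"

text \<open>Like \<open>dpow\<close>, this takes values in \<open>ennreal\<close>: Fubini and the
  extraction of constants then need only measurability.\<close>

definition etr :: "real^'d^'d \<Rightarrow> ennreal" where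
  "etr x = ennreal (exp (- trace x))"

lemma dpow_measurable [measurable]: "dpow s \<in> borel_measurable borel"
  unfolding dpow_def by measurable

lemma etr_measurable [measurable]: "etr \<in> borel_measurable borel"
  unfolding etr_def by measurable

lemma dpow_add: "x \<in> posdef \<Longrightarrow> dpow (s + t) x = dpow s x * dpow t x"
  by (simp add: dpow_def powr_add ennreal_mult)

lemma dpow_0: "x \<in> posdef \<Longrightarrow> dpow 0 x = 1"
  using posdef_det_pos[of x] by (simp add: dpow_def)

lemma dpow_finite [simp]: "dpow s x \<noteq> \<infinity>" "dpow s x \<noteq> \<top>"
  by (auto simp: dpow_def)

lemma dpow_pos: "x \<in> posdef \<Longrightarrow> dpow s x \<noteq> 0"
  using posdef_det_pos[of x] by (simp add: dpow_def)

lemma dpow_minus: "x \<in> posdef \<Longrightarrow> dpow s x * dpow (- s) x = 1"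
  by (simp add: dpow_add[symmetric] dpow_0)

lemma dpow_mult: "det x > 0 \<Longrightarrow> det y > 0 \<Longrightarrow> det z = det x * det y \<Longrightarrow> dpow s z = dpow s x * dpow s y"
  by (simp add: dpow_def powr_mult ennreal_mult)

lemma etr_add: "etr (x + y) = etr x * etr y"
  by (simp add: etr_def trace_add exp_add[symmetric] ennreal_mult[symmetric])

lemma etr_finite [simp]: "etr x \<noteq> \<infinity>" "etr x \<noteq> \<top>" "etr x \<noteq> 0"
  by (auto simp: etr_def)

lemma det_congr: "det (transpose g ** x ** g) = (det g)\<^sup>2 * det (x :: real^'d^'d)"
  by (simp add: det_mul det_transpose power2_eq_square)

lemma sets_mu [measurable_cong, simp]: "sets mu = sets borel"
  and space_mu [simp]: "space mu = UNIV"
  by (auto simp: mu_def)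

lemma nn_integral_mu:
  fixes F :: "real^'d^'d \<Rightarrow> ennreal"
  assumes [measurable]: "F \<in> borel_measurable borel"
  shows "(\<integral>\<^sup>+x. F x \<partial>mu) = (\<integral>\<^sup>+x. indicator posdef x * dpow (- (real CARD('d) + 1) / 2) x * F x \<partial>sym_lebesgue)"
  unfolding mu_def dpow_def by (subst nn_integral_density) (auto simp: mult_ac)

lemma AE_mu: "AE x in mu. x \<in> posdef"
  unfolding mu_def by (subst AE_density) (auto simp: indicator_def)

lemma nn_integral_mu_cong:
  "(\<And>x. x \<in> posdef \<Longrightarrow> F x = G x) \<Longrightarrow> (\<integral>\<^sup>+x. F x \<partial>mu) = (\<integral>\<^sup>+x. G x \<partial>mu)"
  by (rule nn_integral_cong_AE) (use AE_mu in \<open>eventually_elim, auto\<close>)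

lemma sigma_finite_mu: "sigma_finite_measure (mu :: (real^'d^'d) measure)"
  unfolding mu_def
  by (subst sym_lebesgue.sigma_finite_iff_density_finite) (auto simp: indicator_def)

interpretation mu: sigma_finite_measure "mu :: (real^'d^'d) measure"
  by (rule sigma_finite_mu)

interpretation mu_pair: pair_sigma_finite "mu :: (real^'d^'d) measure" "mu :: (real^'d^'d) measure"
  by unfold_locales

text \<open>The exponent -(d+1)/2 in \<open>mu\<close> is made for this: a congruence multiplies the
  determinant by (det g)^2, and the resulting power of |det g| is the Jacobian of
  \<open>congr_scaling\<close>.\<close>

lemma nn_integral_mu_congr:
  fixes g :: "real^'d^'d"
  assumes g: "invertible g" and [measurable]: "F \<in> borel_measurable borel"
  shows "(\<integral>\<^sup>+x. F (transpose g ** x ** g) \<partial>mu) = (\<integral>\<^sup>+x. F x \<partial>mu)"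
proof -
  let ?\<delta> = "- (real CARD('d) + 1) / 2"
  have nz: "det g \<noteq> 0" using g by (simp add: invertible_det_nz)
  define c where "c = ennreal ((1 / \<bar>det g\<bar>) ^ (CARD('d) + 1))"
  have c: "c \<noteq> 0" "c \<noteq> \<infinity>" using nz by (auto simp: c_def)
  have c_eq: "c = ennreal ((det g)\<^sup>2 powr ?\<delta>)"
  proof -
    have "(det g)\<^sup>2 powr ?\<delta> = (\<bar>det g\<bar> powr 2) powr ?\<delta>" using nz by (simp add: powr_numeral)
    also have "\<dots> = \<bar>det g\<bar> powr (2 * ?\<delta>)" by (rule powr_powr)
    also have "2 * ?\<delta> = - real (CARD('d) + 1)" by simp
    also have "\<bar>det g\<bar> powr (- real (CARD('d) + 1)) = (1 / \<bar>det g\<bar>) ^ (CARD('d) + 1)" using nz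
      by (simp only: powr_minus powr_realpow zero_less_abs_iff not_False_eq_True) (simp add: power_one_over inverse_eq_divide)
    finally show ?thesis by (simp only: c_def)
  qed
  have "c * (\<integral>\<^sup>+x. F (transpose g ** x ** g) \<partial>mu)
    = (\<integral>\<^sup>+x. c * (indicator posdef x * dpow ?\<delta> x * F (transpose g ** x ** g)) \<partial>sym_lebesgue)"
    by (subst nn_integral_mu) (simp_all add: nn_integral_cmult)
  also have "\<dots> = (\<integral>\<^sup>+x. indicator posdef (transpose g ** x ** g) * dpow ?\<delta> (transpose g ** x ** g)
     * F (transpose g ** x ** g) \<partial>sym_lebesgue)"
  proof (rule nn_integral_cong)
    fix x :: "real^'d^'d"
    show "c * (indicator posdef x * dpow ?\<delta> x * F (transpose g ** x ** g))
      = indicator posdef (transpose g ** x ** g) * dpow ?\<delta> (transpose g ** x ** g) * F (transpose g ** x ** g)"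
    proof (cases "x \<in> posdef")
      case True
      then have "dpow ?\<delta> (transpose g ** x ** g) = c * dpow ?\<delta> x"
        using posdef_det_pos[OF True] by (simp add: dpow_def det_congr powr_mult ennreal_mult c_eq)
      then show ?thesis using True by (simp add: indicator_def posdef_congr_iff[OF g] mult_ac)
    qed (simp add: indicator_def posdef_congr_iff[OF g])
  qed
  also have "\<dots> = c * (\<integral>\<^sup>+x. indicator posdef x * dpow ?\<delta> x * F x \<partial>sym_lebesgue)"
    using congr_scaling[of g, unfolded congr_scaling_def, folded c_def, rule_format, OF nz,
      of "\<lambda>x. indicator posdef x * dpow ?\<delta> x * F x"] by simp
  also have "\<dots> = c * (\<integral>\<^sup>+x. F x \<partial>mu)" by (subst nn_integral_mu) simp_all
  finally show ?thesis using c ennreal_mult_cancel_left by auto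
qed

text \<open>The extended counterpart of \<open>mGamma\<close>. The Bochner integral there is 0 when
  the integral diverges, so identities are proved for this version and transferred once it is known
  to be finite.\<close>

definition nGamma :: "'d::finite itself \<Rightarrow> real \<Rightarrow> ennreal" where
  "nGamma _ s = (\<integral>\<^sup>+x. dpow s x * etr x \<partial>(mu :: (real^'d^'d) measure))"

text \<open>Trace at most 1 puts a positive definite matrix into \<open>unit_box\<close>. Relative
  to \<open>sym_lebesgue\<close> the exponent is s - (d+1)/2, which exceeds -1 exactly when s >
  (d-1)/2.\<close>

lemma nn_integral_dpow_trace_le_finite:
  assumes s: "s > (real CARD('d) - 1) / 2"
  shows "(\<integral>\<^sup>+x. indicator {x. trace x \<le> 1} x * dpow s x \<partial>(mu :: (real^'d^'d) measure)) < \<infinity>"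
proof -
  let ?\<delta> = "- (real CARD('d) + 1) / 2"
  have "(\<integral>\<^sup>+x. indicator {x. trace x \<le> 1} x * dpow s x \<partial>(mu :: (real^'d^'d) measure))
    = (\<integral>\<^sup>+x. indicator posdef x * dpow ?\<delta> x * (indicator {x. trace x \<le> 1} x * dpow s x) \<partial>(sym_lebesgue :: (real^'d^'d) measure))"
    by (subst nn_integral_mu) simp_all
  also have "\<dots> \<le> (\<integral>\<^sup>+x. indicator unit_box x * (indicator posdef x * ennreal (det x powr (?\<delta> + s))) \<partial>(sym_lebesgue :: (real^'d^'d) measure))"
  proof (rule nn_integral_mono)
    fix x :: "real^'d^'d"
    show "indicator posdef x * dpow ?\<delta> x * (indicator {x. trace x \<le> 1} x * dpow s x)
      \<le> indicator unit_box x * (indicator posdef x * ennreal (det x powr (?\<delta> + s)))"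
    proof (cases "x \<in> posdef \<and> trace x \<le> 1")
      case True
      then have "x \<in> unit_box"
        using posdef_entry_le_trace[OF posdef_sym posdef_nonneg, of x] by (auto simp: unit_box_def intro: order.trans)
      then show ?thesis using True dpow_add[of x "?\<delta>" s] by (simp add: indicator_def dpow_def)
    qed (auto simp: indicator_def)
  qed
  also have "\<dots> < \<infinity>" using s by (intro nn_integral_det_powr_unit_box_finite) (simp add: field_simps)
  finally show ?thesis .
qed

text \<open>Scaling by R is the congruence by sqrt R times the identity, which leaves
  \<open>mu\<close> unchanged and multiplies the determinant by R^d.\<close>

lemma nn_integral_dpow_trace_le_scale:
  fixes R :: real
  assumes R: "R > 0"
  shows "(\<integral>\<^sup>+x. indicator {x. trace x \<le> R} x * dpow s x \<partial>(mu :: (real^'d^'d) measure))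
    = ennreal (R powr (real CARD('d) * s)) * (\<integral>\<^sup>+x. indicator {x. trace x \<le> 1} x * dpow s x \<partial>(mu :: (real^'d^'d) measure))"
proof -
  define g where "g = sqrt R *\<^sub>R (mat 1 :: real^'d^'d)"
  have gx: "transpose g ** x ** g = R *\<^sub>R x" for x
    using R by (simp add: g_def transpose_scalar scalar_matrix_assoc[symmetric] matrix_scalar_ac transpose_mat)
  have "g ** ((1 / sqrt R) *\<^sub>R mat 1) = mat 1" "((1 / sqrt R) *\<^sub>R mat 1) ** g = mat 1"
    using R by (simp_all add: g_def scalar_matrix_assoc[symmetric] matrix_scalar_ac)
  then have "invertible g" by (auto simp: invertible_def)
  then have "(\<integral>\<^sup>+x. indicator {x. trace x \<le> R} x * dpow s x \<partial>(mu :: (real^'d^'d) measure))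
    = (\<integral>\<^sup>+x. indicator {x. trace x \<le> R} (transpose g ** x ** g) * dpow s (transpose g ** x ** g) \<partial>mu)"
    by (intro nn_integral_mu_congr[symmetric]) measurable
  also have "\<dots> = (\<integral>\<^sup>+x. ennreal (R powr (real CARD('d) * s)) * (indicator {x. trace x \<le> 1} x * dpow s x) \<partial>(mu :: (real^'d^'d) measure))"
  proof (rule nn_integral_mu_cong)
    fix x :: "real^'d^'d" assume x: "x \<in> posdef"
    have "det (R *\<^sub>R x) = R ^ CARD('d) * det x"
    proof -
      have "det (R *\<^sub>R x) = (det g)\<^sup>2 * det x" using det_congr[of g x] by (simp only: gx)
      also have "det g = sqrt R ^ CARD('d)" unfolding g_def by (subst det_diagonal) (auto simp: mat_def)
      finally show ?thesis using R by (simp add: power_mult_distrib[symmetric] power2_eq_square)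
    qed
    then have "dpow s (R *\<^sub>R x) = ennreal (R powr (real CARD('d) * s)) * dpow s x"
      using R posdef_det_pos[OF x] by (simp add: dpow_def powr_mult ennreal_mult powr_powr powr_realpow[symmetric])
    moreover have "trace (R *\<^sub>R x) = R * trace x" by (simp add: trace_def sum_distrib_left)
    ultimately show "indicator {x. trace x \<le> R} (transpose g ** x ** g) * dpow s (transpose g ** x ** g)
      = ennreal (R powr (real CARD('d) * s)) * (indicator {x. trace x \<le> 1} x * dpow s x)"
      unfolding gx using R by (simp add: indicator_def)
  qed
  also have "\<dots> = ennreal (R powr (real CARD('d) * s)) * (\<integral>\<^sup>+x. indicator {x. trace x \<le> 1} x * dpow s x \<partial>(mu :: (real^'d^'d) measure))"
    by (rule nn_integral_cmult) measurable
  finally show ?thesis .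
qed

lemma summable_exp_minus_powr: "summable (\<lambda>n. exp (- real n) * (real n + 1) powr c)"
proof -
  \<comment> \<open>Two powers more than c: from y^l \<le> l! exp y at y = n + 1, the summand is at
    most a constant times 1/(n+1)^2.\<close>
  obtain l :: nat where l: "c + 2 \<le> real l" using real_arch_simple by blast
  have "summable (\<lambda>n. (fact l * exp 1) * (1 / real (Suc n) ^ 2))"
  proof (rule summable_mult)
    have "summable (\<lambda>n. 1 / real n ^ 2)"
      using inverse_power_summable[of 2, where 'a=real] by (simp add: inverse_eq_divide)
    then show "summable (\<lambda>n. 1 / real (Suc n) ^ 2)" by (subst summable_Suc_iff)
  qed
  then show ?thesis
  proof (rule summable_comparison_test')
    fix n :: nat
    let ?x = "real n + 1"
    have "?x powr c * ?x ^ 2 = ?x powr (c + 2)" by (simp add: powr_add)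
    also have "\<dots> \<le> ?x powr real l" using l by (intro powr_mono) auto
    also have "\<dots> = ?x ^ l" by (simp add: powr_realpow)
    also have "\<dots> \<le> fact l * exp ?x"
    proof -
      have "(\<Sum>k\<in>{l}. ?x ^ k /\<^sub>R fact k) \<le> exp ?x"
        unfolding exp_def by (rule sum_le_suminf) (use summable_exp[of ?x] in auto)
      then show ?thesis by (simp add: field_simps)
    qed
    finally have "exp (- real n) * (?x powr c * ?x ^ 2) \<le> exp (- real n) * (fact l * exp ?x)" by simp
    also have "\<dots> = fact l * exp 1" by (simp add: exp_add exp_minus field_simps)
    finally show "norm (exp (- real n) * ?x powr c) \<le> (fact l * exp 1) * (1 / real (Suc n) ^ 2)"
      by (simp add: field_simps)
  qed
qed

text \<open>Sort the matrices by the integer part n of the trace. There the exponential is at most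
  exp(-n), while the set of trace at most n + 1 costs only a power of n + 1 by scaling.\<close>

lemma nGamma_finite:
  assumes s: "s > (real CARD('d) - 1) / 2"
  shows "nGamma TYPE('d::finite) s < \<infinity>"
proof -
  let ?G = "(\<integral>\<^sup>+x. indicator {x. trace x \<le> 1} x * dpow s x \<partial>(mu :: (real^'d^'d) measure))"
  have "nGamma TYPE('d) s \<le> (\<integral>\<^sup>+x. (\<Sum>n. ennreal (exp (- real n)) * (indicator {x. trace x \<le> real n + 1} x * dpow s x)) \<partial>(mu :: (real^'d^'d) measure))"
    unfolding nGamma_def
  proof (rule nn_integral_mono_AE, use AE_mu in eventually_elim)
    fix x :: "real^'d^'d" assume x: "x \<in> posdef"
    define n where "n = nat \<lfloor>trace x\<rfloor>"
    have "0 \<le> trace x" unfolding trace_def using posdef_diag_pos[OF x] by (intro sum_nonneg less_imp_le)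
    then have n: "real n \<le> trace x" "trace x \<le> real n + 1" unfolding n_def by linarith+
    let ?f = "\<lambda>n. ennreal (exp (- real n)) * (indicator {x. trace x \<le> real n + 1} x * dpow s x)"
    have "dpow s x * etr x \<le> ?f n"
      using n by (simp add: etr_def mult.commute mult_left_mono)
    also have "\<dots> = (\<Sum>k\<in>{n}. ?f k)" by simp
    also have "\<dots> \<le> (\<Sum>k. ?f k)" by (rule sum_le_suminf) auto
    finally show "dpow s x * etr x \<le> (\<Sum>k. ?f k)" .
  qed
  also have "\<dots> = (\<Sum>n. ennreal (exp (- real n)) * (ennreal ((real n + 1) powr (real CARD('d) * s)) * ?G))"
  proof -
    have "(\<integral>\<^sup>+x. ennreal (exp (- real n)) * (indicator {x. trace x \<le> real n + 1} x * dpow s x) \<partial>(mu :: (real^'d^'d) measure))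
      = ennreal (exp (- real n)) * (ennreal ((real n + 1) powr (real CARD('d) * s)) * ?G)" for n
      by (subst nn_integral_cmult, measurable, subst nn_integral_dpow_trace_le_scale) simp_all
    then show ?thesis by (subst nn_integral_suminf) simp_all
  qed
  also have "\<dots> = (\<Sum>n. ennreal (exp (- real n) * (real n + 1) powr (real CARD('d) * s))) * ?G"
    by (subst ennreal_suminf_multc[symmetric]) (simp add: ennreal_mult mult.assoc)
  also have "\<dots> < \<infinity>"
    using nn_integral_dpow_trace_le_finite[OF s]
    by (subst suminf_ennreal2) (auto intro!: summable_exp_minus_powr simp: ennreal_mult_less_top)
  finally show ?thesis .
qed

lemma mGamma_eq: "mGamma TYPE('d::finite) s = enn2real (nGamma TYPE('d) s)"
proof -
  have "mGamma TYPE('d) s = enn2real (\<integral>\<^sup>+x. ennreal (det x powr s * exp (- trace x)) \<partial>(mu :: (real^'d^'d) measure))"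
    unfolding mGamma_def by (rule integral_eq_nn_integral) auto
  then show ?thesis by (simp add: nGamma_def dpow_def etr_def ennreal_mult)
qed

section \<open>Beta and Euler integrals\<close>

interpretation mu_sym: pair_sigma_finite "mu :: (real^'d^'d) measure" "sym_lebesgue :: (real^'d^'d) measure"
  by unfold_locales

text \<open>Otherwise the cone would be a null set for \<open>sym_lebesgue\<close>, and so would its
  translates by -n I. These countably many translates cover all symmetric matrices, but the unit box
  has positive measure.\<close>

lemma nGamma_nonzero: "nGamma TYPE('d::finite) s \<noteq> 0"
proof
  assume "nGamma TYPE('d) s = 0"
  then have "AE x in (mu :: (real^'d^'d) measure). dpow s x * etr x = 0"
    unfolding nGamma_def by (subst (asm) nn_integral_0_iff_AE) auto
  then have "AE x in (mu :: (real^'d^'d) measure). False"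
    using AE_mu by eventually_elim (simp add: dpow_pos)
  then have "AE x in (sym_lebesgue :: (real^'d^'d) measure). x \<notin> posdef"
    unfolding mu_def by (subst (asm) AE_density) (auto simp: indicator_def elim!: eventually_mono dest: posdef_det_pos)
  then have null: "(\<integral>\<^sup>+x. indicator posdef x \<partial>(sym_lebesgue :: (real^'d^'d) measure)) = 0"
    by (subst nn_integral_0_iff_AE) (auto simp: indicator_def)
  have "AE x in (sym_lebesgue :: (real^'d^'d) measure). \<forall>n::nat. x + real n *\<^sub>R mat 1 \<notin> posdef"
    unfolding AE_all_countable
  proof
    fix n :: nat
    have "(\<integral>\<^sup>+x. indicator posdef (x + real n *\<^sub>R mat 1) \<partial>(sym_lebesgue :: (real^'d^'d) measure)) = 0"
      by (subst nn_integral_sym_lebesgue_translation) (auto simp: null transpose_scalar transpose_mat)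
    then show "AE x in (sym_lebesgue :: (real^'d^'d) measure). x + real n *\<^sub>R mat 1 \<notin> posdef"
      by (subst (asm) nn_integral_0_iff_AE) (auto simp: indicator_def)
  qed
  then have "AE x in (sym_lebesgue :: (real^'d^'d) measure). False"
    using AE_sym_lebesgue
  proof eventually_elim
    fix x :: "real^'d^'d" assume x: "transpose x = x" and n: "\<forall>n::nat. x + real n *\<^sub>R mat 1 \<notin> posdef"
    \<comment> \<open>Any n above the operator norm of \<open>x\<close> outweighs the negative part
      of its quadratic form.\<close>
    obtain n where "onorm ((*v) x) < real n" using reals_Archimedean2 by blast
    have "x + real n *\<^sub>R mat 1 \<in> posdef"
    proof (rule posdefI)
      show "transpose (x + real n *\<^sub>R mat 1) = x + real n *\<^sub>R mat 1"
        by (simp add: transpose_add transpose_scalar transpose_mat x)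
      fix v :: "real^'d" assume v: "v \<noteq> 0"
      have "- (v \<bullet> (x *v v)) \<le> norm v * norm (x *v v)"
        using Cauchy_Schwarz_ineq2[of v "x *v v"] by linarith
      also have "\<dots> \<le> norm v * (onorm ((*v) x) * norm v)"
        by (intro mult_left_mono onorm matrix_vector_mul_bounded_linear) auto
      also have "\<dots> < norm v * (real n * norm v)"
        using v \<open>onorm ((*v) x) < real n\<close> by simp
      also have "\<dots> = real n * (v \<bullet> v)" by (simp add: power2_norm_eq_inner[symmetric] power2_eq_square)
      finally show "0 < v \<bullet> ((x + real n *\<^sub>R mat 1) *v v)"
        by (simp add: matrix_vector_mult_add_rdistrib inner_add_right scaleR_matrix_vector_assoc[symmetric])
    qed
    with n show False by blast
  qed
  then have "emeasure (sym_lebesgue :: (real^'d^'d) measure) UNIV = 0"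
    by (auto simp: AE_iff_null)
  then have "emeasure sym_lebesgue (unit_box :: (real^'d^'d) set) = 0"
    by (metis emeasure_mono le_zero_eq sets.top sets_sym_lebesgue space_borel subset_UNIV)
  then show False using emeasure_unit_box(1) by blast
qed

section \<open>Gamma and Euler integrals by symmetric substitutions\<close>

lemma nn_integral_mu_congr_sym:
  fixes c :: "real^'d^'d"
  assumes "transpose c = c" "invertible c" "F \<in> borel_measurable borel"
  shows "(\<integral>\<^sup>+x. F (c ** x ** c) \<partial>mu) = (\<integral>\<^sup>+x. F x \<partial>mu)"
  using nn_integral_mu_congr[OF assms(2,3)] assms(1) by simp

lemma posdef_congr_sym_iff:
  fixes c :: "real^'d^'d"
  assumes "transpose c = c" "invertible c"
  shows "c ** x ** c \<in> posdef \<longleftrightarrow> x \<in> posdef"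
  using posdef_congr_iff[OF assms(2), of x] assms(1) by simp

lemma dpow_congr_sym:
  fixes c :: "real^'d^'d"
  assumes "c ** c = y" "y \<in> posdef" "x \<in> posdef"
  shows "dpow s (c ** x ** c) = dpow s y * dpow s x"
  by (rule dpow_mult) (use assms posdef_det_pos in \<open>auto simp: det_mul[of _ c] det_mul\<close>)

lemma etr_mult_commute: "etr (x ** y) = etr (y ** x)"
  unfolding etr_def by (simp only: trace_mul_sym[of x y])

lemma etr_congr_sym: "c ** c = y \<Longrightarrow> etr (c ** x ** c) = etr (y ** x)"
  by (metis etr_mult_commute matrix_mul_assoc)

lemma etr_mult_add: "etr ((x + y) ** z) = etr (x ** z) * etr (y ** z)"
  by (simp add: matrix_mult_add_rdistrib etr_add)

lemma etr_mult_add2: "etr (x ** (y + z)) = etr (x ** y) * etr (x ** z)"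
  by (simp add: matrix_add_ldistrib etr_add)

text \<open>Substitute x -> c x c with c the root of \<open>y\<close>. Read from right to left, this
  writes a power of |y| as an integral of exponentials, in which a sum inside \<open>y\<close>
  factorises.\<close>

lemma nn_integral_dpow_etr:
  fixes y :: "real^'d^'d"
  assumes y: "y \<in> posdef"
  shows "(\<integral>\<^sup>+x. dpow s x * etr (y ** x) \<partial>mu) = nGamma TYPE('d) s * dpow (- s) y"
proof -
  obtain c where c: "transpose c = c" "invertible c" "c ** c = y" using posdef_sqrt[OF y] .
  have "nGamma TYPE('d) s = (\<integral>\<^sup>+x. dpow s (c ** x ** c) * etr (c ** x ** c) \<partial>mu)"
    unfolding nGamma_def by (rule nn_integral_mu_congr_sym[OF c(1,2), symmetric]) measurable
  also have "\<dots> = (\<integral>\<^sup>+x. dpow s y * (dpow s x * etr (y ** x)) \<partial>mu)"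
    by (rule nn_integral_mu_cong) (simp add: dpow_congr_sym[OF c(3) y] etr_congr_sym[OF c(3)] mult.assoc)
  also have "\<dots> = dpow s y * (\<integral>\<^sup>+x. dpow s x * etr (y ** x) \<partial>mu)"
    by (rule nn_integral_cmult) measurable
  finally have "nGamma TYPE('d) s * dpow (- s) y
    = (dpow s y * dpow (- s) y) * (\<integral>\<^sup>+x. dpow s x * etr (y ** x) \<partial>mu)" by (simp add: mult_ac)
  then show ?thesis by (simp add: dpow_minus[OF y])
qed

text \<open>Write |I + x| to the power -(a+b) as a Gamma integral over y and integrate x first: that
  yields |y|^(-a) and leaves the Gamma integral for b.\<close>

lemma nn_integral_beta:
  "nGamma TYPE('d::finite) (a + b) * (\<integral>\<^sup>+x. dpow a x * dpow (- (a + b)) (mat 1 + x) \<partial>(mu :: (real^'d^'d) measure))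
    = nGamma TYPE('d) a * nGamma TYPE('d) b"
proof -
  have "nGamma TYPE('d) (a + b) * (\<integral>\<^sup>+x. dpow a x * dpow (- (a + b)) (mat 1 + x) \<partial>(mu :: (real^'d^'d) measure))
    = (\<integral>\<^sup>+x. dpow a x * (nGamma TYPE('d) (a + b) * dpow (- (a + b)) (mat 1 + x)) \<partial>(mu :: (real^'d^'d) measure))"
    by (subst nn_integral_cmult[symmetric]) (auto simp: mult_ac)
  also have "\<dots> = (\<integral>\<^sup>+x. (\<integral>\<^sup>+y. dpow a x * (dpow (a + b) y * (etr y * etr (y ** x))) \<partial>mu) \<partial>(mu :: (real^'d^'d) measure))"
  proof (rule nn_integral_mu_cong)
    fix x :: "real^'d^'d" assume x: "x \<in> posdef"
    have "nGamma TYPE('d) (a + b) * dpow (- (a + b)) (mat 1 + x)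
       = (\<integral>\<^sup>+y. dpow (a + b) y * (etr y * etr (y ** x)) \<partial>mu)"
      by (subst nn_integral_dpow_etr[symmetric])
        (simp_all add: posdef_add posdef_mat1 x etr_mult_add etr_mult_commute[of x])
    then show "dpow a x * (nGamma TYPE('d) (a + b) * dpow (- (a + b)) (mat 1 + x))
       = (\<integral>\<^sup>+y. dpow a x * (dpow (a + b) y * (etr y * etr (y ** x))) \<partial>mu)"
      by (subst nn_integral_cmult) auto
  qed
  also have "\<dots> = (\<integral>\<^sup>+y. (\<integral>\<^sup>+x. dpow a x * (dpow (a + b) y * (etr y * etr (y ** x))) \<partial>mu) \<partial>(mu :: (real^'d^'d) measure))"
    by (rule mu_pair.Fubini') measurable
  also have "\<dots> = (\<integral>\<^sup>+y. nGamma TYPE('d) a * (dpow b y * etr y) \<partial>(mu :: (real^'d^'d) measure))"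
  proof (rule nn_integral_mu_cong)
    fix y :: "real^'d^'d" assume y: "y \<in> posdef"
    have "(\<integral>\<^sup>+x. dpow a x * (dpow (a + b) y * (etr y * etr (y ** x))) \<partial>mu)
      = dpow (a + b) y * etr y * (\<integral>\<^sup>+x. dpow a x * etr (y ** x) \<partial>mu)"
      by (subst nn_integral_cmult[symmetric]) (auto simp: mult_ac)
    also have "\<dots> = nGamma TYPE('d) a * (dpow b y * (dpow a y * dpow (- a) y) * etr y)"
      by (simp add: nn_integral_dpow_etr y dpow_add mult_ac)
    finally show "(\<integral>\<^sup>+x. dpow a x * (dpow (a + b) y * (etr y * etr (y ** x))) \<partial>mu)
      = nGamma TYPE('d) a * (dpow b y * etr y)" by (simp add: dpow_minus y)
  qed
  also have "\<dots> = nGamma TYPE('d) a * nGamma TYPE('d) b"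
    by (subst nn_integral_cmult) (auto simp: nGamma_def)
  finally show ?thesis .
qed

text \<open>\<open>rho \<alpha>\<close> is the density of \<open>|x|\<^sup>\<alpha> \<mu>(dx)\<close> with respect to \<open>sym_lebesgue\<close>. It vanishes
  off \<open>posdef\<close>, so that \<open>rho \<alpha> (v - x)\<close> restricts integrals to \<open>x < v\<close>.\<close>

definition rho :: "real \<Rightarrow> real^'d^'d \<Rightarrow> ennreal" where
  "rho \<alpha> x = indicator posdef x * dpow (\<alpha> - (real CARD('d) + 1) / 2) x"

lemma rho_measurable [measurable]: "rho \<alpha> \<in> borel_measurable borel"
  unfolding rho_def by measurable

lemma nn_integral_mu_dpow:
  fixes F :: "real^'d^'d \<Rightarrow> ennreal"
  assumes [measurable]: "F \<in> borel_measurable borel"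
  shows "(\<integral>\<^sup>+x. F x * dpow \<alpha> x \<partial>mu) = (\<integral>\<^sup>+x. F x * rho \<alpha> x \<partial>sym_lebesgue)"
proof (subst nn_integral_mu, measurable, rule nn_integral_cong)
  fix x :: "real^'d^'d"
  show "indicator posdef x * dpow (- (real CARD('d) + 1) / 2) x * (F x * dpow \<alpha> x) = F x * rho \<alpha> x"
  proof (cases "x \<in> posdef")
    case True
    have "\<alpha> - (real CARD('d) + 1) / 2 = - (real CARD('d) + 1) / 2 + \<alpha>" by linarith
    then show ?thesis using True by (simp only: rho_def dpow_add) (simp add: mult_ac)
  qed (simp add: rho_def)
qed

lemma nn_integral_sym_lebesgue_minus:
  fixes x :: "real^'d^'d"
  assumes "transpose x = x" and [measurable]: "F \<in> borel_measurable borel"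
  shows "(\<integral>\<^sup>+v. F (v - x) \<partial>sym_lebesgue) = (\<integral>\<^sup>+v. F v \<partial>sym_lebesgue)"
proof -
  have "transpose (- x) = - x" using assms(1) by (simp add: transpose_def vec_eq_iff)
  from nn_integral_sym_lebesgue_translation[OF this assms(2)] show ?thesis by simp
qed

lemma nn_integral_rho_shift:
  fixes x :: "real^'d^'d"
  assumes x: "x \<in> posdef" and [measurable]: "F \<in> borel_measurable borel"
  shows "(\<integral>\<^sup>+y. F (x + y) * dpow \<alpha> y \<partial>mu) = (\<integral>\<^sup>+v. F v * rho \<alpha> (v - x) \<partial>sym_lebesgue)"
  using nn_integral_sym_lebesgue_minus[OF posdef_sym[OF x], of "\<lambda>y. F (x + y) * rho \<alpha> y"]
  by (subst nn_integral_mu_dpow) simp_all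

lemma rho_minus_nonzero: "x \<in> posdef \<Longrightarrow> v \<notin> posdef \<Longrightarrow> rho \<alpha> (v - x) = 0"
  using posdef_add[of x "v - x"] by (auto simp: rho_def indicator_def)

lemma rho_congr_sym:
  fixes c :: "real^'d^'d"
  assumes c: "transpose c = c" "invertible c" "c ** c = y" and y: "y \<in> posdef"
  shows "rho \<alpha> (y - c ** u ** c) = dpow (\<alpha> - (real CARD('d) + 1) / 2) y * rho \<alpha> (mat 1 - u)"
proof -
  have "y - c ** u ** c = c ** (mat 1 - u) ** c"
    using c(3) matrix_mult_add_rdistrib[of "c ** (mat 1 - u)" "c ** u" c] matrix_add_ldistrib[of c "mat 1 - u" u]
    by (simp add: algebra_simps)
  then show ?thesis
    using dpow_congr_sym[OF c(3) y, of "mat 1 - u"] posdef_congr_sym_iff[OF c(1,2), of "mat 1 - u"]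
    by (auto simp: rho_def indicator_def)
qed

text \<open>The power (d+1)/2 cancels the density of \<open>mu\<close>, leaving
  \<open>sym_lebesgue\<close>, which unlike \<open>mu\<close> is translation invariant. The shift of
  s by r then reduces everything to a Gamma integral.\<close>

lemma nn_integral_rho_etr:
  fixes k r :: "real^'d^'d"
  assumes k: "k \<in> posdef" and r: "r \<in> posdef"
  shows "(\<integral>\<^sup>+s. dpow ((real CARD('d) + 1) / 2) s * etr (k ** s) * rho \<alpha> (s - r) \<partial>mu)
    = nGamma TYPE('d) \<alpha> * dpow (- \<alpha>) k * etr (k ** r)"
proof -
  have "(\<integral>\<^sup>+s. dpow ((real CARD('d) + 1) / 2) s * etr (k ** s) * rho \<alpha> (s - r) \<partial>mu)
    = (\<integral>\<^sup>+s. etr (k ** s) * rho \<alpha> (s - r) \<partial>sym_lebesgue)"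
  proof (subst nn_integral_mu, measurable, rule nn_integral_cong)
    fix s :: "real^'d^'d"
    show "indicator posdef s * dpow (- (real CARD('d) + 1) / 2) s * (dpow ((real CARD('d) + 1) / 2) s * etr (k ** s) * rho \<alpha> (s - r))
      = etr (k ** s) * rho \<alpha> (s - r)"
    proof (cases "s \<in> posdef")
      case True
      then have "dpow (- (real CARD('d) + 1) / 2) s * dpow ((real CARD('d) + 1) / 2) s = 1"
        using dpow_minus[of s "(real CARD('d) + 1) / 2"] by (simp add: mult.commute minus_divide_left)
      then have "dpow (- (real CARD('d) + 1) / 2) s * (dpow ((real CARD('d) + 1) / 2) s * C) = C" for C
        by (simp only: mult.assoc[symmetric]) simp
      then show ?thesis using True by (simp add: mult.assoc)
    qed (simp add: rho_minus_nonzero r)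
  qed
  also have "\<dots> = (\<integral>\<^sup>+q. etr (k ** (r + q)) * dpow \<alpha> q \<partial>mu)"
    by (rule nn_integral_rho_shift[OF r, symmetric]) measurable
  also have "\<dots> = etr (k ** r) * (\<integral>\<^sup>+q. dpow \<alpha> q * etr (k ** q) \<partial>mu)"
    by (subst nn_integral_cmult[symmetric]) (auto simp: etr_mult_add2 mult_ac)
  finally show ?thesis by (simp add: nn_integral_dpow_etr k mult_ac)
qed

text \<open>With r = c u c and c the root of \<open>s\<close>, the region r < s becomes u < I, and s
  - r becomes a congruence of I - u. Used to move the dependence on s from the exponential to
  \<open>rho\<close>.\<close>

lemma nn_integral_rho_scale:
  fixes s :: "real^'d^'d"
  assumes s: "s \<in> posdef"
  shows "(\<integral>\<^sup>+u. dpow \<beta> u * etr (u ** s) * rho \<alpha> (mat 1 - u) \<partial>mu)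
    = dpow ((real CARD('d) + 1) / 2 - (\<alpha> + \<beta>)) s * (\<integral>\<^sup>+r. dpow \<beta> r * etr r * rho \<alpha> (s - r) \<partial>mu)"
proof -
  let ?\<delta> = "(real CARD('d) + 1) / 2"
  obtain c where c: "transpose c = c" "invertible c" "c ** c = s" using posdef_sqrt[OF s] .
  have "(\<integral>\<^sup>+r. dpow \<beta> r * etr r * rho \<alpha> (s - r) \<partial>mu)
    = (\<integral>\<^sup>+u. dpow \<beta> (c ** u ** c) * etr (c ** u ** c) * rho \<alpha> (s - c ** u ** c) \<partial>mu)"
    by (rule nn_integral_mu_congr_sym[OF c(1,2), symmetric]) measurable
  also have "\<dots> = (\<integral>\<^sup>+u. (dpow \<beta> s * dpow (\<alpha> - ?\<delta>) s) * (dpow \<beta> u * etr (u ** s) * rho \<alpha> (mat 1 - u)) \<partial>mu)"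
    by (rule nn_integral_mu_cong)
      (simp add: dpow_congr_sym[OF c(3) s] etr_congr_sym[OF c(3)] rho_congr_sym[OF c s] etr_mult_commute[of s] mult_ac)
  also have "\<dots> = (dpow \<beta> s * dpow (\<alpha> - ?\<delta>) s) * (\<integral>\<^sup>+u. dpow \<beta> u * etr (u ** s) * rho \<alpha> (mat 1 - u) \<partial>mu)"
    by (rule nn_integral_cmult) measurable
  also have "dpow \<beta> s * dpow (\<alpha> - ?\<delta>) s = dpow (- (?\<delta> - (\<alpha> + \<beta>))) s"
    by (subst dpow_add[OF s, symmetric]) (simp add: algebra_simps)
  finally show ?thesis
    using dpow_minus[OF s, of "?\<delta> - (\<alpha> + \<beta>)"] by (simp add: mult.assoc[symmetric])
qed


text \<open>With \<open>h\<close> the square root of \<open>v\<close>, write \<open>|I + x|\<close> to a negative power as a Gamma integral over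
  \<open>s\<close>, substitute \<open>x = h u h\<close> and \<open>s := h s h\<close>, then \<open>r = c u c\<close> with \<open>c\<close> the square root of \<open>s\<close>,
  and finally shift \<open>s\<close> by \<open>r\<close>. Using symmetric square roots avoids the inversion \<open>x \<mapsto> x\<^sup>-\<^sup>1\<close>,
  which is not linear.\<close>

lemma nn_integral_rho_beta:
  fixes v :: "real^'d^'d"
  assumes v: "v \<in> posdef"
  shows "nGamma TYPE('d) (\<alpha> + \<beta>) * (\<integral>\<^sup>+x. dpow \<beta> x * dpow (- (\<alpha> + \<beta>)) (mat 1 + x) * rho \<alpha> (v - x) \<partial>mu)
    = nGamma TYPE('d) \<alpha> * nGamma TYPE('d) \<beta>
      * (dpow (- (real CARD('d) + 1) / 2) v * dpow (\<alpha> + \<beta>) v * dpow (- \<beta>) (mat 1 + v))"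
proof -
  let ?\<delta> = "(real CARD('d) + 1) / 2" and ?a = "\<alpha> + \<beta>" and ?G = "nGamma TYPE('d)"
  obtain h where h: "transpose h = h" "invertible h" "h ** h = v" using posdef_sqrt[OF v] .
  obtain h' where h': "h ** h' = mat 1" "h' ** h = mat 1" using h(2) by (auto simp: invertible_def)
  \<comment> \<open>\<open>k\<close> is the inverse of v, in the form that makes h k h = I and its
    positive definiteness immediate.\<close>
  define k where "k = h' ** transpose h'"
  have hkh: "h ** k ** h = mat 1"
  proof -
    have "h ** k ** h = (h ** h') ** transpose (h ** h')"
      by (simp add: k_def matrix_transpose_mul h(1) matrix_mul_assoc)
    then show ?thesis by (simp add: h' transpose_mat)
  qed
  have "h ** k ** h \<in> posdef" unfolding hkh by (rule posdef_mat1)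
  then have k: "k \<in> posdef" by (simp only: posdef_congr_sym_iff[OF h(1,2)])
  have k_v: "dpow s k = dpow (- s) v" for s
  proof -
    have "dpow s v * dpow s k = dpow s (mat 1 :: real^'d^'d)"
      using dpow_congr_sym[OF h(3) v k, of s] by (simp add: hkh)
    then have "dpow s v * dpow s k = 1" by (simp add: dpow_def)
    then have "dpow (- s) v = dpow (- s) v * (dpow s v * dpow s k)" by simp
    also have "\<dots> = (dpow s v * dpow (- s) v) * dpow s k" by (simp only: mult_ac)
    finally show ?thesis by (simp add: dpow_minus[OF v])
  qed
  have k_1: "dpow (- \<beta>) (mat 1 + k) = dpow \<beta> v * dpow (- \<beta>) (mat 1 + v)"
  proof -
    have "h ** (mat 1 + k) ** h = h ** h + h ** k ** h"
      by (simp add: matrix_add_ldistrib matrix_mult_add_rdistrib)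
    then have "h ** (mat 1 + k) ** h = mat 1 + v" by (simp only: hkh h(3) add.commute)
    then have "dpow (- \<beta>) (mat 1 + v) = dpow (- \<beta>) v * dpow (- \<beta>) (mat 1 + k)"
      using dpow_congr_sym[OF h(3) v posdef_add[OF posdef_mat1 k], of "- \<beta>"] by simp
    then have "dpow \<beta> v * dpow (- \<beta>) (mat 1 + v) = (dpow \<beta> v * dpow (- \<beta>) v) * dpow (- \<beta>) (mat 1 + k)"
      by (simp add: mult.assoc)
    then show ?thesis by (simp add: dpow_minus[OF v])
  qed
  \<comment> \<open>The Gamma integral with scale I + h u h; replacing s by h s h turns the scale
    into k + u, so v is left only in \<open>k\<close> and in a power in front.\<close>
  have inner: "?G ?a * dpow (- ?a) (mat 1 + h ** u ** h)
      = dpow (- ?a) v * (\<integral>\<^sup>+s. dpow ?a s * (etr (k ** s) * etr (u ** s)) \<partial>mu)" if u: "u \<in> posdef" for u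
  proof -
    have "(\<integral>\<^sup>+s. dpow ?a s * (etr (k ** s) * etr (u ** s)) \<partial>mu)
      = (\<integral>\<^sup>+s. dpow ?a (h ** s ** h) * (etr (k ** (h ** s ** h)) * etr (u ** (h ** s ** h))) \<partial>mu)"
      by (rule nn_integral_mu_congr_sym[OF h(1,2), symmetric]) measurable
    also have "\<dots> = (\<integral>\<^sup>+s. dpow ?a v * (dpow ?a s * etr ((mat 1 + h ** u ** h) ** s)) \<partial>mu)"
    proof (rule nn_integral_mu_cong)
      fix s :: "real^'d^'d" assume s: "s \<in> posdef"
      have e: "etr (A ** (h ** s ** h)) = etr ((h ** A ** h) ** s)" for A
        using etr_mult_commute[of "A ** h ** s" h] by (simp add: matrix_mul_assoc)
      show "dpow ?a (h ** s ** h) * (etr (k ** (h ** s ** h)) * etr (u ** (h ** s ** h)))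
        = dpow ?a v * (dpow ?a s * etr ((mat 1 + h ** u ** h) ** s))"
        unfolding e hkh etr_mult_add dpow_congr_sym[OF h(3) v s] by (simp add: mult.assoc)
    qed
    also have "\<dots> = dpow ?a v * (\<integral>\<^sup>+s. dpow ?a s * etr ((mat 1 + h ** u ** h) ** s) \<partial>mu)"
      by (rule nn_integral_cmult) measurable
    also have "\<dots> = dpow ?a v * (?G ?a * dpow (- ?a) (mat 1 + h ** u ** h))"
      using u by (subst nn_integral_dpow_etr) (auto intro!: posdef_add posdef_mat1 simp: posdef_congr_sym_iff[OF h(1,2)])
    finally have "dpow (- ?a) v * (\<integral>\<^sup>+s. dpow ?a s * (etr (k ** s) * etr (u ** s)) \<partial>mu)
      = (dpow ?a v * dpow (- ?a) v) * (?G ?a * dpow (- ?a) (mat 1 + h ** u ** h))" by (simp only: mult_ac)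
    then show ?thesis by (simp only: dpow_minus[OF v] mult_1)
  qed
  \<comment> \<open>The powers of |v| coming from |x|^\<beta>, from \<open>rho\<close> and from the
    Gamma integral; the exponents add up to -(d+1)/2.\<close>
  define C where "C = dpow \<beta> v * dpow (\<alpha> - ?\<delta>) v * dpow (- ?a) v"
  have C: "C = dpow (- (real CARD('d) + 1) / 2) v"
    unfolding C_def dpow_add[OF v, symmetric] by (rule arg_cong[where f="\<lambda>s. dpow s v"]) linarith
  have "?G ?a * (\<integral>\<^sup>+x. dpow \<beta> x * dpow (- ?a) (mat 1 + x) * rho \<alpha> (v - x) \<partial>mu)
    = ?G ?a * (\<integral>\<^sup>+u. dpow \<beta> (h ** u ** h) * dpow (- ?a) (mat 1 + h ** u ** h) * rho \<alpha> (v - h ** u ** h) \<partial>mu)"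
    by (subst nn_integral_mu_congr_sym[OF h(1,2), symmetric]) simp_all
  also have "\<dots> = (\<integral>\<^sup>+u. ?G ?a * (dpow \<beta> (h ** u ** h) * dpow (- ?a) (mat 1 + h ** u ** h) * rho \<alpha> (v - h ** u ** h)) \<partial>mu)"
    by (rule nn_integral_cmult[symmetric]) measurable
  also have "\<dots> = (\<integral>\<^sup>+u. (\<integral>\<^sup>+s. C * (dpow \<beta> u * rho \<alpha> (mat 1 - u) * (dpow ?a s * (etr (k ** s) * etr (u ** s)))) \<partial>mu) \<partial>mu)"
  proof (rule nn_integral_mu_cong)
    fix u :: "real^'d^'d" assume u: "u \<in> posdef"
    have "?G ?a * (dpow \<beta> (h ** u ** h) * dpow (- ?a) (mat 1 + h ** u ** h) * rho \<alpha> (v - h ** u ** h))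
      = (dpow \<beta> v * dpow (\<alpha> - ?\<delta>) v) * (dpow \<beta> u * rho \<alpha> (mat 1 - u)) * (?G ?a * dpow (- ?a) (mat 1 + h ** u ** h))"
      unfolding dpow_congr_sym[OF h(3) v u] rho_congr_sym[OF h v] by (simp add: mult_ac)
    also have "\<dots> = C * (dpow \<beta> u * rho \<alpha> (mat 1 - u)) * (\<integral>\<^sup>+s. dpow ?a s * (etr (k ** s) * etr (u ** s)) \<partial>mu)"
      unfolding inner[OF u] C_def by (simp add: mult_ac)
    also have "\<dots> = (\<integral>\<^sup>+s. C * (dpow \<beta> u * rho \<alpha> (mat 1 - u) * (dpow ?a s * (etr (k ** s) * etr (u ** s)))) \<partial>mu)"
      by (subst nn_integral_cmult[symmetric]) (auto simp: mult.assoc)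
    finally show "?G ?a * (dpow \<beta> (h ** u ** h) * dpow (- ?a) (mat 1 + h ** u ** h) * rho \<alpha> (v - h ** u ** h))
      = (\<integral>\<^sup>+s. C * (dpow \<beta> u * rho \<alpha> (mat 1 - u) * (dpow ?a s * (etr (k ** s) * etr (u ** s)))) \<partial>mu)" .
  qed
  also have "\<dots> = (\<integral>\<^sup>+s. (\<integral>\<^sup>+u. C * (dpow \<beta> u * rho \<alpha> (mat 1 - u) * (dpow ?a s * (etr (k ** s) * etr (u ** s)))) \<partial>mu) \<partial>mu)"
    by (rule mu_pair.Fubini') measurable
  also have "\<dots> = (\<integral>\<^sup>+s. (\<integral>\<^sup>+r. C * (dpow \<beta> r * etr r * (dpow ?\<delta> s * etr (k ** s) * rho \<alpha> (s - r))) \<partial>mu) \<partial>mu)"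
  proof (rule nn_integral_mu_cong)
    fix s :: "real^'d^'d" assume s: "s \<in> posdef"
    have "(\<integral>\<^sup>+u. C * (dpow \<beta> u * rho \<alpha> (mat 1 - u) * (dpow ?a s * (etr (k ** s) * etr (u ** s)))) \<partial>mu)
      = (C * dpow ?a s * etr (k ** s)) * (\<integral>\<^sup>+u. dpow \<beta> u * etr (u ** s) * rho \<alpha> (mat 1 - u) \<partial>mu)"
      by (subst nn_integral_cmult[symmetric]) (auto simp: mult_ac)
    also have "\<dots> = C * (dpow ?a s * dpow (?\<delta> - ?a) s) * etr (k ** s) * (\<integral>\<^sup>+r. dpow \<beta> r * etr r * rho \<alpha> (s - r) \<partial>mu)"
      unfolding nn_integral_rho_scale[OF s] by (simp add: mult_ac)
    also have "dpow ?a s * dpow (?\<delta> - ?a) s = dpow ?\<delta> s" by (subst dpow_add[OF s, symmetric]) simp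
    also have "C * dpow ?\<delta> s * etr (k ** s) * (\<integral>\<^sup>+r. dpow \<beta> r * etr r * rho \<alpha> (s - r) \<partial>mu)
      = (\<integral>\<^sup>+r. C * (dpow \<beta> r * etr r * (dpow ?\<delta> s * etr (k ** s) * rho \<alpha> (s - r))) \<partial>mu)"
      by (subst nn_integral_cmult[symmetric]) (auto simp: mult_ac)
    finally show "(\<integral>\<^sup>+u. C * (dpow \<beta> u * rho \<alpha> (mat 1 - u) * (dpow ?a s * (etr (k ** s) * etr (u ** s)))) \<partial>mu)
      = (\<integral>\<^sup>+r. C * (dpow \<beta> r * etr r * (dpow ?\<delta> s * etr (k ** s) * rho \<alpha> (s - r))) \<partial>mu)" .
  qed
  also have "\<dots> = (\<integral>\<^sup>+r. (\<integral>\<^sup>+s. C * (dpow \<beta> r * etr r * (dpow ?\<delta> s * etr (k ** s) * rho \<alpha> (s - r))) \<partial>mu) \<partial>mu)"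
    by (rule mu_pair.Fubini') measurable
  also have "\<dots> = (\<integral>\<^sup>+r. (C * ?G \<alpha> * dpow (- \<alpha>) k) * (dpow \<beta> r * etr ((mat 1 + k) ** r)) \<partial>mu)"
  proof (rule nn_integral_mu_cong)
    fix r :: "real^'d^'d" assume r: "r \<in> posdef"
    have "(\<integral>\<^sup>+s. C * (dpow \<beta> r * etr r * (dpow ?\<delta> s * etr (k ** s) * rho \<alpha> (s - r))) \<partial>mu)
      = (C * dpow \<beta> r * etr r) * (\<integral>\<^sup>+s. dpow ?\<delta> s * etr (k ** s) * rho \<alpha> (s - r) \<partial>mu)"
      by (subst nn_integral_cmult[symmetric]) (auto simp: mult_ac)
    also have "\<dots> = (C * ?G \<alpha> * dpow (- \<alpha>) k) * (dpow \<beta> r * etr ((mat 1 + k) ** r))"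
      unfolding nn_integral_rho_etr[OF k r] etr_mult_add by (simp add: mult_ac)
    finally show "(\<integral>\<^sup>+s. C * (dpow \<beta> r * etr r * (dpow ?\<delta> s * etr (k ** s) * rho \<alpha> (s - r))) \<partial>mu)
      = (C * ?G \<alpha> * dpow (- \<alpha>) k) * (dpow \<beta> r * etr ((mat 1 + k) ** r))" .
  qed
  also have "\<dots> = (C * ?G \<alpha> * dpow (- \<alpha>) k) * (?G \<beta> * dpow (- \<beta>) (mat 1 + k))"
    by (subst nn_integral_cmult) (simp_all add: nn_integral_dpow_etr posdef_add posdef_mat1 k)
  also have "\<dots> = ?G \<alpha> * ?G \<beta> * (C * (dpow \<alpha> v * dpow \<beta> v) * dpow (- \<beta>) (mat 1 + v))"
    unfolding k_1 k_v by (simp add: mult_ac)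
  also have "dpow \<alpha> v * dpow \<beta> v = dpow ?a v" by (simp add: dpow_add v)
  finally show ?thesis unfolding C .
qed

text \<open>With g = w x one has T(I + z) = x + y for y the congruence of z by g, and |I + z| = |x +
  y|/|x|. By invariance of \<open>mu\<close> the variable z may be replaced by y, so g drops out;
  the exponents of |x| add up to \<alpha> - \<alpha> + \<beta> = \<beta>. Shifting to v = x + y and
  exchanging the integrals leaves the Euler type integral over x.\<close>

lemma nn_integral_beta_fixed_point:
  fixes w :: "real^'d^'d \<Rightarrow> real^'d^'d"
  assumes [measurable]: "F \<in> borel_measurable borel" "w \<in> borel_measurable borel"
    and w: "\<And>x. x \<in> posdef \<Longrightarrow> transpose (w x) ** w x = x"
  shows "nGamma TYPE('d) (\<alpha> + \<beta>) * (\<integral>\<^sup>+x. (\<integral>\<^sup>+z. F (T w x (mat 1 + z))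
      * (dpow \<alpha> x * dpow (- (\<alpha> + \<beta>)) (mat 1 + x)) * (dpow \<alpha> z * dpow (- \<beta>) (mat 1 + z)) \<partial>mu) \<partial>mu)
    = nGamma TYPE('d) \<alpha> * nGamma TYPE('d) \<beta> * (\<integral>\<^sup>+z. F z * (dpow \<alpha> z * dpow (- \<beta>) (mat 1 + z)) \<partial>mu)"
proof -
  let ?\<delta> = "(real CARD('d) + 1) / 2" and ?a = "\<alpha> + \<beta>" and ?G = "nGamma TYPE('d)"
  have inner: "(\<integral>\<^sup>+z. F (T w x (mat 1 + z)) * (dpow \<alpha> x * dpow (- ?a) (mat 1 + x)) * (dpow \<alpha> z * dpow (- \<beta>) (mat 1 + z)) \<partial>mu)
    = (\<integral>\<^sup>+v. F v * dpow (- \<beta>) v * (dpow \<beta> x * dpow (- ?a) (mat 1 + x) * rho \<alpha> (v - x)) \<partial>sym_lebesgue)"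
    if x: "x \<in> posdef" for x
  proof -
    define g where "g = w x"
    have gg: "transpose g ** g = x" using w[OF x] by (simp add: g_def)
    have detx: "det x = (det g)\<^sup>2" unfolding gg[symmetric] by (simp add: det_mul det_transpose power2_eq_square)
    then have g: "invertible g" using posdef_det_pos[OF x] by (auto simp: invertible_det_nz)
    have d: "dpow s (transpose g ** z ** g) = dpow s x * dpow s z" if "z \<in> posdef" for s z
      by (rule dpow_mult) (use x that posdef_det_pos g in \<open>auto simp: det_congr detx invertible_det_nz\<close>)
    have Tx: "T w x (mat 1 + z) = x + transpose g ** z ** g" for z
      by (simp add: T_def g_def[symmetric] matrix_add_ldistrib matrix_mult_add_rdistrib gg)
    have "(\<integral>\<^sup>+z. F (T w x (mat 1 + z)) * (dpow \<alpha> x * dpow (- ?a) (mat 1 + x)) * (dpow \<alpha> z * dpow (- \<beta>) (mat 1 + z)) \<partial>mu)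
      = (\<integral>\<^sup>+z. (dpow \<beta> x * dpow (- ?a) (mat 1 + x)) * (F (x + transpose g ** z ** g) * dpow (- \<beta>) (x + transpose g ** z ** g)
          * dpow \<alpha> (transpose g ** z ** g)) \<partial>mu)"
    proof (rule nn_integral_mu_cong)
      fix z :: "real^'d^'d" assume z: "z \<in> posdef"
      have "dpow (- \<beta>) (x + transpose g ** z ** g) = dpow (- \<beta>) x * dpow (- \<beta>) (mat 1 + z)"
        using d[OF posdef_add[OF posdef_mat1 z], of "- \<beta>"]
        by (simp add: matrix_add_ldistrib matrix_mult_add_rdistrib gg)
      then have "(dpow \<beta> x * dpow (- ?a) (mat 1 + x)) * (F (x + transpose g ** z ** g) * dpow (- \<beta>) (x + transpose g ** z ** g)
          * dpow \<alpha> (transpose g ** z ** g))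
        = (dpow \<beta> x * dpow (- \<beta>) x) * (F (x + transpose g ** z ** g) * (dpow \<alpha> x * dpow (- ?a) (mat 1 + x)) * (dpow \<alpha> z * dpow (- \<beta>) (mat 1 + z)))"
        by (simp add: d[OF z] mult_ac)
      then show "F (T w x (mat 1 + z)) * (dpow \<alpha> x * dpow (- ?a) (mat 1 + x)) * (dpow \<alpha> z * dpow (- \<beta>) (mat 1 + z))
        = (dpow \<beta> x * dpow (- ?a) (mat 1 + x)) * (F (x + transpose g ** z ** g) * dpow (- \<beta>) (x + transpose g ** z ** g)
          * dpow \<alpha> (transpose g ** z ** g))"
        by (simp add: dpow_minus[OF x] Tx)
    qed
    also have "\<dots> = (\<integral>\<^sup>+y. (dpow \<beta> x * dpow (- ?a) (mat 1 + x)) * (F (x + y) * dpow (- \<beta>) (x + y) * dpow \<alpha> y) \<partial>mu)"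
      by (rule nn_integral_mu_congr[OF g, where F="\<lambda>y. (dpow \<beta> x * dpow (- ?a) (mat 1 + x)) * (F (x + y) * dpow (- \<beta>) (x + y) * dpow \<alpha> y)"]) measurable
    also have "\<dots> = (dpow \<beta> x * dpow (- ?a) (mat 1 + x)) * (\<integral>\<^sup>+y. F (x + y) * dpow (- \<beta>) (x + y) * dpow \<alpha> y \<partial>mu)"
      by (rule nn_integral_cmult) measurable
    also have "(\<integral>\<^sup>+y. F (x + y) * dpow (- \<beta>) (x + y) * dpow \<alpha> y \<partial>mu) = (\<integral>\<^sup>+v. F v * dpow (- \<beta>) v * rho \<alpha> (v - x) \<partial>sym_lebesgue)"
      by (rule nn_integral_rho_shift[OF x]) measurable
    also have "(dpow \<beta> x * dpow (- ?a) (mat 1 + x)) * (\<integral>\<^sup>+v. F v * dpow (- \<beta>) v * rho \<alpha> (v - x) \<partial>sym_lebesgue)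
      = (\<integral>\<^sup>+v. F v * dpow (- \<beta>) v * (dpow \<beta> x * dpow (- ?a) (mat 1 + x) * rho \<alpha> (v - x)) \<partial>sym_lebesgue)"
      by (subst nn_integral_cmult[symmetric]) (auto simp: mult_ac)
    finally show ?thesis .
  qed
  have "?G ?a * (\<integral>\<^sup>+x. (\<integral>\<^sup>+z. F (T w x (mat 1 + z))
      * (dpow \<alpha> x * dpow (- ?a) (mat 1 + x)) * (dpow \<alpha> z * dpow (- \<beta>) (mat 1 + z)) \<partial>mu) \<partial>mu)
    = ?G ?a * (\<integral>\<^sup>+x. (\<integral>\<^sup>+v. F v * dpow (- \<beta>) v * (dpow \<beta> x * dpow (- ?a) (mat 1 + x) * rho \<alpha> (v - x)) \<partial>sym_lebesgue) \<partial>mu)"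
    by (rule arg_cong[where f="(*) _"], rule nn_integral_mu_cong, rule inner)
  also have "\<dots> = ?G ?a * (\<integral>\<^sup>+v. (\<integral>\<^sup>+x. F v * dpow (- \<beta>) v * (dpow \<beta> x * dpow (- ?a) (mat 1 + x) * rho \<alpha> (v - x)) \<partial>mu) \<partial>sym_lebesgue)"
    by (rule arg_cong[where f="(*) _"], rule mu_sym.Fubini'[symmetric]) measurable
  also have "\<dots> = (\<integral>\<^sup>+v. F v * dpow (- \<beta>) v * (?G ?a * (\<integral>\<^sup>+x. dpow \<beta> x * dpow (- ?a) (mat 1 + x) * rho \<alpha> (v - x) \<partial>mu)) \<partial>sym_lebesgue)"
    by (subst nn_integral_cmult[symmetric], measurable, rule nn_integral_cong, subst nn_integral_cmult) (auto simp: mult_ac)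
  also have "\<dots> = (\<integral>\<^sup>+v. (?G \<alpha> * ?G \<beta>) * (indicator posdef v * dpow (- (real CARD('d) + 1) / 2) v * (F v * (dpow \<alpha> v * dpow (- \<beta>) (mat 1 + v)))) \<partial>sym_lebesgue)"
  proof (rule nn_integral_cong)
    fix v :: "real^'d^'d"
    show "F v * dpow (- \<beta>) v * (?G ?a * (\<integral>\<^sup>+x. dpow \<beta> x * dpow (- ?a) (mat 1 + x) * rho \<alpha> (v - x) \<partial>mu))
      = (?G \<alpha> * ?G \<beta>) * (indicator posdef v * dpow (- (real CARD('d) + 1) / 2) v * (F v * (dpow \<alpha> v * dpow (- \<beta>) (mat 1 + v))))"
    proof (cases "v \<in> posdef")
      case True
      have "F v * dpow (- \<beta>) v * (?G ?a * (\<integral>\<^sup>+x. dpow \<beta> x * dpow (- ?a) (mat 1 + x) * rho \<alpha> (v - x) \<partial>mu))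
        = (?G \<alpha> * ?G \<beta>) * (dpow (- (real CARD('d) + 1) / 2) v * (F v * (dpow \<alpha> v * (dpow \<beta> v * dpow (- \<beta>) v) * dpow (- \<beta>) (mat 1 + v))))"
        unfolding nn_integral_rho_beta[OF True] dpow_add[OF True, of \<alpha> \<beta>] by (simp only: mult_ac)
      then show ?thesis using True by (simp add: dpow_minus mult.assoc)
    next
      case False
      then have "(\<integral>\<^sup>+x. dpow \<beta> x * dpow (- ?a) (mat 1 + x) * rho \<alpha> (v - x) \<partial>mu) = (\<integral>\<^sup>+x. 0 \<partial>(mu :: (real^'d^'d) measure))"
        by (intro nn_integral_mu_cong) (simp add: rho_minus_nonzero)
      then show ?thesis using False by simp
    qed
  qed
  also have "\<dots> = (?G \<alpha> * ?G \<beta>) * (\<integral>\<^sup>+v. indicator posdef v * dpow (- (real CARD('d) + 1) / 2) v * (F v * (dpow \<alpha> v * dpow (- \<beta>) (mat 1 + v))) \<partial>sym_lebesgue)"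
    by (rule nn_integral_cmult) measurable
  also have "\<dots> = (?G \<alpha> * ?G \<beta>) * (\<integral>\<^sup>+z. F z * (dpow \<alpha> z * dpow (- \<beta>) (mat 1 + z)) \<partial>mu)"
    by (subst nn_integral_mu[of "\<lambda>z. F z * (dpow \<alpha> z * dpow (- \<beta>) (mat 1 + z))"]) simp_all
  finally show ?thesis .
qed

section \<open>Normalised Beta laws\<close>

context
  fixes a b :: real
  assumes a: "a > (real CARD('d::finite) - 1) / 2" and b: "b > (real CARD('d) - 1) / 2"
begin

lemma beta_parameter_sum: "a + b > (real CARD('d) - 1) / 2"
proof -
  have "real CARD('d) \<ge> 1" by (simp add: Suc_le_eq)
  then show ?thesis using a b by argo
qed

text \<open>The place where the real normalising constant meets the extended integrals: it needs
  Gamma finite and positive at a, b and a + b.\<close>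

lemma mBeta_pos: "mBeta TYPE('d) a b > 0"
  and mBeta_nGamma: "ennreal (1 / mBeta TYPE('d) a b) * (nGamma TYPE('d) a * nGamma TYPE('d) b) = nGamma TYPE('d) (a + b)"
proof -
  from a b beta_parameter_sum have G: "nGamma TYPE('d) s = ennreal (mGamma TYPE('d) s)" "mGamma TYPE('d) s > 0" if "s \<in> {a, b, a + b}" for s
    using that nGamma_finite[of s, where 'd='d] nGamma_nonzero[where 'd='d, of s]
    by (auto simp: mGamma_eq enn2real_positive_iff zero_less_iff_neq_zero less_top)
  show "mBeta TYPE('d) a b > 0" using G by (simp add: mBeta_def)
  show "ennreal (1 / mBeta TYPE('d) a b) * (nGamma TYPE('d) a * nGamma TYPE('d) b) = nGamma TYPE('d) (a + b)"
    using G(2)[of a] G(2)[of b] G(2)[of "a + b"] by (simp add: G(1) mBeta_def ennreal_mult[symmetric])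
qed

lemma nn_integral_BetaII:
  fixes F :: "real^'d^'d \<Rightarrow> ennreal"
  assumes [measurable]: "F \<in> borel_measurable borel"
  shows "(\<integral>\<^sup>+x. F x \<partial>BetaII a b)
    = ennreal (1 / mBeta TYPE('d) a b) * (\<integral>\<^sup>+x. F x * (dpow a x * dpow (- (a + b)) (mat 1 + x)) \<partial>mu)"
proof -
  have e: "ennreal (det x powr a * det (mat 1 + x) powr (- (a + b)) / mBeta TYPE('d) a b)
    = ennreal (1 / mBeta TYPE('d) a b) * (dpow a x * dpow (- (a + b)) (mat 1 + x))" for x :: "real^'d^'d"
    using mBeta_pos by (simp add: dpow_def ennreal_mult[symmetric])
  show ?thesis
    unfolding BetaII_def e
    by (subst nn_integral_density) (simp_all add: nn_integral_cmult[symmetric] mult_ac)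
qed

lemma prob_space_BetaII: "prob_space (BetaII a b :: (real^'d^'d) measure)"
proof
  let ?G = "nGamma TYPE('d)"
  let ?I = "\<integral>\<^sup>+x. dpow a x * dpow (- (a + b)) (mat 1 + x) \<partial>(mu :: (real^'d^'d) measure)"
  have "emeasure (BetaII a b :: (real^'d^'d) measure) (space (BetaII a b)) = (\<integral>\<^sup>+x. 1 \<partial>(BetaII a b :: (real^'d^'d) measure))"
    by simp
  also have "\<dots> = ennreal (1 / mBeta TYPE('d) a b) * ?I"
    by (subst nn_integral_BetaII) simp_all
  finally have "?G (a + b) * emeasure (BetaII a b :: (real^'d^'d) measure) (space (BetaII a b))
    = ennreal (1 / mBeta TYPE('d) a b) * (?G (a + b) * ?I)" by (simp add: mult_ac)
  also have "\<dots> = ?G (a + b) * 1" unfolding nn_integral_beta mBeta_nGamma by simp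
  finally show "emeasure (BetaII a b :: (real^'d^'d) measure) (space (BetaII a b)) = 1"
    using nGamma_nonzero nGamma_finite[OF beta_parameter_sum]
    by (subst (asm) ennreal_mult_cancel_left) auto
qed

end

lemma sets_BetaII [measurable_cong, simp]: "sets (BetaII a b) = sets borel"
  and space_BetaII [simp]: "space (BetaII a b) = UNIV"
  by (auto simp: BetaII_def)

lemma AE_BetaII: "AE x in BetaII a b. x \<in> posdef"
  unfolding BetaII_def by (subst AE_density) (use AE_mu in auto)

text \<open>The normaliser of the law of z appears on both sides. That of the law of x is absorbed
  by the factor which the Euler type integral produces, the Beta function at (\<alpha>, \<beta>).
  The exponent of |I + z| is -\<beta> since \<alpha> + (\<beta> - \<alpha>) = \<beta>.\<close>

lemma BetaII_fixed_point:
  fixes w :: "real^'d^'d \<Rightarrow> real^'d^'d"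
  assumes \<alpha>: "\<alpha> > (real CARD('d) - 1) / 2" and \<beta>: "\<beta> - \<alpha> > (real CARD('d) - 1) / 2"
    and [measurable]: "F \<in> borel_measurable borel" "w \<in> borel_measurable borel"
    and w: "\<And>x. x \<in> posdef \<Longrightarrow> transpose (w x) ** w x = x"
  shows "(\<integral>\<^sup>+x. (\<integral>\<^sup>+z. F (T w x (mat 1 + z)) \<partial>BetaII \<alpha> (\<beta> - \<alpha>)) \<partial>BetaII \<alpha> \<beta>) = (\<integral>\<^sup>+z. F z \<partial>BetaII \<alpha> (\<beta> - \<alpha>))"
proof -
  let ?G = "nGamma TYPE('d)" and ?a = "\<alpha> + \<beta>"
  have \<beta>': "\<beta> > (real CARD('d) - 1) / 2" using beta_parameter_sum[OF \<alpha> \<beta>] by simp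
  interpret prob_space "BetaII \<alpha> (\<beta> - \<alpha>) :: (real^'d^'d) measure" by (rule prob_space_BetaII[OF \<alpha> \<beta>])
  have [measurable]: "(\<lambda>p. F (T w (fst p) (mat 1 + snd p))) \<in> borel_measurable (borel \<Otimes>\<^sub>M borel)"
    unfolding T_def by measurable
  have "(\<lambda>p. F (T w (fst p) (mat 1 + snd p))) \<in> borel_measurable (borel \<Otimes>\<^sub>M BetaII \<alpha> (\<beta> - \<alpha>))"
    by measurable
  from borel_measurable_nn_integral_fst[OF this]
  have meas: "(\<lambda>x. \<integral>\<^sup>+z. F (T w x (mat 1 + z)) \<partial>BetaII \<alpha> (\<beta> - \<alpha>)) \<in> borel_measurable borel" by simp
  define c c' where "c = ennreal (1 / mBeta TYPE('d) \<alpha> \<beta>)" and "c' = ennreal (1 / mBeta TYPE('d) \<alpha> (\<beta> - \<alpha>))"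
  let ?p = "\<lambda>x :: real^'d^'d. dpow \<alpha> x * dpow (- ?a) (mat 1 + x)"
  let ?q = "\<lambda>z :: real^'d^'d. dpow \<alpha> z * dpow (- \<beta>) (mat 1 + z)"
  have "(\<integral>\<^sup>+x. (\<integral>\<^sup>+z. F (T w x (mat 1 + z)) \<partial>BetaII \<alpha> (\<beta> - \<alpha>)) \<partial>BetaII \<alpha> \<beta>)
    = c * (\<integral>\<^sup>+x. (\<integral>\<^sup>+z. F (T w x (mat 1 + z)) \<partial>BetaII \<alpha> (\<beta> - \<alpha>)) * ?p x \<partial>mu)"
    unfolding c_def by (rule nn_integral_BetaII[OF \<alpha> \<beta>']) (rule meas)
  also have "\<dots> = c * (\<integral>\<^sup>+x. (\<integral>\<^sup>+z. c' * (F (T w x (mat 1 + z)) * ?p x * ?q z) \<partial>mu) \<partial>mu)"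
  proof (rule arg_cong[where f="(*) c"], rule nn_integral_cong)
    fix x :: "real^'d^'d"
    have [measurable]: "T w x \<in> borel_measurable borel" unfolding T_def by measurable
    have "(\<integral>\<^sup>+z. F (T w x (mat 1 + z)) \<partial>BetaII \<alpha> (\<beta> - \<alpha>)) = c' * (\<integral>\<^sup>+z. F (T w x (mat 1 + z)) * ?q z \<partial>mu)"
      using nn_integral_BetaII[OF \<alpha> \<beta>, of "\<lambda>z. F (T w x (mat 1 + z))"] by (simp add: c'_def)
    then show "(\<integral>\<^sup>+z. F (T w x (mat 1 + z)) \<partial>BetaII \<alpha> (\<beta> - \<alpha>)) * ?p x
      = (\<integral>\<^sup>+z. c' * (F (T w x (mat 1 + z)) * ?p x * ?q z) \<partial>mu)"
      by (simp add: nn_integral_cmult[symmetric] nn_integral_multc[symmetric] mult_ac)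
  qed
  also have "\<dots> = c' * (c * (\<integral>\<^sup>+x. (\<integral>\<^sup>+z. F (T w x (mat 1 + z)) * ?p x * ?q z \<partial>mu) \<partial>mu))"
  proof -
    have m: "(\<lambda>p. F (T w (fst p) (mat 1 + snd p)) * ?p (fst p) * ?q (snd p)) \<in> borel_measurable (borel \<Otimes>\<^sub>M (mu :: (real^'d^'d) measure))"
      by measurable
    have "(\<integral>\<^sup>+x. (\<integral>\<^sup>+z. c' * (F (T w x (mat 1 + z)) * ?p x * ?q z) \<partial>mu) \<partial>mu)
      = (\<integral>\<^sup>+x. c' * (\<integral>\<^sup>+z. F (T w x (mat 1 + z)) * ?p x * ?q z \<partial>mu) \<partial>mu)"
      by (intro nn_integral_cong nn_integral_cmult) (simp add: T_def)
    also have "\<dots> = c' * (\<integral>\<^sup>+x. (\<integral>\<^sup>+z. F (T w x (mat 1 + z)) * ?p x * ?q z \<partial>mu) \<partial>mu)"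
      using mu.borel_measurable_nn_integral_fst[OF m] by (intro nn_integral_cmult) simp
    finally show ?thesis by (simp add: mult_ac)
  qed
  also have "c * (\<integral>\<^sup>+x. (\<integral>\<^sup>+z. F (T w x (mat 1 + z)) * ?p x * ?q z \<partial>mu) \<partial>mu) = (\<integral>\<^sup>+z. F z * ?q z \<partial>mu)"
    (is "c * ?I = ?K")
  proof -
    have "?G ?a * (c * ?I) = c * (?G \<alpha> * ?G \<beta> * ?K)"
      using nn_integral_beta_fixed_point[OF assms(3,4) w, of \<alpha> \<beta>] by (simp add: mult_ac)
    also have "\<dots> = c * (?G \<alpha> * ?G \<beta>) * ?K" by (simp only: mult.assoc)
    also have "\<dots> = ?G ?a * ?K" unfolding c_def mBeta_nGamma[OF \<alpha> \<beta>'] ..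
    finally show ?thesis
      using nGamma_nonzero nGamma_finite[OF beta_parameter_sum[OF \<alpha> \<beta>']] by (subst (asm) ennreal_mult_cancel_left) auto
  qed
  also have "c' * ?K = (\<integral>\<^sup>+z. F z \<partial>BetaII \<alpha> (\<beta> - \<alpha>))"
    using nn_integral_BetaII[OF \<alpha> \<beta>, of F] by (simp add: c'_def)
  finally show ?thesis .
qed

text \<open>Almost sure convergence only passes through continuous functions, so the law of the
  limit is identified by these. The indicator of a closed set is the limit of the functions that
  fall linearly to 0 within distance 1/n, and closed sets generate the Borel sets.\<close>

lemma measure_eqI_continuous:
  fixes M N :: "'a::metric_space measure"
  assumes M: "prob_space M" "sets M = sets borel" and N: "prob_space N" "sets N = sets borel"
    and eq: "\<And>f :: 'a \<Rightarrow> real. continuous_on UNIV f \<Longrightarrow> (\<And>x. 0 \<le> f x \<and> f x \<le> 1) \<Longrightarrow>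
      (\<integral>\<^sup>+x. ennreal (f x) \<partial>M) = (\<integral>\<^sup>+x. ennreal (f x) \<partial>N)"
  shows "M = N"
proof (rule measure_eqI_generator_eq[where E="Collect closed" and \<Omega>=UNIV and A="\<lambda>_. UNIV"])
  fix C :: "'a set" assume "C \<in> Collect closed"
  then have C: "closed C" by simp
  show "emeasure M C = emeasure N C"
  proof (cases "C = {}")
    case False
    define f where "f n x = max 0 (1 - real n * infdist x C)" for n x
    have f: "0 \<le> f n x" "f n x \<le> 1" for n x by (auto simp: f_def infdist_nonneg)
    have cont: "continuous_on UNIV (f n)" for n unfolding f_def by (intro continuous_intros)
    have lim: "(\<lambda>n. ennreal (f n x)) \<longlonglongrightarrow> indicator C x" for x
    proof (cases "x \<in> C")
      case True
      then show ?thesis by (simp add: f_def)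
    next
      case False
      then have "infdist x C > 0"
        using C \<open>C \<noteq> {}\<close> by (metis in_closed_iff_infdist_zero infdist_nonneg order_le_less)
      then obtain n0 where n0: "1 < real n0 * infdist x C" using reals_Archimedean3 by blast
      have "f n x = 0" if "n \<ge> n0" for n
      proof -
        have "real n0 * infdist x C \<le> real n * infdist x C" using that by (intro mult_right_mono) (auto simp: infdist_nonneg)
        then show ?thesis using n0 by (simp add: f_def)
      qed
      then have "eventually (\<lambda>n. ennreal (f n x) = indicator C x) sequentially"
        using False by (intro eventually_sequentiallyI[of n0]) simp
      then show ?thesis by (rule tendsto_eventually)
    qed
    have conv: "(\<lambda>n. \<integral>\<^sup>+x. ennreal (f n x) \<partial>L) \<longlonglongrightarrow> emeasure L C" if L: "prob_space L" "sets L = sets borel" for L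
    proof -
      interpret prob_space L by fact
      have "C \<in> sets L" using L(2) C by simp
      have m: "f n \<in> borel_measurable L" for n
        using borel_measurable_continuous_onI[OF cont] L(2) by (simp cong: measurable_cong_sets)
      have "(\<lambda>n. \<integral>\<^sup>+x. ennreal (f n x) \<partial>L) \<longlonglongrightarrow> (\<integral>\<^sup>+x. indicator C x \<partial>L)"
        by (rule nn_integral_dominated_convergence[where w="\<lambda>_. 1"])
          (use m f lim \<open>C \<in> sets L\<close> in \<open>auto simp: emeasure_space_1\<close>)
      then show ?thesis using L(2) C by simp
    qed
    have "(\<lambda>n. \<integral>\<^sup>+x. ennreal (f n x) \<partial>M) = (\<lambda>n. \<integral>\<^sup>+x. ennreal (f n x) \<partial>N)"
      using eq[OF cont] f by (intro ext) auto
    then show ?thesis using LIMSEQ_unique[OF conv[OF M]] conv[OF N] by metis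
  qed simp
next
  show "sets M = sigma_sets UNIV (Collect closed)" "sets N = sigma_sets UNIV (Collect closed)"
    using M N by (simp_all add: borel_eq_closed)
  show "emeasure M UNIV \<noteq> \<infinity>" for i :: nat
    using prob_space.axioms(1)[OF M(1)] by (simp add: finite_measure.emeasure_finite)
qed (auto simp: Int_stable_def)

section \<open>Perpetuities\<close>

text \<open>This cone is stable under every congruence, invertible or not, so what is said about the
  terms of the series holds at every sample point.\<close>

definition possemidef :: "(real^'d^'d) set" where
  "possemidef = {x. transpose x = x \<and> (\<forall>v. v \<bullet> (x *v v) \<ge> 0)}"

lemma posdef_possemidef: "x \<in> posdef \<Longrightarrow> x \<in> possemidef"
  by (auto simp: possemidef_def posdef_sym posdef_nonneg)

lemma possemidef_congr: "x \<in> possemidef \<Longrightarrow> transpose g ** x ** (g :: real^'d^'d) \<in> possemidef"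
  by (auto simp: possemidef_def transpose_congr inner_congr)

lemma possemidef_entry_le_trace: "x \<in> possemidef \<Longrightarrow> \<bar>x $ i $ j\<bar> \<le> trace x"
  by (rule posdef_entry_le_trace) (auto simp: possemidef_def)

lemma possemidef_trace_nonneg: "x \<in> possemidef \<Longrightarrow> trace x \<ge> 0"
  using possemidef_entry_le_trace[of x undefined undefined] by linarith

text \<open>Reduces convergence of a series of matrices to that of its traces, a nonnegative real
  series.\<close>

lemma possemidef_norm_le:
  fixes x :: "real^'d^'d"
  assumes "x \<in> possemidef"
  shows "norm x \<le> real CARD('d) * (real CARD('d) * trace x)"
proof -
  have "norm (x $ i) \<le> real CARD('d) * trace x" for i
  proof -
    have "norm (x $ i) \<le> (\<Sum>j\<in>UNIV. \<bar>x $ i $ j\<bar>)" by (rule norm_le_l1_cart)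
    also have "\<dots> \<le> (\<Sum>j\<in>(UNIV :: 'd set). trace x)" by (intro sum_mono possemidef_entry_le_trace assms)
    finally show ?thesis by simp
  qed
  then have "(\<Sum>i\<in>UNIV. norm (x $ i)) \<le> (\<Sum>i\<in>(UNIV :: 'd set). real CARD('d) * trace x)" by (intro sum_mono)
  moreover have "norm x \<le> (\<Sum>i\<in>UNIV. norm (x $ i))" unfolding norm_vec_def by (rule L2_set_le_sum) simp
  ultimately show ?thesis by simp
qed

section \<open>Compositions of congruences\<close>

lemma T_add: "T w y (a + b) = T w y a + T w y b"
  by (simp add: T_def matrix_add_ldistrib matrix_mult_add_rdistrib)

lemma T_sum: "T w y (\<Sum>j\<in>I. f j) = (\<Sum>j\<in>I. T w y (f j))"
proof -
  have "T w y 0 = 0" using T_add[of w y 0 0] by simp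
  then show ?thesis by (induction I rule: infinite_finite_induct) (simp_all add: T_add)
qed

lemma T_measurable [measurable (raw)]:
  assumes [measurable]: "w \<in> borel_measurable borel" "f \<in> borel_measurable N" "g \<in> borel_measurable N"
  shows "(\<lambda>x. T w (f x) (g x)) \<in> borel_measurable N"
  unfolding T_def by measurable

text \<open>Indices are given as a list, so that an induction can peel off the outermost map and
  integrate over its variable alone.\<close>

definition T_comp :: "(real^'d^'d \<Rightarrow> real^'d^'d) \<Rightarrow> (nat \<Rightarrow> real^'d^'d) \<Rightarrow> nat list \<Rightarrow> real^'d^'d \<Rightarrow> real^'d^'d"
  where "T_comp w x ks = foldr (\<lambda>k. T w (x k)) ks"

text \<open>Along [1..<Suc n] and with starting value z this is the iterate R_n of the
  equation.\<close>

definition affine_comp :: "(real^'d^'d \<Rightarrow> real^'d^'d) \<Rightarrow> (nat \<Rightarrow> real^'d^'d) \<Rightarrow> nat list \<Rightarrow> real^'d^'d \<Rightarrow> real^'d^'d"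
  where "affine_comp w x ks = foldr (\<lambda>k u. T w (x k) (mat 1 + u)) ks"

lemma T_iter_eq: "T_iter w x n = T_comp w x [1..<Suc n] (mat 1)"
  by (simp add: T_iter_def T_comp_def)

lemma T_comp_congr:
  obtains g where "\<And>z. T_comp w x ks z = transpose g ** z ** g"
proof -
  have "\<exists>g. \<forall>z. T_comp w x ks z = transpose g ** z ** g"
  proof (induction ks)
    case Nil
    show ?case by (rule exI[of _ "mat 1"]) (simp add: T_comp_def transpose_mat)
  next
    case (Cons k ks)
    then obtain g where "\<And>z. T_comp w x ks z = transpose g ** z ** g" by blast
    then show ?case
      by (intro exI[of _ "g ** w (x k)"]) (simp add: T_comp_def T_def matrix_transpose_mul matrix_mul_assoc)
  qed
  then show ?thesis using that by blast
qed

lemma T_comp_possemidef: "z \<in> possemidef \<Longrightarrow> T_comp w x ks z \<in> possemidef"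
  by (rule T_comp_congr[of w x ks]) (simp add: possemidef_congr)

text \<open>By additivity of \<open>T w y\<close>, the identity inserted at each level contributes
  one term for each non-empty prefix of the list.\<close>

lemma affine_comp_eq:
  "affine_comp w x ks z = (\<Sum>j<length ks. T_comp w x (take (Suc j) ks) (mat 1)) + T_comp w x ks z"
proof (induction ks)
  case Nil
  show ?case by (simp add: affine_comp_def T_comp_def)
next
  case (Cons k ks)
  have "affine_comp w x (k # ks) z = T w (x k) (mat 1 + affine_comp w x ks z)"
    by (simp add: affine_comp_def)
  also have "\<dots> = T w (x k) (mat 1) + (\<Sum>j<length ks. T_comp w x (k # take (Suc j) ks) (mat 1)) + T_comp w x (k # ks) z"
    unfolding Cons.IH T_add T_sum by (simp add: T_comp_def add.assoc)
  also have "T w (x k) (mat 1) + (\<Sum>j<length ks. T_comp w x (k # take (Suc j) ks) (mat 1))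
    = (\<Sum>j<length (k # ks). T_comp w x (take (Suc j) (k # ks)) (mat 1))"
    by (simp only: length_Cons sum.lessThan_Suc_shift) (simp add: T_comp_def)
  finally show ?case .
qed

lemma affine_comp_T_iter:
  "affine_comp w x [1..<Suc n] z = (\<Sum>j<n. T_iter w x (Suc j)) + T_comp w x [1..<Suc n] z"
proof -
  have "take (Suc j) [1..<Suc n] = [1..<Suc (Suc j)]" if "j < n" for j
    using that by (subst take_upt) auto
  then show ?thesis unfolding affine_comp_eq T_iter_eq by (intro arg_cong2[where f="(+)"] sum.cong) auto
qed

lemma T_comp_measurable [measurable (raw)]:
  assumes [measurable]: "w \<in> borel_measurable borel" "z \<in> borel_measurable N"
    and x: "\<And>k. k \<in> set ks \<Longrightarrow> (\<lambda>\<omega>. x \<omega> k) \<in> borel_measurable N"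
  shows "(\<lambda>\<omega>. T_comp w (x \<omega>) ks (z \<omega>)) \<in> borel_measurable N"
  using x by (induction ks) (simp_all add: T_comp_def)

lemma affine_comp_measurable [measurable (raw)]:
  assumes [measurable]: "w \<in> borel_measurable borel" "z \<in> borel_measurable N"
    and x: "\<And>k. k \<in> set ks \<Longrightarrow> (\<lambda>\<omega>. x \<omega> k) \<in> borel_measurable N"
  shows "(\<lambda>\<omega>. affine_comp w (x \<omega>) ks (z \<omega>)) \<in> borel_measurable N"
  using x by (induction ks) (simp_all add: affine_comp_def)

lemma affine_comp_cong:
  "(\<And>k. k \<in> set ks \<Longrightarrow> x k = y k) \<Longrightarrow> affine_comp w x ks z = affine_comp w y ks z"
  unfolding affine_comp_def by (rule foldr_cong) auto

text \<open>Each composition is the congruence by some matrix g n. Its value at I has the squared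
  column norms of g n on the diagonal, so convergence at I forces g n to 0, and then the value at
  any z tends to 0.\<close>

lemma T_comp_tendsto_0:
  fixes w :: "real^'d^'d \<Rightarrow> real^'d^'d"
  assumes "(\<lambda>n. T_comp w x (ks n) (mat 1)) \<longlonglongrightarrow> 0"
  shows "(\<lambda>n. T_comp w x (ks n) z) \<longlonglongrightarrow> 0"
proof -
  have "\<forall>n. \<exists>g. \<forall>z. T_comp w x (ks n) z = transpose g ** z ** g" using T_comp_congr by blast
  then obtain g where g: "\<And>n z. T_comp w x (ks n) z = transpose (g n) ** z ** g n" by metis
  have "(\<lambda>n. g n $ i $ j) \<longlonglongrightarrow> 0" for i j
  proof (rule Lim_null_comparison)
    have "(g n $ i $ j)\<^sup>2 \<le> T_comp w x (ks n) (mat 1) $ j $ j" for n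
    proof -
      have "(g n $ i $ j)\<^sup>2 \<le> (\<Sum>i\<in>UNIV. (g n $ i $ j)\<^sup>2)" by (rule member_le_sum) auto
      also have "\<dots> = T_comp w x (ks n) (mat 1) $ j $ j"
      proof -
        have "T_comp w x (ks n) (mat 1) = transpose (g n) ** g n" by (simp add: g)
        then show ?thesis by (simp add: matrix_matrix_mult_def transpose_def power2_eq_square)
      qed
      finally show ?thesis .
    qed
    then show "\<forall>\<^sub>F n in sequentially. norm (g n $ i $ j) \<le> sqrt (T_comp w x (ks n) (mat 1) $ j $ j)"
      by (intro always_eventually allI real_le_rsqrt) simp
    have "(\<lambda>n. T_comp w x (ks n) (mat 1) $ j $ j) \<longlonglongrightarrow> 0"
      using tendsto_vec_nth[OF tendsto_vec_nth[OF assms, of j], of j] by simp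
    then show "(\<lambda>n. sqrt (T_comp w x (ks n) (mat 1) $ j $ j)) \<longlonglongrightarrow> 0"
      using tendsto_real_sqrt by fastforce
  qed
  then have "g \<longlonglongrightarrow> 0" by (intro vec_tendstoI) simp
  moreover have "continuous_on UNIV (\<lambda>g. transpose g ** z ** (g :: real^'d^'d))" by (intro continuous_intros)
  ultimately have "(\<lambda>n. transpose (g n) ** z ** g n) \<longlonglongrightarrow> transpose 0 ** z ** 0"
    by (intro continuous_on_tendsto_compose[of UNIV "\<lambda>g. transpose g ** z ** g"]) auto
  moreover have "transpose (0 :: real^'d^'d) ** z ** 0 = 0" by (simp add: matrix_matrix_mult_def vec_eq_iff)
  ultimately show ?thesis by (simp add: g)
qed

text \<open>Here \<open>w\<close> is measurable on all matrices and the \<open>X n\<close> are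
  positive definite at every sample point; the main result reaches this form by extending
  \<open>w\<close>.\<close>

locale perpetuity = prob_space M
  for M :: "'a measure" +
  fixes B :: "(real^'d^'d) measure" and w :: "real^'d^'d \<Rightarrow> real^'d^'d" and X :: "nat \<Rightarrow> 'a \<Rightarrow> real^'d^'d"
  assumes prob_B: "prob_space B" and sets_B [measurable_cong, simp]: "sets B = sets borel"
    and w_meas [measurable]: "w \<in> borel_measurable borel"
    and w_root: "\<And>x. x \<in> posdef \<Longrightarrow> transpose (w x) ** w x = x"
    and X_indep: "indep_vars (\<lambda>_. borel) X {1..}"
    and X_distr: "\<And>n. n \<ge> 1 \<Longrightarrow> distr M borel (X n) = B"
    and X_posdef: "\<And>n \<omega>. n \<ge> 1 \<Longrightarrow> \<omega> \<in> space M \<Longrightarrow> X n \<omega> \<in> posdef"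
begin

abbreviation term_at :: "'a \<Rightarrow> nat \<Rightarrow> real^'d^'d" where
  "term_at \<omega> j \<equiv> T_iter w (\<lambda>n. X n \<omega>) (Suc j)"

abbreviation Z :: "'a \<Rightarrow> real^'d^'d" where
  "Z \<omega> \<equiv> Z_inf w (\<lambda>n. X n \<omega>)"

text \<open>The equation in distribution as a condition on a law alone: independence is encoded by
  the iterated integral, so the starting value need not be a random variable on
  \<open>M\<close>.\<close>

definition stationary :: "(real^'d^'d) measure \<Rightarrow> bool" where
  "stationary \<nu> \<longleftrightarrow> prob_space \<nu> \<and> sets \<nu> = sets borel \<and> (AE z in \<nu>. z \<in> posdef) \<and>
    (\<forall>F\<in>borel_measurable borel. (\<integral>\<^sup>+z. (\<integral>\<^sup>+y. F (T w y (mat 1 + z)) \<partial>B) \<partial>\<nu>) = (\<integral>\<^sup>+z. F z \<partial>\<nu>))"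

section \<open>Stationary laws and convergence of the series\<close>

lemma X_meas: "n \<ge> 1 \<Longrightarrow> X n \<in> borel_measurable M"
  using X_indep by (auto simp: indep_vars_def)

lemma term_meas [measurable]: "(\<lambda>\<omega>. term_at \<omega> j) \<in> borel_measurable M"
  unfolding T_iter_eq by (rule T_comp_measurable) (auto intro: X_meas)

lemma Z_meas [measurable]: "Z \<in> borel_measurable M"
  unfolding Z_inf_def by measurable

lemma term_possemidef: "term_at \<omega> j \<in> possemidef"
  unfolding T_iter_eq by (intro T_comp_possemidef posdef_possemidef posdef_mat1)

text \<open>The head of the list is the outermost map. Integrating its variable replaces
  \<open>F\<close> by an average \<open>?K\<close>; the induction hypothesis for \<open>?K\<close>
  removes the remaining maps, and stationarity removes the last average. Distinct indices ensure
  that the remaining maps do not involve that variable.\<close>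

lemma nn_integral_affine_comp_PiM:
  assumes \<nu>: "stationary \<nu>" and "distinct ks" and "F \<in> borel_measurable borel"
  shows "(\<integral>\<^sup>+z. (\<integral>\<^sup>+x. F (affine_comp w x ks z) \<partial>(\<Pi>\<^sub>M k\<in>set ks. B)) \<partial>\<nu>) = (\<integral>\<^sup>+z. F z \<partial>\<nu>)"
  using assms(2,3)
proof (induction ks arbitrary: F)
  case Nil
  show ?case by (simp add: affine_comp_def PiM_empty nn_integral_count_space_finite)
next
  case (Cons k ks)
  note [measurable] = Cons.prems(2)
  interpret B: prob_space B by (rule prob_B)
  interpret BP: product_sigma_finite "\<lambda>_ :: nat. B" by standard
  let ?K = "\<lambda>u. \<integral>\<^sup>+y. F (T w y (mat 1 + u)) \<partial>B"
  have K [measurable]: "?K \<in> borel_measurable borel"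
    by (rule B.borel_measurable_nn_integral) measurable
  have "(\<integral>\<^sup>+x. F (affine_comp w x (k # ks) z) \<partial>(\<Pi>\<^sub>M k\<in>set (k # ks). B))
    = (\<integral>\<^sup>+x. ?K (affine_comp w x ks z) \<partial>(\<Pi>\<^sub>M k\<in>set ks. B))" for z
  proof -
    have m: "(\<lambda>x. F (affine_comp w x (k # ks) z)) \<in> borel_measurable (\<Pi>\<^sub>M k\<in>insert k (set ks). B)"
    proof (rule measurable_compose[OF affine_comp_measurable Cons.prems(2)])
      fix j assume "j \<in> set (k # ks)"
      then show "(\<lambda>x. x j) \<in> borel_measurable (\<Pi>\<^sub>M k\<in>insert k (set ks). B)"
        using measurable_component_singleton[of j "insert k (set ks)" "\<lambda>_. B"] by (simp cong: measurable_cong_sets)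
    qed auto
    have "(\<integral>\<^sup>+x. F (affine_comp w x (k # ks) z) \<partial>(\<Pi>\<^sub>M k\<in>set (k # ks). B))
      = (\<integral>\<^sup>+x. (\<integral>\<^sup>+y. F (affine_comp w (x(k := y)) (k # ks) z) \<partial>B) \<partial>(\<Pi>\<^sub>M k\<in>set ks. B))"
      using BP.product_nn_integral_insert[OF _ _ m] Cons.prems(1) by simp
    also have "\<dots> = (\<integral>\<^sup>+x. ?K (affine_comp w x ks z) \<partial>(\<Pi>\<^sub>M k\<in>set ks. B))"
    proof (intro nn_integral_cong)
      fix x y
      have "affine_comp w (x(k := y)) ks z = affine_comp w x ks z"
        using Cons.prems(1) by (intro affine_comp_cong) auto
      then show "F (affine_comp w (x(k := y)) (k # ks) z) = F (T w y (mat 1 + affine_comp w x ks z))"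
        by (simp add: affine_comp_def)
    qed
    finally show ?thesis .
  qed
  then have "(\<integral>\<^sup>+z. (\<integral>\<^sup>+x. F (affine_comp w x (k # ks) z) \<partial>(\<Pi>\<^sub>M k\<in>set (k # ks). B)) \<partial>\<nu>)
    = (\<integral>\<^sup>+z. (\<integral>\<^sup>+x. ?K (affine_comp w x ks z) \<partial>(\<Pi>\<^sub>M k\<in>set ks. B)) \<partial>\<nu>)" by simp
  also have "\<dots> = (\<integral>\<^sup>+z. ?K z \<partial>\<nu>)" using Cons.prems(1) by (intro Cons.IH K) simp
  also have "\<dots> = (\<integral>\<^sup>+z. F z \<partial>\<nu>)" using \<nu> Cons.prems(2) by (simp add: stationary_def)
  finally show ?case .
qed

lemma nn_integral_affine_comp:
  assumes \<nu>: "stationary \<nu>" and F: "F \<in> borel_measurable borel"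
  shows "(\<integral>\<^sup>+z. (\<integral>\<^sup>+\<omega>. F (affine_comp w (\<lambda>k. X k \<omega>) [1..<Suc (Suc n)] z) \<partial>M) \<partial>\<nu>) = (\<integral>\<^sup>+z. F z \<partial>\<nu>)"
proof -
  \<comment> \<open>The list has n + 1 entries: the description of independence by a product law is
    applied to a non-empty index set.\<close>
  define ks where "ks = [1..<Suc (Suc n)]"
  have ks: "set ks \<subseteq> {1..}" "distinct ks" "set ks \<noteq> {}" by (auto simp: ks_def)
  have Xm: "\<And>k. k \<in> set ks \<Longrightarrow> X k \<in> borel_measurable M" using ks(1) X_meas by auto
  have "distr M (\<Pi>\<^sub>M k\<in>set ks. borel) (\<lambda>\<omega>. \<lambda>k\<in>set ks. X k \<omega>) = (\<Pi>\<^sub>M k\<in>set ks. distr M borel (X k))"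
    using indep_vars_subset[OF X_indep ks(1)] by (subst (asm) indep_vars_iff_distr_eq_PiM'[OF ks(3) Xm]) auto
  also have "\<dots> = (\<Pi>\<^sub>M k\<in>set ks. B)" using ks(1) by (intro PiM_cong refl X_distr) auto
  finally have d: "distr M (\<Pi>\<^sub>M k\<in>set ks. borel) (\<lambda>\<omega>. \<lambda>k\<in>set ks. X k \<omega>) = (\<Pi>\<^sub>M k\<in>set ks. B)" .
  have "(\<integral>\<^sup>+\<omega>. F (affine_comp w (\<lambda>k. X k \<omega>) ks z) \<partial>M) = (\<integral>\<^sup>+x. F (affine_comp w x ks z) \<partial>(\<Pi>\<^sub>M k\<in>set ks. B))" for z
  proof -
    have "(\<integral>\<^sup>+x. F (affine_comp w x ks z) \<partial>(\<Pi>\<^sub>M k\<in>set ks. B))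
      = (\<integral>\<^sup>+\<omega>. F (affine_comp w (\<lambda>k\<in>set ks. X k \<omega>) ks z) \<partial>M)"
    proof -
      have m: "(\<lambda>\<omega>. \<lambda>k\<in>set ks. X k \<omega>) \<in> measurable M (\<Pi>\<^sub>M k\<in>set ks. borel)"
        by (intro measurable_restrict Xm)
      have "(\<lambda>x. F (affine_comp w x ks z)) \<in> borel_measurable (\<Pi>\<^sub>M k\<in>set ks. borel)"
        by (rule measurable_compose[OF affine_comp_measurable F]) (auto intro: measurable_component_singleton)
      then have "(\<lambda>x. F (affine_comp w x ks z)) \<in> borel_measurable
          (distr M (\<Pi>\<^sub>M k\<in>set ks. borel) (\<lambda>\<omega>. \<lambda>k\<in>set ks. X k \<omega>))" by simp
      from nn_integral_distr[OF m this] show ?thesis unfolding d .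
    qed
    also have "\<dots> = (\<integral>\<^sup>+\<omega>. F (affine_comp w (\<lambda>k. X k \<omega>) ks z) \<partial>M)"
      by (intro nn_integral_cong arg_cong[where f=F] affine_comp_cong) simp
    finally show ?thesis ..
  qed
  then show ?thesis using nn_integral_affine_comp_PiM[OF \<nu> ks(2) F] by (simp add: ks_def)
qed

lemma emeasure_partial_sum_le:
  assumes \<nu>: "stationary \<nu>"
  shows "emeasure M {\<omega>\<in>space M. r < trace (\<Sum>j<Suc n. term_at \<omega> j)} \<le> emeasure \<nu> {x. r < trace x}"
proof -
  interpret \<nu>: prob_space \<nu> using \<nu> by (simp add: stationary_def)
  have sets_\<nu> [measurable_cong, simp]: "sets \<nu> = sets borel" using \<nu> by (simp add: stationary_def)
  have "emeasure M {\<omega>\<in>space M. r < trace (\<Sum>j<Suc n. term_at \<omega> j)}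
    = (\<integral>\<^sup>+\<omega>. indicator {x. r < trace x} (\<Sum>j<Suc n. term_at \<omega> j) \<partial>M)"
  proof -
    have "emeasure M {\<omega>\<in>space M. r < trace (\<Sum>j<Suc n. term_at \<omega> j)}
      = (\<integral>\<^sup>+\<omega>. indicator {\<omega>\<in>space M. r < trace (\<Sum>j<Suc n. term_at \<omega> j)} \<omega> \<partial>M)"
      by (subst nn_integral_indicator) (simp_all del: sum.lessThan_Suc)
    also have "\<dots> = (\<integral>\<^sup>+\<omega>. indicator {x. r < trace x} (\<Sum>j<Suc n. term_at \<omega> j) \<partial>M)"
      by (intro nn_integral_cong) (simp add: indicator_def del: sum.lessThan_Suc)
    finally show ?thesis .
  qed
  \<comment> \<open>Averaging a constant over the probability measure \<open>\<nu>\<close>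
    introduces the starting value z, so that the partial sum can be compared with the iterate
    started at z.\<close>
  also have "\<dots> = (\<integral>\<^sup>+z. (\<integral>\<^sup>+\<omega>. indicator {x. r < trace x} (\<Sum>j<Suc n. term_at \<omega> j) \<partial>M) \<partial>\<nu>)"
    by (simp add: \<nu>.emeasure_space_1 del: sum.lessThan_Suc)
  also have "\<dots> \<le> (\<integral>\<^sup>+z. (\<integral>\<^sup>+\<omega>. indicator {x. r < trace x} (affine_comp w (\<lambda>k. X k \<omega>) [1..<Suc (Suc n)] z) \<partial>M) \<partial>\<nu>)"
  proof (rule nn_integral_mono_AE)
    have "AE z in \<nu>. z \<in> posdef" using \<nu> by (simp add: stationary_def)
    then show "AE z in \<nu>. (\<integral>\<^sup>+\<omega>. indicator {x. r < trace x} (\<Sum>j<Suc n. term_at \<omega> j) \<partial>M)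
      \<le> (\<integral>\<^sup>+\<omega>. indicator {x. r < trace x} (affine_comp w (\<lambda>k. X k \<omega>) [1..<Suc (Suc n)] z) \<partial>M)"
    proof eventually_elim
      fix z :: "real^'d^'d" assume "z \<in> posdef"
      then have "trace (\<Sum>j<Suc n. term_at \<omega> j) \<le> trace (affine_comp w (\<lambda>k. X k \<omega>) [1..<Suc (Suc n)] z)" for \<omega>
        unfolding affine_comp_T_iter trace_add
        using possemidef_trace_nonneg[OF T_comp_possemidef[OF posdef_possemidef]] by (simp del: upt_Suc sum.lessThan_Suc)
      then show "(\<integral>\<^sup>+\<omega>. indicator {x. r < trace x} (\<Sum>j<Suc n. term_at \<omega> j) \<partial>M)
        \<le> (\<integral>\<^sup>+\<omega>. indicator {x. r < trace x} (affine_comp w (\<lambda>k. X k \<omega>) [1..<Suc (Suc n)] z) \<partial>M)"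
        by (intro nn_integral_mono) (auto simp: indicator_def simp del: upt_Suc sum.lessThan_Suc intro: less_le_trans)
    qed
  qed
  also have "\<dots> = (\<integral>\<^sup>+z. indicator {x. r < trace x} z \<partial>\<nu>)"
    by (rule nn_integral_affine_comp[OF \<nu>]) measurable
  also have "\<dots> = emeasure \<nu> {x. r < trace x}" by simp
  finally show ?thesis .
qed


text \<open>The traces of the partial sums increase, so their tail bound, uniform in n, passes to
  the extended sum \<open>s\<close> by continuity from below. The event that \<open>s\<close> is
  infinite then has probability at most \<nu>(trace > n) for all n, which tends to 0.\<close>

lemma AE_summable:
  assumes \<nu>: "stationary \<nu>"
  shows "AE \<omega> in M. summable (term_at \<omega>)"
proof -
  interpret \<nu>: prob_space \<nu> using \<nu> by (simp add: stationary_def)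
  have sets_\<nu> [measurable_cong, simp]: "sets \<nu> = sets borel" using \<nu> by (simp add: stationary_def)
  have tr: "0 \<le> trace (term_at \<omega> j)" for \<omega> j by (rule possemidef_trace_nonneg[OF term_possemidef])
  define s where "s \<omega> = (\<Sum>j. ennreal (trace (term_at \<omega> j)))" for \<omega>
  have s_meas [measurable]: "s \<in> borel_measurable M" unfolding s_def by measurable
  have trace_sum: "ennreal (trace (\<Sum>j<n. term_at \<omega> j)) = (\<Sum>j<n. ennreal (trace (term_at \<omega> j)))" for n \<omega>
  proof -
    have "trace (\<Sum>j<n. term_at \<omega> j) = (\<Sum>j<n. trace (term_at \<omega> j))"
      unfolding trace_def by (simp, rule sum.swap)
    then show ?thesis using tr by simp
  qed
  have le: "emeasure M {\<omega>\<in>space M. ennreal r < s \<omega>} \<le> emeasure \<nu> {x. r < trace x}" if r: "r \<ge> 0" for r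
  proof -
    let ?A = "\<lambda>n. {\<omega>\<in>space M. r < trace (\<Sum>j<Suc n. term_at \<omega> j)}"
    have gt: "ennreal r < ennreal t \<longleftrightarrow> r < t" for t using r by (simp add: ennreal_less_iff)
    have mono: "(\<Sum>j<m. ennreal (trace (term_at \<omega> j))) \<le> (\<Sum>j<n. ennreal (trace (term_at \<omega> j)))" if "m \<le> n" for m n \<omega>
      using that by (intro sum_mono2) auto
    have "incseq ?A"
      unfolding gt[symmetric] trace_sum by (auto simp: incseq_def simp del: sum.lessThan_Suc intro: less_le_trans mono)
    have "{\<omega>\<in>space M. ennreal r < s \<omega>} = (\<Union>n. ?A n)"
    proof (intro equalityI subsetI)
      fix \<omega> assume \<omega>: "\<omega> \<in> {\<omega>\<in>space M. ennreal r < s \<omega>}"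
      then obtain n where "ennreal r < (\<Sum>j<n. ennreal (trace (term_at \<omega> j)))"
        unfolding s_def suminf_eq_SUP by (auto simp: less_SUP_iff)
      also have "\<dots> \<le> (\<Sum>j<Suc n. ennreal (trace (term_at \<omega> j)))" by (rule mono) simp
      finally show "\<omega> \<in> (\<Union>n. ?A n)" using \<omega> unfolding trace_sum[symmetric] gt by blast
    next
      fix \<omega> assume "\<omega> \<in> (\<Union>n. ?A n)"
      then obtain n where "\<omega> \<in> space M" "r < trace (\<Sum>j<Suc n. term_at \<omega> j)" by blast
      moreover from this have "ennreal r < (\<Sum>j<Suc n. ennreal (trace (term_at \<omega> j)))"
        unfolding trace_sum[symmetric] gt by blast
      moreover have "(\<Sum>j<Suc n. ennreal (trace (term_at \<omega> j))) \<le> s \<omega>"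
        unfolding s_def by (rule sum_le_suminf) auto
      ultimately show "\<omega> \<in> {\<omega>\<in>space M. ennreal r < s \<omega>}" by (auto intro: less_le_trans)
    qed
    also have "emeasure M (\<Union>n. ?A n) = (SUP n. emeasure M (?A n))"
      using \<open>incseq ?A\<close> by (intro SUP_emeasure_incseq[symmetric]) auto
    also have "\<dots> \<le> emeasure \<nu> {x. r < trace x}"
      by (intro SUP_least emeasure_partial_sum_le[OF \<nu>])
    finally show ?thesis .
  qed
  have "(\<lambda>n. emeasure \<nu> {x. real n < trace x}) \<longlonglongrightarrow> emeasure \<nu> (\<Inter>n. {x. real n < trace x})"
    by (rule Lim_emeasure_decseq) (auto simp: decseq_def \<nu>.emeasure_eq_measure)
  moreover have "(\<Inter>n. {x :: real^'d^'d. real n < trace x}) = {}"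
    by (auto dest: less_asym) (metis less_asym reals_Archimedean2)
  ultimately have "(\<lambda>n. emeasure \<nu> {x. real n < trace x}) \<longlonglongrightarrow> 0" by simp
  moreover have "emeasure M {\<omega>\<in>space M. s \<omega> = \<infinity>} \<le> emeasure \<nu> {x. real n < trace x}" for n
    by (rule order.trans[OF emeasure_mono le]) auto
  ultimately have "emeasure M {\<omega>\<in>space M. s \<omega> = \<infinity>} \<le> 0"
    by (intro LIMSEQ_le_const) auto
  then have "AE \<omega> in M. s \<omega> \<noteq> \<infinity>" by (intro AE_I[of _ _ "{\<omega>\<in>space M. s \<omega> = \<infinity>}"]) auto
  then show ?thesis
  proof eventually_elim
    fix \<omega> assume "s \<omega> \<noteq> \<infinity>"
    then have "summable (\<lambda>j. trace (term_at \<omega> j))"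
      unfolding s_def using tr by (intro summable_suminf_not_top) auto
    then have "summable (\<lambda>j. real CARD('d) * (real CARD('d) * trace (term_at \<omega> j)))" by (intro summable_mult)
    then show "summable (term_at \<omega>)"
      by (rule summable_comparison_test'[where N=0]) (rule possemidef_norm_le[OF term_possemidef])
  qed
qed

text \<open>A limit of partial sums is only semidefinite; strictness comes from the first term,
  which equals \<open>X 1\<close> because T maps I to its index.\<close>

lemma Z_posdef:
  assumes \<omega>: "\<omega> \<in> space M" and s: "summable (term_at \<omega>)"
  shows "Z \<omega> \<in> posdef"
proof (rule posdefI)
  have sums: "term_at \<omega> sums Z \<omega>" unfolding Z_inf_def using s by (rule summable_sums)
  have psd: "transpose (term_at \<omega> j) = term_at \<omega> j" "0 \<le> v \<bullet> (term_at \<omega> j *v v)" for j v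
    using term_possemidef[of \<omega> j] by (auto simp: possemidef_def)
  have "bounded_linear (transpose :: real^'d^'d \<Rightarrow> real^'d^'d)"
    by (intro linear_conv_bounded_linear[THEN iffD1] linearI) (simp_all add: transpose_add transpose_scalar)
  from bounded_linear.sums[OF this sums] have "term_at \<omega> sums transpose (Z \<omega>)" by (simp add: psd)
  then show "transpose (Z \<omega>) = Z \<omega>" using sums sums_unique2 by blast
  fix v :: "real^'d" assume v: "v \<noteq> 0"
  have "bounded_linear (\<lambda>x :: real^'d^'d. v \<bullet> (x *v v))"
    by (intro linear_conv_bounded_linear[THEN iffD1] linearI)
      (simp_all add: matrix_vector_mult_add_rdistrib inner_add_right scaleR_matrix_vector_assoc[symmetric])
  from bounded_linear.sums[OF this sums] have q: "(\<lambda>j. v \<bullet> (term_at \<omega> j *v v)) sums (v \<bullet> (Z \<omega> *v v))" .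
  have "term_at \<omega> 0 = X 1 \<omega>"
    using w_root[OF X_posdef[of 1 \<omega>]] \<omega> by (simp add: T_iter_def T_def)
  then have "0 < v \<bullet> (term_at \<omega> 0 *v v)" using X_posdef[of 1 \<omega>] \<omega> v by (simp add: posdef_pos)
  also have "\<dots> = (\<Sum>j\<in>{0}. v \<bullet> (term_at \<omega> j *v v))" by simp
  also have "\<dots> \<le> (\<Sum>j. v \<bullet> (term_at \<omega> j *v v))"
    using q psd by (intro sum_le_suminf) (auto simp: sums_iff)
  also have "\<dots> = v \<bullet> (Z \<omega> *v v)" using q by (simp add: sums_iff)
  finally show "0 < v \<bullet> (Z \<omega> *v v)" .
qed

lemma distr_Z_eq:
  assumes \<nu>: "stationary \<nu>"
  shows "distr M borel Z = \<nu>"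
proof (rule measure_eqI_continuous)
  show "prob_space (distr M borel Z)" by (rule prob_space_distr) measurable
  show "prob_space \<nu>" and sets_\<nu> [measurable_cong, simp]: "sets \<nu> = sets borel"
    using \<nu> by (auto simp: stationary_def)
  interpret \<nu>: prob_space \<nu> by fact
  fix f :: "real^'d^'d \<Rightarrow> real" assume cont: "continuous_on UNIV f" and f: "\<And>x. 0 \<le> f x \<and> f x \<le> 1"
  have [measurable]: "f \<in> borel_measurable borel" by (rule borel_measurable_continuous_onI[OF cont])
  let ?R = "\<lambda>n z \<omega>. affine_comp w (\<lambda>k. X k \<omega>) [1..<Suc (Suc n)] z"
  have R_meas: "(\<lambda>p. ?R n (fst p) (snd p)) \<in> borel_measurable (\<nu> \<Otimes>\<^sub>M M)" for n
    by (rule affine_comp_measurable) (auto intro!: measurable_compose[OF measurable_snd] X_meas)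
  have R_lim: "AE \<omega> in M. \<forall>z. (\<lambda>n. ?R n z \<omega>) \<longlonglongrightarrow> Z \<omega>"
    using AE_summable[OF \<nu>]
  proof eventually_elim
    fix \<omega> assume s: "summable (term_at \<omega>)"
    have "(\<lambda>n. T_comp w (\<lambda>k. X k \<omega>) [1..<Suc (Suc n)] z) \<longlonglongrightarrow> 0" for z
      using summable_LIMSEQ_zero[OF s] unfolding T_iter_eq by (rule T_comp_tendsto_0)
    moreover have "(\<lambda>n. \<Sum>j<Suc n. term_at \<omega> j) \<longlonglongrightarrow> Z \<omega>"
      unfolding Z_inf_def using LIMSEQ_Suc[OF summable_LIMSEQ[OF s]] .
    ultimately have "(\<lambda>n. ?R n z \<omega>) \<longlonglongrightarrow> Z \<omega> + 0" for z
      unfolding affine_comp_T_iter by (intro tendsto_add)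
    then show "\<forall>z. (\<lambda>n. ?R n z \<omega>) \<longlonglongrightarrow> Z \<omega>" by simp
  qed
  \<comment> \<open>The limit is taken first over \<open>\<omega>\<close> with z fixed, then over z;
    the constant 1 dominates both times.\<close>
  have inner: "(\<lambda>n. \<integral>\<^sup>+\<omega>. ennreal (f (?R n z \<omega>)) \<partial>M) \<longlonglongrightarrow> (\<integral>\<^sup>+\<omega>. ennreal (f (Z \<omega>)) \<partial>M)" for z
  proof (rule nn_integral_dominated_convergence[where w="\<lambda>_. 1"])
    show "(\<lambda>\<omega>. ennreal (f (?R n z \<omega>))) \<in> borel_measurable M" for n
      by (rule measurable_compose[OF affine_comp_measurable]) (auto intro: X_meas)
    show "AE \<omega> in M. (\<lambda>n. ennreal (f (?R n z \<omega>))) \<longlonglongrightarrow> ennreal (f (Z \<omega>))"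
      using R_lim
      by eventually_elim (auto intro!: tendsto_ennrealI continuous_on_tendsto_compose[OF cont] simp del: upt_Suc)
  qed (use f in \<open>auto simp: emeasure_space_1\<close>)
  have "(\<lambda>n. \<integral>\<^sup>+z. (\<integral>\<^sup>+\<omega>. ennreal (f (?R n z \<omega>)) \<partial>M) \<partial>\<nu>) \<longlonglongrightarrow> (\<integral>\<^sup>+z. (\<integral>\<^sup>+\<omega>. ennreal (f (Z \<omega>)) \<partial>M) \<partial>\<nu>)"
  proof (rule nn_integral_dominated_convergence[where w="\<lambda>_. 1"])
    show "(\<lambda>z. \<integral>\<^sup>+\<omega>. ennreal (f (?R n z \<omega>)) \<partial>M) \<in> borel_measurable \<nu>" for n
      using borel_measurable_nn_integral_fst[of "\<lambda>p. ennreal (f (?R n (fst p) (snd p)))" \<nu>] R_meas[of n] by simp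
    show "AE z in \<nu>. (\<integral>\<^sup>+\<omega>. ennreal (f (?R n z \<omega>)) \<partial>M) \<le> 1" for n
    proof (rule AE_I2)
      fix z
      have "(\<integral>\<^sup>+\<omega>. ennreal (f (?R n z \<omega>)) \<partial>M) \<le> (\<integral>\<^sup>+\<omega>. 1 \<partial>M)" using f by (intro nn_integral_mono) auto
      then show "(\<integral>\<^sup>+\<omega>. ennreal (f (?R n z \<omega>)) \<partial>M) \<le> 1" by (simp add: emeasure_space_1)
    qed
  qed (use inner in \<open>auto simp: \<nu>.emeasure_space_1\<close>)
  \<comment> \<open>By stationarity the double integrals form a constant sequence, so the limit just
    computed is their common value.\<close>
  moreover have "(\<integral>\<^sup>+z. (\<integral>\<^sup>+\<omega>. ennreal (f (?R n z \<omega>)) \<partial>M) \<partial>\<nu>) = (\<integral>\<^sup>+z. ennreal (f z) \<partial>\<nu>)" for n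
    by (rule nn_integral_affine_comp[OF \<nu>, of "\<lambda>x. ennreal (f x)"]) measurable
  ultimately have "(\<integral>\<^sup>+z. ennreal (f z) \<partial>\<nu>) = (\<integral>\<^sup>+\<omega>. ennreal (f (Z \<omega>)) \<partial>M)"
    by (simp add: LIMSEQ_const_iff \<nu>.emeasure_space_1 del: upt_Suc)
  then show "(\<integral>\<^sup>+x. ennreal (f x) \<partial>distr M borel Z) = (\<integral>\<^sup>+x. ennreal (f x) \<partial>\<nu>)"
    by (subst nn_integral_distr) auto
qed simp

end

section \<open>From laws back to random variables\<close>

lemma (in perpetuity) stationary_BetaII:
  assumes \<alpha>: "\<alpha> > (real CARD('d) - 1) / 2" and \<beta>: "\<beta> - \<alpha> > (real CARD('d) - 1) / 2"
    and B: "B = BetaII \<alpha> \<beta>"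
  shows "stationary (BetaII \<alpha> (\<beta> - \<alpha>))"
proof -
  let ?\<nu> = "BetaII \<alpha> (\<beta> - \<alpha>) :: (real^'d^'d) measure"
  interpret B: prob_space B by (rule prob_B)
  interpret \<nu>: prob_space ?\<nu> by (rule prob_space_BetaII[OF \<alpha> \<beta>])
  interpret pair_sigma_finite B ?\<nu> ..
  have "(\<integral>\<^sup>+z. (\<integral>\<^sup>+y. F (T w y (mat 1 + z)) \<partial>B) \<partial>?\<nu>) = (\<integral>\<^sup>+z. F z \<partial>?\<nu>)"
    if [measurable]: "F \<in> borel_measurable borel" for F
  proof -
    have "(\<integral>\<^sup>+z. (\<integral>\<^sup>+y. F (T w y (mat 1 + z)) \<partial>B) \<partial>?\<nu>) = (\<integral>\<^sup>+y. (\<integral>\<^sup>+z. F (T w y (mat 1 + z)) \<partial>?\<nu>) \<partial>B)"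
      by (rule Fubini') measurable
    also have "\<dots> = (\<integral>\<^sup>+z. F z \<partial>?\<nu>)"
      unfolding B by (rule BetaII_fixed_point[OF \<alpha> \<beta> that w_meas w_root])
    finally show ?thesis .
  qed
  then show ?thesis by (simp add: stationary_def prob_space_BetaII[OF \<alpha> \<beta>] AE_BetaII)
qed

lemma T_eq: "w y = w' y \<Longrightarrow> T w y x = T w' y x"
  by (simp add: T_def)

text \<open>Links the equation between random variables with the iterated integrals of
  \<open>stationary\<close>. As \<open>Y\<close> takes values in \<open>posdef\<close> at every
  point, the partially specified \<open>w\<close> may be replaced by its measurable extension
  \<open>w'\<close>.\<close>

lemma nn_integral_T_indep:
  fixes w w' :: "real^'d^'d \<Rightarrow> real^'d^'d"
  assumes N: "prob_space N" "prob_space.indep_var N posdef_borel Y posdef_borel V"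
    and [measurable]: "w' \<in> borel_measurable borel" and w': "\<And>x. x \<in> posdef \<Longrightarrow> w x = w' x"
    and [measurable]: "F \<in> borel_measurable borel"
  shows "(\<lambda>\<omega>. T w (Y \<omega>) (mat 1 + V \<omega>)) \<in> borel_measurable N" (is ?meas)
    and "(\<integral>\<^sup>+\<omega>. F (T w (Y \<omega>) (mat 1 + V \<omega>)) \<partial>N)
      = (\<integral>\<^sup>+z. (\<integral>\<^sup>+y. F (T w' y (mat 1 + z)) \<partial>distr N borel Y) \<partial>distr N borel V)" (is ?int)
proof -
  interpret N: prob_space N by fact
  have id: "(\<lambda>x. x) \<in> borel_measurable (posdef_borel :: (real^'d^'d) measure)"
    by (rule measurable_restrict_space1) simp
  have "N.indep_var borel ((\<lambda>x. x) \<circ> Y) borel ((\<lambda>x. x) \<circ> V)" by (rule N.indep_var_compose[OF N(2) id id])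
  then have ind: "N.indep_var borel Y borel V" by (simp add: comp_def)
  have [measurable]: "Y \<in> borel_measurable N" "V \<in> borel_measurable N"
    using N.indep_var_rv1[OF ind] N.indep_var_rv2[OF ind] by auto
  have "Y \<omega> \<in> posdef" if "\<omega> \<in> space N" for \<omega>
    using measurable_space[OF N.indep_var_rv1[OF N(2)] that] by (simp add: space_restrict_space)
  then have eq: "T w (Y \<omega>) x = T w' (Y \<omega>) x" if "\<omega> \<in> space N" for \<omega> x using that by (intro T_eq w')
  show ?meas by (subst measurable_cong[OF eq]) measurable
  interpret DY: prob_space "distr N borel Y" by (rule N.prob_space_distr) simp
  interpret DV: prob_space "distr N borel V" by (rule N.prob_space_distr) simp
  interpret pair_sigma_finite "distr N borel Y" "distr N borel V" ..
  have m: "(\<lambda>p. F (T w' (fst p) (mat 1 + snd p))) \<in> borel_measurable (borel \<Otimes>\<^sub>M borel)" by measurable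
  have "(\<integral>\<^sup>+\<omega>. F (T w (Y \<omega>) (mat 1 + V \<omega>)) \<partial>N) = (\<integral>\<^sup>+\<omega>. F (T w' (fst (Y \<omega>, V \<omega>)) (mat 1 + snd (Y \<omega>, V \<omega>))) \<partial>N)"
    by (intro nn_integral_cong) (simp add: eq)
  also have "\<dots> = (\<integral>\<^sup>+p. F (T w' (fst p) (mat 1 + snd p)) \<partial>distr N (borel \<Otimes>\<^sub>M borel) (\<lambda>\<omega>. (Y \<omega>, V \<omega>)))"
    using m by (intro nn_integral_distr[symmetric]) simp_all
  also have "distr N (borel \<Otimes>\<^sub>M borel) (\<lambda>\<omega>. (Y \<omega>, V \<omega>)) = distr N borel Y \<Otimes>\<^sub>M distr N borel V"
    using ind unfolding N.indep_var_distribution_eq by simp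
  also have "(\<integral>\<^sup>+p. F (T w' (fst p) (mat 1 + snd p)) \<partial>(distr N borel Y \<Otimes>\<^sub>M distr N borel V))
    = (\<integral>\<^sup>+y. (\<integral>\<^sup>+z. F (T w' y (mat 1 + z)) \<partial>distr N borel V) \<partial>distr N borel Y)"
  proof -
    have "(\<lambda>p. F (T w' (fst p) (mat 1 + snd p))) \<in> borel_measurable (distr N borel Y \<Otimes>\<^sub>M distr N borel V)" by measurable
    from DV.nn_integral_fst[OF this] show ?thesis by simp
  qed
  also have "\<dots> = (\<integral>\<^sup>+z. (\<integral>\<^sup>+y. F (T w' y (mat 1 + z)) \<partial>distr N borel Y) \<partial>distr N borel V)"
    by (rule Fubini'[symmetric]) measurable
  finally show ?int .
qed

text \<open>\<open>solves_eq\<close> asks for variables that lie in \<open>posdef\<close>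
  everywhere, while a Beta law lives on all matrices. The restricted measures provide a probability
  space on which the coordinate maps have this property.\<close>

lemma prob_space_posdef_restrict:
  fixes B :: "(real^'d^'d) measure"
  assumes B: "prob_space B" "sets B = sets borel" "AE x in B. x \<in> posdef"
  shows "prob_space (restrict_space B posdef)" "sets (restrict_space B posdef) = sets posdef_borel"
    and "(\<lambda>x. x) \<in> borel_measurable (restrict_space B posdef)" "distr (restrict_space B posdef) borel (\<lambda>x. x) = B"
proof -
  interpret B: prob_space B by fact
  have P: "posdef \<in> sets B" using B(2) by simp
  then show "prob_space (restrict_space B posdef)"
    using B(3) B.emeasure_eq_1_AE[of posdef] by (intro prob_space_restrict_space) auto
  show "sets (restrict_space B posdef) = sets posdef_borel" by (rule sets_restrict_space_cong[OF B(2)])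
  show m: "(\<lambda>x. x) \<in> borel_measurable (restrict_space B posdef)"
    by (intro measurable_restrict_space1 measurable_ident_sets B(2))
  show "distr (restrict_space B posdef) borel (\<lambda>x. x) = B"
  proof (rule measure_eqI)
    fix A assume "A \<in> sets (distr (restrict_space B posdef) borel (\<lambda>x. x))"
    then have A: "A \<in> sets B" using B(2) by simp
    have "emeasure (distr (restrict_space B posdef) borel (\<lambda>x. x)) A = emeasure (restrict_space B posdef) (A \<inter> posdef)"
      using A B(2) sets_eq_imp_space_eq[OF B(2)] by (subst emeasure_distr[OF m]) (auto simp: space_restrict_space)
    also have "\<dots> = emeasure B (A \<inter> posdef)"
      using P by (intro emeasure_restrict_space) (auto simp: sets.Int_space_eq2)
    also have "\<dots> = emeasure B A" using B(3) A P by (intro emeasure_eq_AE) auto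
    finally show "emeasure (distr (restrict_space B posdef) borel (\<lambda>x. x)) A = emeasure B A" .
  qed (simp add: B(2))
qed

theorem proposition5p3:
  fixes \<alpha> \<beta> :: real
    and w :: "real^'d^'d \<Rightarrow> real^'d^'d"
    and M :: "'a measure"
    and X :: "nat \<Rightarrow> 'a \<Rightarrow> real^'d^'d"
  assumes "\<alpha> > (real CARD('d) - 1) / 2"
    and "\<beta> - \<alpha> > (real CARD('d) - 1) / 2"
    and "w \<in> measurable posdef_borel borel"
    and "\<And>x. x \<in> posdef \<Longrightarrow> invertible (w x)"
    and "\<And>x. x \<in> posdef \<Longrightarrow> x = transpose (w x) ** w x"
    and "prob_space M"
    and "prob_space.indep_vars M (\<lambda>_. posdef_borel) X {1..}"
    and "\<And>n. n \<ge> 1 \<Longrightarrow> distr M borel (X n) = BetaII \<alpha> \<beta>"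
  defines "Z \<equiv> \<lambda>\<omega>. Z_inf w (\<lambda>n. X n \<omega>)"
  shows "(AE \<omega> in M. summable (\<lambda>k. T_iter w (\<lambda>n. X n \<omega>) (Suc k)) \<and> Z \<omega> \<in> posdef) \<and>
    (\<exists>(N :: ((real^'d^'d) \<times> (real^'d^'d)) measure) Y Z'.
        solves_eq w \<alpha> \<beta> N Y Z' \<and> distr N borel Z' = distr M borel Z) \<and>
    (\<forall>(N :: 'b measure) Y Z'.
        solves_eq w \<alpha> \<beta> N Y Z' \<longrightarrow> distr N borel Z' = distr M borel Z) \<and>
    distr M borel Z = BetaII \<alpha> (\<beta> - \<alpha>)"
proof -
  note ab = assms(1,2)
  interpret M: prob_space M by fact
  \<comment> \<open>Off the cone any measurable value would do; this makes \<open>w'\<close> Borel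
    on all matrices.\<close>
  define w' where "w' x = (if x \<in> posdef then w x else mat 1)" for x
  have w'_eq: "w x = w' x" if "x \<in> posdef" for x using that by (simp add: w'_def)
  have w'_meas [measurable]: "w' \<in> borel_measurable borel"
    unfolding w'_def using assms(3) by (subst measurable_If_restrict_space_iff) auto
  have X_rv: "X n \<in> measurable M posdef_borel" if "n \<ge> 1" for n
    using assms(7) that unfolding M.indep_vars_def by auto
  have X_posdef: "X n \<omega> \<in> posdef" if "n \<ge> 1" "\<omega> \<in> space M" for n \<omega>
    using measurable_space[OF X_rv[OF that(1)] that(2)] by (simp add: space_restrict_space)
  let ?B = "BetaII \<alpha> \<beta> :: (real^'d^'d) measure" and ?\<nu> = "BetaII \<alpha> (\<beta> - \<alpha>) :: (real^'d^'d) measure"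
  have X_meas: "X n \<in> borel_measurable M" if "n \<ge> 1" for n
    using X_rv[OF that] by (simp add: measurable_restrict_space2_iff)
  interpret P: perpetuity M ?B w' X
  proof (rule perpetuity.intro[OF assms(6)], rule perpetuity_axioms.intro)
    show "prob_space ?B" using M.prob_space_distr[OF X_meas[of 1]] assms(8)[of 1] by simp
    show "transpose (w' x) ** w' x = x" if "x \<in> posdef" for x
      using assms(5)[OF that] w'_eq[OF that] by simp
    have "(\<lambda>x. x) \<in> borel_measurable (posdef_borel :: (real^'d^'d) measure)"
      by (rule measurable_restrict_space1) simp
    then show "M.indep_vars (\<lambda>_. borel) X {1..}"
      by (rule M.indep_vars_compose2[OF assms(7), of "\<lambda>_ x. x" "\<lambda>_. borel"])
    show "sets ?B = sets borel" by (rule sets_BetaII)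
    show "w' \<in> borel_measurable borel" by (rule w'_meas)
    show "distr M borel (X n) = ?B" if "n \<ge> 1" for n using that by (rule assms(8))
    show "X n \<omega> \<in> posdef" if "n \<ge> 1" "\<omega> \<in> space M" for n \<omega> using that by (rule X_posdef)
  qed
  have stat: "P.stationary ?\<nu>" by (rule P.stationary_BetaII[OF ab refl])
  have T_iter_eq': "T_iter w (\<lambda>n. X n \<omega>) k = T_iter w' (\<lambda>n. X n \<omega>) k" if "\<omega> \<in> space M" for \<omega> k
  proof -
    have "T w (X n \<omega>) = T w' (X n \<omega>)" if "n \<ge> 1" for n
      using w'_eq[OF X_posdef[OF that \<open>\<omega> \<in> space M\<close>]] by (simp add: T_def fun_eq_iff)
    then show ?thesis unfolding T_iter_def by (intro foldr_cong refl) (auto simp del: upt_Suc)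
  qed
  then have Z_eq: "Z \<omega> = P.Z \<omega>" if "\<omega> \<in> space M" for \<omega> using that by (simp add: Z_def Z_inf_def)
  have distr_Z: "distr M borel Z = distr M borel P.Z" by (rule distr_cong) (simp_all add: Z_eq)
  have law: "distr M borel Z = ?\<nu>" unfolding distr_Z by (rule P.distr_Z_eq[OF stat])
  have "AE \<omega> in M. summable (\<lambda>k. T_iter w (\<lambda>n. X n \<omega>) (Suc k)) \<and> Z \<omega> \<in> posdef"
    using P.AE_summable[OF stat] AE_space by eventually_elim (simp add: T_iter_eq' Z_eq P.Z_posdef)
  moreover have "\<exists>(N :: ((real^'d^'d) \<times> (real^'d^'d)) measure) Y Z'.
        solves_eq w \<alpha> \<beta> N Y Z' \<and> distr N borel Z' = distr M borel Z"
  proof -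
    let ?B' = "restrict_space ?B posdef" and ?\<nu>' = "restrict_space ?\<nu> posdef"
    note B' = prob_space_posdef_restrict[OF P.prob_B sets_BetaII AE_BetaII]
    note \<nu>' = prob_space_posdef_restrict[OF prob_space_BetaII[OF ab] sets_BetaII AE_BetaII]
    interpret B': prob_space ?B' by (rule B')
    interpret \<nu>': prob_space ?\<nu>' by (rule \<nu>')
    interpret pair_prob_space ?B' ?\<nu>' ..
    let ?N = "?B' \<Otimes>\<^sub>M ?\<nu>'"
    have fst: "distr ?N ?B' fst = ?B'" by (rule \<nu>'.distr_pair_fst)
    \<comment> \<open>The second marginal is reduced to a first marginal by swapping the
      factors.\<close>
    have snd: "distr ?N ?\<nu>' snd = ?\<nu>'" 
    proof -
      have "distr ?N ?\<nu>' snd = distr (distr (?\<nu>' \<Otimes>\<^sub>M ?B') ?N (\<lambda>(x, y). (y, x))) ?\<nu>' snd"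
        by (subst distr_pair_swap) (rule refl)
      also have "\<dots> = distr (?\<nu>' \<Otimes>\<^sub>M ?B') ?\<nu>' fst"
        by (subst distr_distr) (auto intro!: distr_cong simp: comp_def split_beta)
      also have "\<dots> = ?\<nu>'" by (rule B'.distr_pair_fst)
      finally show ?thesis .
    qed
    have Y: "distr ?N borel fst = ?B"
      using distr_distr[OF B'(3) measurable_fst, of ?\<nu>'] by (simp add: fst B'(4) comp_def)
    have V: "distr ?N borel snd = ?\<nu>"
      using distr_distr[OF \<nu>'(3) measurable_snd, of ?B'] by (simp add: snd \<nu>'(4) comp_def)
    have ind: "prob_space.indep_var ?N posdef_borel fst posdef_borel snd"
    proof -
      have "distr ?N posdef_borel fst = ?B'" "distr ?N posdef_borel snd = ?\<nu>'"
        using distr_cong[OF refl B'(2), of ?N fst fst] distr_cong[OF refl \<nu>'(2), of ?N snd snd] fst snd by auto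
      moreover have "distr ?N (posdef_borel \<Otimes>\<^sub>M posdef_borel) (\<lambda>x. (fst x, snd x)) = ?N"
        by (simp add: distr_id2 sets_pair_measure_cong[OF B'(2) \<nu>'(2)])
      ultimately show ?thesis
        unfolding indep_var_distribution_eq
        by (simp add: measurable_cong_sets[OF refl B'(2)[symmetric]] measurable_cong_sets[OF refl \<nu>'(2)[symmetric]])
    qed
    have "distr ?N borel (\<lambda>\<omega>. T w (fst \<omega>) (mat 1 + snd \<omega>)) = ?\<nu>"
    proof (rule measure_eqI)
      fix A assume "A \<in> sets (distr ?N borel (\<lambda>\<omega>. T w (fst \<omega>) (mat 1 + snd \<omega>)))"
      then have A [measurable]: "A \<in> sets borel" by simp
      note * = nn_integral_T_indep[OF prob_space_axioms ind w'_meas w'_eq borel_measurable_indicator[OF A]]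
      have "emeasure (distr ?N borel (\<lambda>\<omega>. T w (fst \<omega>) (mat 1 + snd \<omega>))) A
        = (\<integral>\<^sup>+x. indicator A x \<partial>distr ?N borel (\<lambda>\<omega>. T w (fst \<omega>) (mat 1 + snd \<omega>)))" by simp
      also have "\<dots> = (\<integral>\<^sup>+\<omega>. indicator A (T w (fst \<omega>) (mat 1 + snd \<omega>)) \<partial>?N)"
        by (rule nn_integral_distr[OF *(1)]) auto
      also have "\<dots> = (\<integral>\<^sup>+z. (\<integral>\<^sup>+y. indicator A (T w' y (mat 1 + z)) \<partial>?B) \<partial>?\<nu>)"
        using *(2) by (simp only: Y V)
      also have "\<dots> = (\<integral>\<^sup>+z. indicator A z \<partial>?\<nu>)" using stat by (simp add: P.stationary_def)
      also have "\<dots> = emeasure ?\<nu> A" by simp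
      finally show "emeasure (distr ?N borel (\<lambda>\<omega>. T w (fst \<omega>) (mat 1 + snd \<omega>))) A = emeasure ?\<nu> A" .
    qed simp
    with ind have "solves_eq w \<alpha> \<beta> ?N fst snd" by (simp add: solves_eq_def prob_space_axioms Y V)
    with V law show ?thesis by auto
  qed
  moreover have "\<forall>(N :: 'b measure) Y Z'. solves_eq w \<alpha> \<beta> N Y Z' \<longrightarrow> distr N borel Z' = distr M borel Z"
  proof (intro allI impI)
    fix N :: "'b measure" and Y Z' assume "solves_eq w \<alpha> \<beta> N Y Z'"
    then have N: "prob_space N" "prob_space.indep_var N posdef_borel Y posdef_borel Z'"
      and Y: "distr N borel Y = ?B"
      and eq: "distr N borel Z' = distr N borel (\<lambda>\<omega>. T w (Y \<omega>) (mat 1 + Z' \<omega>))"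
      by (auto simp: solves_eq_def)
    interpret N: prob_space N by fact
    note * = nn_integral_T_indep[OF N w'_meas w'_eq]
    have Z'_rv: "Z' \<in> measurable N posdef_borel" using N.indep_var_rv2[OF N(2)] .
    then have Z'_meas: "Z' \<in> borel_measurable N" by (simp add: measurable_restrict_space2_iff)
    have Z'_posdef: "Z' \<omega> \<in> posdef" if "\<omega> \<in> space N" for \<omega>
      using measurable_space[OF Z'_rv that] by (simp add: space_restrict_space)
    \<comment> \<open>Uniqueness follows from this alone, because \<open>P.distr_Z_eq\<close>
      identifies every stationary law with the law of the same variable \<open>P.Z\<close>.\<close>
    have "P.stationary (distr N borel Z')"
      unfolding P.stationary_def
    proof (intro conjI ballI)
      show "prob_space (distr N borel Z')" by (rule N.prob_space_distr[OF Z'_meas])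
      show "AE z in distr N borel Z'. z \<in> posdef"
        using Z'_meas Z'_posdef by (subst AE_distr_iff) auto
      fix F :: "real^'d^'d \<Rightarrow> ennreal" assume F: "F \<in> borel_measurable borel"
      have "(\<integral>\<^sup>+z. (\<integral>\<^sup>+y. F (T w' y (mat 1 + z)) \<partial>?B) \<partial>distr N borel Z') = (\<integral>\<^sup>+\<omega>. F (T w (Y \<omega>) (mat 1 + Z' \<omega>)) \<partial>N)"
        using *(2)[OF _ F] by (simp only: Y)
      also have "\<dots> = (\<integral>\<^sup>+z. F z \<partial>distr N borel (\<lambda>\<omega>. T w (Y \<omega>) (mat 1 + Z' \<omega>)))"
        by (rule nn_integral_distr[symmetric]) (use *(1)[OF _ F] F in auto)
      finally show "(\<integral>\<^sup>+z. (\<integral>\<^sup>+y. F (T w' y (mat 1 + z)) \<partial>?B) \<partial>distr N borel Z') = (\<integral>\<^sup>+z. F z \<partial>distr N borel Z')"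
        by (simp only: eq[symmetric])
    qed simp
    from P.distr_Z_eq[OF this] show "distr N borel Z' = distr M borel Z" by (simp only: distr_Z)
  qed
  ultimately show ?thesis using law by blast
qed

end
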